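(* Let $n\ge2$ and let $(S_1,\dots,S_{n-1},P)$ be a $\Gamma_n$-contraction on a Hilbert space $\mathcal H$. Let $\mathcal A$ be the strong operator limit of $\{P^{*k}P^k\}_{k\ge1}$ and $\mathcal A_*$ the strong operator limit of $\{P^kP^{*k}\}_{k\ge1}$. If $\mathcal A=\mathcal A^2$, then: (1) $\mathrm{Ker}(\mathcal A)$, $\mathrm{Ker}(I-\mathcal A)\cap\mathrm{Ker}(\mathcal A_* )$ and $\mathrm{Ker}(I-\mathcal A)\cap\mathrm{Ker}(I-\mathcal A_* )$ reduce $S_1,\dots,S_{n-1}$; (2) the restriction of $(S_1,\dots,S_{n-1},P)$ to $\mathrm{Ker}(\mathcal A)$ is a strongly stable $\Gamma_n$-contraction; (3) the restriction of $(S_1,\dots,S_{n-1},P)$ to $\mathrm{Ker}(I-\mathcal A)\cap\mathrm{Ker}(\mathcal A_* )$ is a pure $\Gamma_n$-isometry; (4) the restriction of $(S_1,\dots,S_{n-1},P)$ to $\mathrm{Ker}(I-\mathcal A)\cap\mathrm{Ker}(I-\mathcal A_* )$ is a $\Gamma_n$-unitary. Moreover, if $\mathcal A=\mathcal A^2$ and $\mathcal A_*=\mathcal A_*^2$, then: (1') the restriction of $(S_1,\dots,S_{n-1},P)$ to $\mathrm{Ker}(\mathcal A)\cap\mathrm{Ker}(\mathcal A_* )$ is a $\mathcal C_{00}$ $\Gamma_n$-contraction; (2') the restriction of $(S_1,\dots,S_{n-1},P)$ to $\mathrm{Ker}(\mathcal A)\cap\mathrm{Ker}(I-\mathcal A_*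 )$ is a $\Gamma_n$-contraction whose last component (the restriction of $P$) is a backward unilateral shift. Furthermore, if $\mathcal A=\mathcal A_*$, then: (1'') the restriction of $(S_1,\dots,S_{n-1},P)$ to $\mathrm{Ker}(\mathcal A)$ is a $\mathcal C_{00}$ $\Gamma_n$-contraction; (2'') the restriction of $(S_1,\dots,S_{n-1},P)$ to $\mathrm{Ker}(I-\mathcal A)$ is a $\Gamma_n$-unitary.
   Context: All operators are bounded linear operators on complex Hilbert spaces; subspaces are closed. A subspace reduces $T$ if it is invariant under $T$ and $T^*$. The subspaces occurring may be $\{0\}$. A compact set $K\subset\mathbb C^n$ is a spectral set for a commuting $n$-tuple $\underline T$ if the Taylor joint spectrum of $\underline T$ lies in $K$ and $\|f(\underline T)\|\le\sup_{K}|f|$ for every rational function $f$ with poles off $K$. The closed symmetrized polydisc is $\Gamma_n=\pi_n(\overline{\mathbb D}^n)$, where $\pi_n(z_1,\dots,z_n)=(\sum_i z_i,\sum_{i<j}z_iz_j,\dots,\prod_i z_i)$, and $b\Gamma_n=\pi_n(\mathbb T^n)$. A $\Gamma_n$-contraction is a commuting $n$-tuple $(S_1,\dots,S_{n-1},P)$ having $\Gamma_n$ as a spectral set (then $P$ is a contraction, so that $\{P^{*k}P^k\}$ and $\{P^kP^{*k}\}$ are non-increasing sequences of positive contractions and converge strongly). A $\Gamma_n$-unitary is a commuting tuple of normal operators with Taylor joint spectrum contained in $b\Gamma_n$. A $\Gamma_n$-isometry is the restriction of a $\Gamma_n$-unitary to a joint invariant subspace. An operator $P$ is strongly stable if $\|P^kx\|\to0$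 for all $x$. A $\Gamma_n$-contraction $(S_1,\dots,S_{n-1},P)$ is strongly stable if $P$ is strongly stable; pure if $P^*$ is strongly stable; $\mathcal C_{00}$ if both $P$ and $P^*$ are strongly stable. A pure $\Gamma_n$-isometry is a $\Gamma_n$-isometry that is a pure $\Gamma_n$-contraction. A unilateral shift (of arbitrary multiplicity) is an isometry whose adjoint is strongly stable; a backward unilateral shift is the adjoint of a unilateral shift. *)

theory Defs
  imports "HOL-Analysis.Analysis" "HOL-Library.Poly_Mapping"
begin

section \<open>Complex Hilbert spaces\<close>

text \<open>
  A complex Hilbert space is presented as a complete real inner product space (whose norm and
  topology are then those of the library) with a complex scalar multiplication and a sesquilinear
  form, linear in its first argument, whose real part is the given real inner product.
\<close>

class complex_hilbert = real_inner + complete_space +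
  fixes scaleC :: "complex \<Rightarrow> 'a \<Rightarrow> 'a"  (infixr \<open>*\<^sub>C\<close> 75)
    and cinner :: "'a \<Rightarrow> 'a \<Rightarrow> complex"
  assumes scaleC_add_right: "a *\<^sub>C (x + y) = a *\<^sub>C x + a *\<^sub>C y"
    and scaleC_add_left: "(a + b) *\<^sub>C x = a *\<^sub>C x + b *\<^sub>C x"
    and scaleC_scaleC: "a *\<^sub>C (b *\<^sub>C x) = (a * b) *\<^sub>C x"
    and scaleC_of_real: "complex_of_real r *\<^sub>C x = r *\<^sub>R x"
    and cinner_commute: "cinner x y = cnj (cinner y x)"
    and cinner_add_left: "cinner (x + y) z = cinner x z + cinner y z"
    and cinner_scaleC_left: "cinner (a *\<^sub>C x) y = a * cinner x y"
    and Re_cinner: "Re (cinner x y) = inner x y"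

lemma cinner_self: "cinner x x = complex_of_real ((norm x)\<^sup>2)"
  for x :: "'a::complex_hilbert"
proof (rule complex_eqI)
  show "Re (cinner x x) = Re (complex_of_real ((norm x)\<^sup>2))"
    by (simp add: Re_cinner power2_norm_eq_inner)
  have "Im (cinner x x) = - Im (cinner x x)"
    using arg_cong[OF cinner_commute[of x x], of Im] by simp
  then show "Im (cinner x x) = Im (complex_of_real ((norm x)\<^sup>2))" by simp
qed

lemma norm_scaleC: "norm (a *\<^sub>C x) = cmod a * norm x"
  for x :: "'a::complex_hilbert"
proof -
  have "cinner (a *\<^sub>C x) (a *\<^sub>C x) = a * cnj (cinner (a *\<^sub>C x) x)"
    by (metis cinner_commute cinner_scaleC_left)
  also have "\<dots> = (a * cnj a) * complex_of_real ((norm x)\<^sup>2)"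
    by (simp add: cinner_scaleC_left cinner_self)
  also have "\<dots> = complex_of_real ((cmod a * norm x)\<^sup>2)"
    by (simp only: complex_norm_square[symmetric] power_mult_distrib of_real_mult of_real_power)
  finally have "complex_of_real ((norm (a *\<^sub>C x))\<^sup>2) = complex_of_real ((cmod a * norm x)\<^sup>2)"
    by (simp only: cinner_self)
  then have "(norm (a *\<^sub>C x))\<^sup>2 = (cmod a * norm x)\<^sup>2"
    by (simp only: of_real_eq_iff)
  then show ?thesis
    by (rule power2_eq_imp_eq) simp_all
qed

lemma Im_cinner: "Im (cinner x y) = inner x (\<i> *\<^sub>C y)"
  for x :: "'a::complex_hilbert"
proof -
  have "cinner x (\<i> *\<^sub>C y) = cnj (\<i> * cinner y x)"
    by (metis cinner_commute cinner_scaleC_left)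
  also have "\<dots> = - \<i> * cinner x y"
    by (simp add: cinner_commute[of x y])
  finally show ?thesis by (simp flip: Re_cinner)
qed

instantiation complex :: complex_hilbert
begin

definition "a *\<^sub>C x = a * x" for a x :: complex
definition "cinner x y = x * cnj y" for x y :: complex

instance
  by standard
    (simp_all add: scaleC_complex_def cinner_complex_def algebra_simps scaleR_conv_of_real
      inner_complex_def)

end


section \<open>Square-summable sequences in a complex Hilbert space\<close>

typedef (overloaded) 'a ell2 = "{f :: nat \<Rightarrow> 'a::complex_hilbert. summable (\<lambda>n. (norm (f n))\<^sup>2)}"
  morphisms ell2_nth Abs_ell2
  by (rule exI[of _ "\<lambda>_. 0"]) simp

lemma summable_ell2: "summable (\<lambda>n. (norm (ell2_nth f n))\<^sup>2)"
  using ell2_nth[of f] by simp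

lemma ell2_nth_Abs: "summable (\<lambda>n. (norm (f n))\<^sup>2) \<Longrightarrow> ell2_nth (Abs_ell2 f) = f"
  by (simp add: Abs_ell2_inverse)

lemma ell2_eqI: "(\<And>n. ell2_nth f n = ell2_nth g n) \<Longrightarrow> f = g"
  by (metis ell2_nth_inject ext)

lemma summable_ell2_add:
  fixes f g :: "nat \<Rightarrow> 'a::complex_hilbert"
  assumes "summable (\<lambda>n. (norm (f n))\<^sup>2)" "summable (\<lambda>n. (norm (g n))\<^sup>2)"
  shows "summable (\<lambda>n. (norm (f n + g n))\<^sup>2)"
proof (rule summable_comparison_test')
  show "summable (\<lambda>n. 2 * ((norm (f n))\<^sup>2 + (norm (g n))\<^sup>2))"
    using assms by (intro summable_mult summable_add)
  show "norm ((norm (f n + g n))\<^sup>2) \<le> 2 * ((norm (f n))\<^sup>2 + (norm (g n))\<^sup>2)" for n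
  proof -
    have "(norm (f n + g n))\<^sup>2 \<le> (norm (f n) + norm (g n))\<^sup>2"
      by (intro power_mono norm_triangle_ineq) simp
    also have "\<dots> \<le> 2 * ((norm (f n))\<^sup>2 + (norm (g n))\<^sup>2)"
      using sum_squares_bound[of "norm (f n)" "norm (g n)"] by (simp add: power2_sum)
    finally show ?thesis by simp
  qed
qed

lemma summable_ell2_scaleC:
  fixes f :: "nat \<Rightarrow> 'a::complex_hilbert"
  assumes "summable (\<lambda>n. (norm (f n))\<^sup>2)"
  shows "summable (\<lambda>n. (norm (a *\<^sub>C f n))\<^sup>2)"
  using summable_mult[OF assms, of "(cmod a)\<^sup>2"] by (simp add: norm_scaleC power_mult_distrib)

lemma summable_ell2_cinner:
  fixes f g :: "nat \<Rightarrow> 'a::complex_hilbert"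
  assumes "summable (\<lambda>n. (norm (f n))\<^sup>2)" "summable (\<lambda>n. (norm (g n))\<^sup>2)"
  shows "summable (\<lambda>n. cinner (f n) (g n))"
proof (rule summable_comparison_test')
  show "summable (\<lambda>n. ((norm (f n))\<^sup>2 + (norm (g n))\<^sup>2))"
    using assms by (intro summable_add)
  show "norm (cinner (f n) (g n)) \<le> (norm (f n))\<^sup>2 + (norm (g n))\<^sup>2" for n
  proof -
    have 1: "\<bar>inner (f n) (g n)\<bar> \<le> norm (f n) * norm (g n)"
      by (rule Cauchy_Schwarz_ineq2)
    have 2: "\<bar>inner (f n) (\<i> *\<^sub>C g n)\<bar> \<le> norm (f n) * norm (g n)"
      using Cauchy_Schwarz_ineq2[of "f n" "\<i> *\<^sub>C g n"] by (simp add: norm_scaleC)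
    have "norm (cinner (f n) (g n)) \<le> 2 * norm (f n) * norm (g n)"
      using 1 2 cmod_le[of "cinner (f n) (g n)"] by (simp add: Re_cinner Im_cinner)
    also have "\<dots> \<le> (norm (f n))\<^sup>2 + (norm (g n))\<^sup>2"
      by (rule sum_squares_bound)
    finally show ?thesis .
  qed
qed

instantiation ell2 :: (complex_hilbert) real_inner
begin

definition "0 = Abs_ell2 (\<lambda>_. 0)"
definition "f + g = Abs_ell2 (\<lambda>n. ell2_nth f n + ell2_nth g n)"
definition "- f = Abs_ell2 (\<lambda>n. - ell2_nth f n)"
definition "f - g = Abs_ell2 (\<lambda>n. ell2_nth f n - ell2_nth g n)"
definition "r *\<^sub>R f = Abs_ell2 (\<lambda>n. r *\<^sub>R ell2_nth f n)"
definition "norm f = sqrt (suminf (\<lambda>n. (norm (ell2_nth f n))\<^sup>2))"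
definition "sgn f = inverse (norm f) *\<^sub>R f" for f :: "'a ell2"
definition "dist f g = norm (f - g)" for f g :: "'a ell2"
definition [code del]:
  "(uniformity :: ('a ell2 \<times> 'a ell2) filter) = (INF e\<in>{0 <..}. principal {(x, y). dist x y < e})"
definition [code del]:
  "open (U :: 'a ell2 set) \<longleftrightarrow> (\<forall>x\<in>U. eventually (\<lambda>(x', y). x' = x \<longrightarrow> y \<in> U) uniformity)"

lemma ell2_nth_zero [simp]: "ell2_nth 0 n = 0"
  unfolding zero_ell2_def by (simp add: ell2_nth_Abs)

lemma ell2_nth_add [simp]: "ell2_nth (f + g) n = ell2_nth f n + ell2_nth g n"
  unfolding plus_ell2_def
  by (subst ell2_nth_Abs) (auto intro: summable_ell2_add summable_ell2)

lemma ell2_nth_uminus [simp]: "ell2_nth (- f) n = - ell2_nth f n"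
  unfolding uminus_ell2_def
  by (subst ell2_nth_Abs) (auto intro: summable_ell2)

lemma ell2_nth_diff [simp]: "ell2_nth (f - g) n = ell2_nth f n - ell2_nth g n"
  unfolding minus_ell2_def
  using summable_ell2_add[OF summable_ell2[of f] summable_ell2[of "- g"]]
  by (subst ell2_nth_Abs) auto

lemma ell2_nth_scaleR [simp]: "ell2_nth (r *\<^sub>R f) n = r *\<^sub>R ell2_nth f n"
  unfolding scaleR_ell2_def
  using summable_ell2_scaleC[OF summable_ell2[of f], of "complex_of_real r"]
  by (subst ell2_nth_Abs) (auto simp: scaleC_of_real)

lemma norm_ell2_sq: "(norm f)\<^sup>2 = (suminf (\<lambda>n. (norm (ell2_nth f n))\<^sup>2))"
  unfolding norm_ell2_def by (simp add: suminf_nonneg summable_ell2)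

lemma norm_ell2_nth_le: "norm (ell2_nth f n) \<le> norm f"
proof (rule power2_le_imp_le)
  show "(norm (ell2_nth f n))\<^sup>2 \<le> (norm f)\<^sup>2"
    unfolding norm_ell2_sq
    using sum_le_suminf[OF summable_ell2[of f], of "{n}"] by simp
qed (simp add: norm_ell2_def suminf_nonneg summable_ell2)

definition "inner f g = (suminf (\<lambda>n. inner (ell2_nth f n) (ell2_nth g n)))"

lemma summable_ell2_inner: "summable (\<lambda>n. inner (ell2_nth f n) (ell2_nth g n))"
  for f g :: "'a ell2"
  using summable_Re[OF summable_ell2_cinner[OF summable_ell2[of f] summable_ell2[of g]]]
  by (simp add: Re_cinner)

instance
proof
  fix x y z :: "'a ell2" and r s :: real
  show "x + y + z = x + (y + z)" "x + y = y + x" "0 + x = x" "- x + x = 0" "x - y = x + - y"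
    "r *\<^sub>R (x + y) = r *\<^sub>R x + r *\<^sub>R y" "(r + s) *\<^sub>R x = r *\<^sub>R x + s *\<^sub>R x"
    "r *\<^sub>R s *\<^sub>R x = (r * s) *\<^sub>R x" "1 *\<^sub>R x = x"
    by (rule ell2_eqI; simp add: algebra_simps)+
  show "dist x y = norm (x - y)" "sgn x = inverse (norm x) *\<^sub>R x"
    by (simp_all add: dist_ell2_def sgn_ell2_def)
  show "uniformity = (INF e\<in>{0<..}. principal {(x :: 'a ell2, y). dist x y < e})"
    by (rule uniformity_ell2_def)
  show "open U = (\<forall>x\<in>U. \<forall>\<^sub>F (x', y) in uniformity. x' = x \<longrightarrow> y \<in> U)" for U :: "'a ell2 set"
    by (rule open_ell2_def)
  show "inner x y = inner y x"
    by (simp add: inner_ell2_def inner_commute)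
  show "inner (x + y) z = inner x z + inner y z"
    by (simp add: inner_ell2_def inner_add_left suminf_add summable_ell2_inner)
  show "inner (r *\<^sub>R x) y = r * inner x y"
    by (simp add: inner_ell2_def suminf_mult summable_ell2_inner)
  have eq: "inner x x = (norm x)\<^sup>2"
    by (simp add: inner_ell2_def norm_ell2_sq power2_norm_eq_inner)
  show "0 \<le> inner x x" by (simp add: eq)
  have "x = 0" if "norm x = 0"
  proof (rule ell2_eqI)
    show "ell2_nth x n = ell2_nth 0 n" for n
      using that norm_ell2_nth_le[of x n] by simp
  qed
  then show "(inner x x = 0) = (x = 0)"
    by (auto simp: eq) (simp add: norm_ell2_def)
  show "norm x = sqrt (inner x x)"
    by (simp add: norm_ell2_def inner_ell2_def power2_norm_eq_inner)
qed

end

instance ell2 :: (complex_hilbert) complete_space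
proof
  fix X :: "nat \<Rightarrow> 'a ell2"
  assume X: "Cauchy X"
  have "Cauchy (\<lambda>k. ell2_nth (X k) n)" for n
  proof (rule metric_CauchyI)
    fix e :: real assume "e > 0"
    then obtain M where M: "\<And>k l. k \<ge> M \<Longrightarrow> l \<ge> M \<Longrightarrow> dist (X k) (X l) < e"
      using X by (meson Cauchy_def)
    have "dist (ell2_nth (X k) n) (ell2_nth (X l) n) < e" if "k \<ge> M" "l \<ge> M" for k l
      using norm_ell2_nth_le[of "X k - X l" n] M[OF that] by (simp add: dist_norm)
    then show "\<exists>M. \<forall>k\<ge>M. \<forall>l\<ge>M. dist (ell2_nth (X k) n) (ell2_nth (X l) n) < e"
      by blast
  qed
  then have "\<forall>n. \<exists>l. (\<lambda>k. ell2_nth (X k) n) \<longlonglongrightarrow> l"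
    using Cauchy_convergent convergent_def by blast
  then obtain f where f: "\<And>n. (\<lambda>k. ell2_nth (X k) n) \<longlonglongrightarrow> f n"
    by metis
  have tail: "\<exists>M. \<forall>k\<ge>M. summable (\<lambda>n. (norm (ell2_nth (X k) n - f n))\<^sup>2) \<and>
      (suminf (\<lambda>n. (norm (ell2_nth (X k) n - f n))\<^sup>2)) \<le> e\<^sup>2" if "e > 0" for e :: real
  proof -
    obtain M where M: "\<And>k l. k \<ge> M \<Longrightarrow> l \<ge> M \<Longrightarrow> dist (X k) (X l) < e"
      using X \<open>e > 0\<close> by (meson Cauchy_def)
    have "summable (\<lambda>n. (norm (ell2_nth (X k) n - f n))\<^sup>2) \<and>
      (suminf (\<lambda>n. (norm (ell2_nth (X k) n - f n))\<^sup>2)) \<le> e\<^sup>2" if k: "k \<ge> M" for k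
    proof -
      have part: "(\<Sum>n<N. (norm (ell2_nth (X k) n - f n))\<^sup>2) \<le> e\<^sup>2" for N
      proof (rule LIMSEQ_le_const2)
        show "(\<lambda>l. \<Sum>n<N. (norm (ell2_nth (X k) n - ell2_nth (X l) n))\<^sup>2)
            \<longlonglongrightarrow> (\<Sum>n<N. (norm (ell2_nth (X k) n - f n))\<^sup>2)"
          by (intro tendsto_intros f)
        have "(\<Sum>n<N. (norm (ell2_nth (X k) n - ell2_nth (X l) n))\<^sup>2) \<le> e\<^sup>2" if "l \<ge> M" for l
        proof -
          have "(\<Sum>n<N. (norm (ell2_nth (X k - X l) n))\<^sup>2) \<le> (norm (X k - X l))\<^sup>2"
            unfolding norm_ell2_sq by (intro sum_le_suminf summable_ell2) auto
          also have "\<dots> \<le> e\<^sup>2"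
            using M[OF k that] by (intro power_mono) (auto simp: dist_norm)
          finally show ?thesis by simp
        qed
        then show "\<exists>L. \<forall>l\<ge>L. (\<Sum>n<N. (norm (ell2_nth (X k) n - ell2_nth (X l) n))\<^sup>2) \<le> e\<^sup>2"
          by blast
      qed
      have "summable (\<lambda>n. (norm (ell2_nth (X k) n - f n))\<^sup>2)"
        using part by (intro summableI_nonneg_bounded[where x = "e\<^sup>2"]) auto
      then show ?thesis
        using part by (auto intro: suminf_le_const)
    qed
    then show ?thesis by blast
  qed
  obtain k where "summable (\<lambda>n. (norm (ell2_nth (X k) n - f n))\<^sup>2)"
    using tail[of 1] by auto
  then have "summable (\<lambda>n. (norm (f n - ell2_nth (X k) n))\<^sup>2)"
    by (simp add: norm_minus_commute)
  from summable_ell2_add[OF this summable_ell2[of "X k"]]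
  have f2: "summable (\<lambda>n. (norm (f n))\<^sup>2)" by simp
  define F where "F = Abs_ell2 f"
  have F: "ell2_nth F = f" by (simp add: F_def ell2_nth_Abs f2)
  have "X \<longlonglongrightarrow> F"
  proof (rule metric_LIMSEQ_I)
    fix e :: real assume "e > 0"
    then obtain M where M: "\<And>k. k \<ge> M \<Longrightarrow> (suminf (\<lambda>n. (norm (ell2_nth (X k) n - f n))\<^sup>2)) \<le> (e/2)\<^sup>2"
      using tail[of "e/2"] by auto
    have "dist (X k) F < e" if "k \<ge> M" for k
    proof -
      have "(norm (X k - F))\<^sup>2 \<le> (e/2)\<^sup>2"
        unfolding norm_ell2_sq using M[OF that] by (simp add: F)
      then have "norm (X k - F) \<le> e/2"
        using \<open>e > 0\<close> by (auto intro: power2_le_imp_le)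
      then show ?thesis using \<open>e > 0\<close> by (simp add: dist_norm)
    qed
    then show "\<exists>M. \<forall>k\<ge>M. dist (X k) F < e" by blast
  qed
  then show "convergent X" by (auto simp: convergent_def)
qed

instantiation ell2 :: (complex_hilbert) complex_hilbert
begin

definition "a *\<^sub>C f = Abs_ell2 (\<lambda>n. a *\<^sub>C ell2_nth f n)"
definition "cinner f g = (suminf (\<lambda>n. cinner (ell2_nth f n) (ell2_nth g n)))"

lemma ell2_nth_scaleC [simp]: "ell2_nth (a *\<^sub>C f) n = a *\<^sub>C ell2_nth f n"
  unfolding scaleC_ell2_def
  by (subst ell2_nth_Abs) (auto intro: summable_ell2_scaleC summable_ell2)

instance
proof
  fix x y z :: "'a ell2" and a b :: complex and r :: real
  have sm: "summable (\<lambda>n. cinner (ell2_nth u n) (ell2_nth v n))" for u v :: "'a ell2"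
    by (intro summable_ell2_cinner summable_ell2)
  show "a *\<^sub>C (x + y) = a *\<^sub>C x + a *\<^sub>C y"
    by (intro ell2_eqI) (simp add: scaleC_add_right)
  show "(a + b) *\<^sub>C x = a *\<^sub>C x + b *\<^sub>C x"
    by (intro ell2_eqI) (simp add: scaleC_add_left)
  show "a *\<^sub>C b *\<^sub>C x = (a * b) *\<^sub>C x"
    by (intro ell2_eqI) (simp add: scaleC_scaleC)
  show "complex_of_real r *\<^sub>C x = r *\<^sub>R x"
    by (intro ell2_eqI) (simp add: scaleC_of_real)
  have "cinner x y = (suminf (\<lambda>n. cnj (cinner (ell2_nth y n) (ell2_nth x n))))"
    unfolding cinner_ell2_def by (subst cinner_commute) (rule refl)
  also have "\<dots> = cnj (cinner y x)"
    unfolding cinner_ell2_def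
    by (rule bounded_linear.suminf[OF bounded_linear_cnj sm, symmetric])
  finally show "cinner x y = cnj (cinner y x)" .
  show "cinner (x + y) z = cinner x z + cinner y z"
    unfolding cinner_ell2_def by (simp add: cinner_add_left suminf_add[OF sm sm])
  show "cinner (a *\<^sub>C x) y = a * cinner x y"
    unfolding cinner_ell2_def by (simp add: cinner_scaleC_left suminf_mult[OF sm])
  show "Re (cinner x y) = inner x y"
    unfolding cinner_ell2_def inner_ell2_def
    using bounded_linear.suminf[OF bounded_linear_Re sm] by (simp add: Re_cinner)
qed

end


section \<open>Operators on closed subspaces\<close>

text \<open>
  An operator on a Hilbert space \<open>M\<close>, where \<open>M\<close> is a closed subspace of the ambient type, is a
  function on the type of which only the values on \<open>M\<close> matter. Thus the restriction of \<open>T\<close> to an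
  invariant subspace \<open>M\<close> is \<open>T\<close> itself, considered on \<open>M\<close>; every notion below takes the space \<open>M\<close>
  as an argument, and \<open>M = UNIV\<close> is the ambient Hilbert space.
\<close>

definition closed_csubspace :: "'a::complex_hilbert set \<Rightarrow> bool" where
  "closed_csubspace M \<longleftrightarrow>
     closed M \<and> 0 \<in> M \<and> (\<forall>x\<in>M. \<forall>y\<in>M. x + y \<in> M) \<and> (\<forall>a. \<forall>x\<in>M. a *\<^sub>C x \<in> M)"

definition clinear_on :: "'a::complex_hilbert set \<Rightarrow> ('a \<Rightarrow> 'b::complex_hilbert) \<Rightarrow> bool" where
  "clinear_on M T \<longleftrightarrow>
     (\<forall>x\<in>M. \<forall>y\<in>M. T (x + y) = T x + T y) \<and> (\<forall>a. \<forall>x\<in>M. T (a *\<^sub>C x) = a *\<^sub>C T x)"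

definition bounded_op :: "'a::complex_hilbert set \<Rightarrow> ('a \<Rightarrow> 'a) \<Rightarrow> bool" where
  "bounded_op M T \<longleftrightarrow>
     (\<forall>x\<in>M. T x \<in> M) \<and> clinear_on M T \<and> (\<exists>B. \<forall>x\<in>M. norm (T x) \<le> B * norm x)"

definition adj :: "'a::complex_hilbert set \<Rightarrow> ('a \<Rightarrow> 'a) \<Rightarrow> 'a \<Rightarrow> 'a" where
  "adj M T y = (THE z. z \<in> M \<and> (\<forall>x\<in>M. cinner (T x) y = cinner x z))"

definition normal_op :: "'a::complex_hilbert set \<Rightarrow> ('a \<Rightarrow> 'a) \<Rightarrow> bool" where
  "normal_op M T \<longleftrightarrow> bounded_op M T \<and> (\<forall>x\<in>M. T (adj M T x) = adj M T (T x))"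

definition kernel :: "('a::complex_hilbert \<Rightarrow> 'a) \<Rightarrow> 'a set" where
  "kernel T = {x. T x = 0}"

definition reduces :: "'a::complex_hilbert set \<Rightarrow> ('a \<Rightarrow> 'a) \<Rightarrow> bool" where
  "reduces N T \<longleftrightarrow> closed_csubspace N \<and> (\<forall>x\<in>N. T x \<in> N) \<and> (\<forall>x\<in>N. adj UNIV T x \<in> N)"

text \<open>Meaningful when \<open>F\<close> converges strongly; \<open>lim\<close> is unspecified otherwise.\<close>

definition strong_limit :: "(nat \<Rightarrow> 'a::complex_hilbert \<Rightarrow> 'a) \<Rightarrow> 'a \<Rightarrow> 'a" where
  "strong_limit F = (\<lambda>x. lim (\<lambda>k. F k x))"

definition strongly_stable :: "'a::complex_hilbert set \<Rightarrow> ('a \<Rightarrow> 'a) \<Rightarrow> bool" where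
  "strongly_stable M P \<longleftrightarrow> (\<forall>x\<in>M. (\<lambda>k. norm ((P ^^ k) x)) \<longlonglongrightarrow> 0)"

definition unilateral_shift :: "'a::complex_hilbert set \<Rightarrow> ('a \<Rightarrow> 'a) \<Rightarrow> bool" where
  "unilateral_shift M V \<longleftrightarrow>
     bounded_op M V \<and> (\<forall>x\<in>M. norm (V x) = norm x) \<and> strongly_stable M (adj M V)"

definition backward_shift :: "'a::complex_hilbert set \<Rightarrow> ('a \<Rightarrow> 'a) \<Rightarrow> bool" where
  "backward_shift M T \<longleftrightarrow> (\<exists>V. unilateral_shift M V \<and> (\<forall>x\<in>M. T x = adj M V x))"


section \<open>The Taylor joint spectrum\<close>

text \<open>
  Tuples are indexed by \<open>{1..n}\<close>; points of \<open>\<complex>\<^sup>n\<close> are the functions in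
  \<open>{1..n} \<rightarrow>\<^sub>E UNIV\<close>, with the topology inherited from the product topology.
\<close>

definition commuting_tuple :: "nat \<Rightarrow> 'a::complex_hilbert set \<Rightarrow> (nat \<Rightarrow> 'a \<Rightarrow> 'a) \<Rightarrow> bool" where
  "commuting_tuple n M T \<longleftrightarrow>
     closed_csubspace M \<and> (\<forall>i\<in>{1..n}. bounded_op M (T i)) \<and>
     (\<forall>i\<in>{1..n}. \<forall>j\<in>{1..n}. \<forall>x\<in>M. T i (T j x) = T j (T i x))"

text \<open>
  Elements of \<open>M \<otimes> \<Lambda>(\<complex>\<^sup>n)\<close>: the form \<open>\<Sum>\<^sub>I \<xi>\<^sub>I e\<^sub>I\<close> with \<open>e\<^sub>I = e\<^bsub>i\<^sub>1\<^esub> \<and> \<dots> \<and> e\<^bsub>i\<^sub>k\<^esub>\<close> for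
  \<open>I = {i\<^sub>1 < \<dots> < i\<^sub>k}\<close> is encoded by its coefficients \<open>\<xi> I\<close>. The boundary operator is
  \<open>\<Sum>\<^sub>i T\<^sub>i \<otimes> (e\<^sub>i \<and> \<cdot>)\<close>; the sign arises from sorting \<open>e\<^sub>i \<and> e\<^bsub>I - {i}\<^esub>\<close>.
\<close>

definition koszul_forms :: "nat \<Rightarrow> 'a::complex_hilbert set \<Rightarrow> (nat set \<Rightarrow> 'a) set" where
  "koszul_forms n M = {\<xi>. \<forall>I. if I \<subseteq> {1..n} then \<xi> I \<in> M else \<xi> I = 0}"

definition koszul_d ::
    "nat \<Rightarrow> (nat \<Rightarrow> 'a::complex_hilbert \<Rightarrow> 'a) \<Rightarrow> (nat set \<Rightarrow> 'a) \<Rightarrow> nat set \<Rightarrow> 'a" where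
  "koszul_d n T \<xi> = (\<lambda>I. if I \<subseteq> {1..n}
     then \<Sum>i\<in>I. (-1) ^ card {j\<in>I. j < i} *\<^sub>R T i (\<xi> (I - {i})) else 0)"

definition koszul_exact :: "nat \<Rightarrow> 'a::complex_hilbert set \<Rightarrow> (nat \<Rightarrow> 'a \<Rightarrow> 'a) \<Rightarrow> bool" where
  "koszul_exact n M T \<longleftrightarrow>
     {\<xi> \<in> koszul_forms n M. koszul_d n T \<xi> = (\<lambda>_. 0)} = koszul_d n T ` koszul_forms n M"

definition taylor_spectrum ::
    "nat \<Rightarrow> 'a::complex_hilbert set \<Rightarrow> (nat \<Rightarrow> 'a \<Rightarrow> 'a) \<Rightarrow> (nat \<Rightarrow> complex) set" where
  "taylor_spectrum n M T =
     {w \<in> {1..n} \<rightarrow>\<^sub>E UNIV. \<not> koszul_exact n M (\<lambda>i x. T i x - w i *\<^sub>C x)}"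


section \<open>Spectral sets\<close>

type_synonym mpoly = "(nat \<Rightarrow>\<^sub>0 nat) \<Rightarrow>\<^sub>0 complex"

definition poly_in :: "nat \<Rightarrow> mpoly \<Rightarrow> bool" where
  "poly_in n p \<longleftrightarrow> (\<forall>m\<in>Poly_Mapping.keys p. Poly_Mapping.keys m \<subseteq> {1..n})"

definition poly_eval :: "nat \<Rightarrow> mpoly \<Rightarrow> (nat \<Rightarrow> complex) \<Rightarrow> complex" where
  "poly_eval n p z =
     (\<Sum>m\<in>Poly_Mapping.keys p. Poly_Mapping.lookup p m * (\<Prod>i\<in>{1..n}. z i ^ Poly_Mapping.lookup m i))"

text \<open>\<open>op_monom n T m = T\<^sub>1\<^bsup>m\<^sub>1\<^esup> \<circ> \<dots> \<circ> T\<^sub>n\<^bsup>m\<^sub>n\<^esup>\<close>\<close>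

primrec op_monom ::
    "nat \<Rightarrow> (nat \<Rightarrow> 'a::complex_hilbert \<Rightarrow> 'a) \<Rightarrow> (nat \<Rightarrow>\<^sub>0 nat) \<Rightarrow> 'a \<Rightarrow> 'a" where
  "op_monom 0 T m = id"
| "op_monom (Suc k) T m = op_monom k T m \<circ> (T (Suc k) ^^ Poly_Mapping.lookup m (Suc k))"

definition op_poly ::
    "nat \<Rightarrow> mpoly \<Rightarrow> (nat \<Rightarrow> 'a::complex_hilbert \<Rightarrow> 'a) \<Rightarrow> 'a \<Rightarrow> 'a" where
  "op_poly n p T x =
     (\<Sum>m\<in>Poly_Mapping.keys p. Poly_Mapping.lookup p m *\<^sub>C op_monom n T m x)"

text \<open>
  A rational function with poles off \<open>K\<close> is \<open>f = p / q\<close> with \<open>q\<close> zero-free on \<open>K\<close>, and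
  \<open>f(T) = p(T) q(T)\<^sup>-\<^sup>1\<close>. Invertibility of \<open>q(T)\<close> is automatic when the Taylor spectrum lies in \<open>K\<close>
  (spectral mapping theorem); it is recorded only so that \<open>inv_into\<close> is the actual inverse.
\<close>

definition spectral_set ::
    "nat \<Rightarrow> (nat \<Rightarrow> complex) set \<Rightarrow> 'a::complex_hilbert set \<Rightarrow> (nat \<Rightarrow> 'a \<Rightarrow> 'a) \<Rightarrow> bool" where
  "spectral_set n K M T \<longleftrightarrow>
     compact K \<and> taylor_spectrum n M T \<subseteq> K \<and>
     (\<forall>p q. poly_in n p \<and> poly_in n q \<and> (\<forall>z\<in>K. poly_eval n q z \<noteq> 0) \<longrightarrow>
        bij_betw (op_poly n q T) M M \<and>
        (\<forall>x\<in>M. norm (op_poly n p T (inv_into M (op_poly n q T) x))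
                 \<le> (SUP z\<in>K. cmod (poly_eval n p z / poly_eval n q z)) * norm x))"


section \<open>The symmetrized polydisc and its operator classes\<close>

definition sym_map :: "nat \<Rightarrow> (nat \<Rightarrow> complex) \<Rightarrow> nat \<Rightarrow> complex" where
  "sym_map n z = (\<lambda>i\<in>{1..n}. \<Sum>J | J \<subseteq> {1..n} \<and> card J = i. \<Prod>j\<in>J. z j)"

definition Gam :: "nat \<Rightarrow> (nat \<Rightarrow> complex) set" where
  "Gam n = sym_map n ` ({1..n} \<rightarrow>\<^sub>E cball 0 1)"

definition bGam :: "nat \<Rightarrow> (nat \<Rightarrow> complex) set" where
  "bGam n = sym_map n ` ({1..n} \<rightarrow>\<^sub>E sphere 0 1)"

text \<open>In the tuple \<open>T\<close>, the component \<open>T n\<close> is the operator called \<open>P\<close>.\<close>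

definition gamma_contraction :: "nat \<Rightarrow> 'a::complex_hilbert set \<Rightarrow> (nat \<Rightarrow> 'a \<Rightarrow> 'a) \<Rightarrow> bool" where
  "gamma_contraction n M T \<longleftrightarrow> commuting_tuple n M T \<and> spectral_set n (Gam n) M T"

definition gamma_unitary :: "nat \<Rightarrow> 'a::complex_hilbert set \<Rightarrow> (nat \<Rightarrow> 'a \<Rightarrow> 'a) \<Rightarrow> bool" where
  "gamma_unitary n M T \<longleftrightarrow>
     commuting_tuple n M T \<and> (\<forall>i\<in>{1..n}. normal_op M (T i)) \<and> taylor_spectrum n M T \<subseteq> bGam n"

text \<open>
  The space \<open>K\<close> on which the extending \<open>\<Gamma>\<^sub>n\<close>-unitary acts is in general larger than \<open>M\<close>, and \<open>M\<close> is
  identified with the invariant subspace \<open>V ` M\<close> of \<open>K\<close>. Taking \<open>K\<close> inside \<open>\<ell>\<^sup>2(\<nat>, 'a)\<close> loses no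
  generality: given any \<open>\<Gamma>\<^sub>n\<close>-unitary extension \<open>U\<close>, the smallest subspace containing \<open>M\<close> and
  reducing all \<open>U i\<close> has Hilbert dimension at most \<open>\<aleph>\<^sub>0 \<cdot> dim M\<close>, and the restriction of \<open>U\<close>
  to it is again a \<open>\<Gamma>\<^sub>n\<close>-unitary.
\<close>

definition gamma_isometry :: "nat \<Rightarrow> 'a::complex_hilbert set \<Rightarrow> (nat \<Rightarrow> 'a \<Rightarrow> 'a) \<Rightarrow> bool" where
  "gamma_isometry n M T \<longleftrightarrow>
     closed_csubspace M \<and> (\<forall>i\<in>{1..n}. \<forall>x\<in>M. T i x \<in> M) \<and>
     (\<exists>(K :: 'a ell2 set) U V. gamma_unitary n K U \<and>
        clinear_on M V \<and> (\<forall>x\<in>M. V x \<in> K \<and> norm (V x) = norm x) \<and>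
        (\<forall>i\<in>{1..n}. \<forall>x\<in>M. V (T i x) = U i (V x)))"

definition strongly_stable_gamma_contraction ::
    "nat \<Rightarrow> 'a::complex_hilbert set \<Rightarrow> (nat \<Rightarrow> 'a \<Rightarrow> 'a) \<Rightarrow> bool" where
  "strongly_stable_gamma_contraction n M T \<longleftrightarrow>
     gamma_contraction n M T \<and> strongly_stable M (T n)"

definition pure_gamma_contraction ::
    "nat \<Rightarrow> 'a::complex_hilbert set \<Rightarrow> (nat \<Rightarrow> 'a \<Rightarrow> 'a) \<Rightarrow> bool" where
  "pure_gamma_contraction n M T \<longleftrightarrow>
     gamma_contraction n M T \<and> strongly_stable M (adj M (T n))"

definition C00_gamma_contraction ::
    "nat \<Rightarrow> 'a::complex_hilbert set \<Rightarrow> (nat \<Rightarrow> 'a \<Rightarrow> 'a) \<Rightarrow> bool" where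
  "C00_gamma_contraction n M T \<longleftrightarrow>
     gamma_contraction n M T \<and> strongly_stable M (T n) \<and> strongly_stable M (adj M (T n))"

definition pure_gamma_isometry ::
    "nat \<Rightarrow> 'a::complex_hilbert set \<Rightarrow> (nat \<Rightarrow> 'a \<Rightarrow> 'a) \<Rightarrow> bool" where
  "pure_gamma_isometry n M T \<longleftrightarrow> gamma_isometry n M T \<and> pure_gamma_contraction n M T"

end

theory Submission
  imports Defs "HOL-Complex_Analysis.Conformal_Mappings"
    "HOL-Computational_Algebra.Fundamental_Theorem_Algebra" "HOL-Library.Nat_Bijection"
begin

text \<open>
  Write \<open>P = T\<^sub>n\<close> and \<open>D\<^sub>i = T\<^sub>i\<^sup>*\<close>. The kernel of \<open>\<A>\<close> consists of the vectors with \<open>P\<^sup>k x \<rightarrow> 0\<close>, and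
  \<open>Ker (I - \<A>)\<close> of those on which all powers of \<open>P\<close> are isometric. If \<open>\<A> = \<A>\<^sup>2\<close>, these two spaces
  are orthogonal complements of each other (\<open>idempotent_orthogonal\<close>). The stable one is invariant
  under whatever commutes with \<open>P\<close>, hence the isometric one under all \<open>D\<^sub>i\<close>; what has to be proved
  is that the isometric one is invariant under the \<open>T\<^sub>i\<close>.

  This is where \<open>\<Gamma>\<^sub>n\<close> enters. On \<open>b\<Gamma>\<^sub>n\<close> one has \<open>s\<^bsub>n-i\<^esub> = cnj s\<^sub>i \<sqdot> p\<close>; therefore, for \<open>|a| = 1\<close> and large
  \<open>\<kappa>\<close>, the function \<open>(\<kappa> a p - s\<^bsub>n-i\<^esub>) / (\<kappa> - a s\<^sub>i)\<close> is unimodular on \<open>b\<Gamma>\<^sub>n\<close> and, by the maximum principle,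
  bounded by \<open>1\<close> on \<open>\<Gamma>\<^sub>n\<close> (\<open>esym_pencil_le\<close>). The spectral set condition turns the functions for \<open>i\<close>
  and \<open>n - i\<close> into the domination of the form of \<open>T\<^sub>i - D\<^bsub>n-i\<^esub> P\<close> by a multiple of \<open>\<parallel>x\<parallel>\<^sup>2 - \<parallel>P x\<parallel>\<^sup>2\<close>,
  and so \<open>T\<^sub>i x = D\<^bsub>n-i\<^esub> P x\<close> wherever \<open>\<parallel>P x\<parallel> = \<parallel>x\<parallel>\<close> (\<open>fundamental_relation\<close>). With this relation,
  and its dual for the adjoint tuple, each of the subspaces in question reduces the tuple, and
  restriction to a reducing subspace preserves \<open>\<Gamma>\<^sub>n\<close>-contractions.

  On the unitary part of \<open>P\<close> the dual relation \<open>D\<^sub>i = T\<^bsub>n-i\<^esub> P\<^sup>*\<close> makes the \<open>T\<^sub>i\<close> normal. On the remaining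
  part of \<open>Ker (I - \<A>)\<close> the operator \<open>P\<close> is a shift with wandering subspace \<open>E\<close>, and the relation says
  that each \<open>T\<^sub>i\<close> is a Toeplitz operator with a symbol \<open>A\<^sub>i + \<zeta> B\<^sub>i\<close> of degree one; the Laurent operators
  with these symbols on two-sided sequences in \<open>E\<close> form the \<open>\<Gamma>\<^sub>n\<close>-unitary extension
  (\<open>gamma_isometry_on_shift\<close>).

  Taylor spectra are only ever bounded from above, by one criterion: the Koszul complex at \<open>w\<close> is
  contractible if a linear combination of the \<open>T\<^sub>i - w\<^sub>i\<close> is invertible
  (\<open>koszul_exact_if_bij\<close>). A point outside \<open>\<Gamma>\<^sub>n\<close> is a zero of some \<open>\<Prod>\<^sub>j (1 - u z\<^sub>j)\<close> with \<open>|u| < 1\<close>,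
  which is an affine function of the coordinates, and invertibility of this function of the tuple is
  inherited by restrictions and by the extension.

  Finally \<open>\<A> = \<A>\<^sub>*\<close> forces \<open>\<A> = \<A>\<^sup>2\<close> (\<open>idempotent_if_limits_agree\<close>), which reduces the last part of
  the theorem to the first.
\<close>

section \<open>Closed subspaces and adjoints\<close>

lemma inner_scaleC_left: "inner (a *\<^sub>C x) y = inner x (cnj a *\<^sub>C y)"
  for x y :: "'a::complex_hilbert"
proof -
  have "cinner (a *\<^sub>C x) y = cinner x (cnj a *\<^sub>C y)"
    by (metis cinner_commute cinner_scaleC_left complex_cnj_cnj complex_cnj_mult)
  then show ?thesis by (metis Re_cinner)
qed

lemma scaleC_one [simp]: "1 *\<^sub>C x = x"
  for x :: "'a::complex_hilbert"
  using scaleC_of_real[of 1 x] by simp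

lemma bounded_linear_scaleC: "bounded_linear ((*\<^sub>C) a :: 'a::complex_hilbert \<Rightarrow> 'a)"
proof (rule bounded_linear_intro)
  show "a *\<^sub>C (r *\<^sub>R x) = r *\<^sub>R (a *\<^sub>C x)" for r and x :: 'a
    by (simp add: scaleC_of_real[symmetric] scaleC_scaleC mult.commute)
  show "norm (a *\<^sub>C x) \<le> norm x * cmod a" for x :: 'a
    by (simp add: norm_scaleC)
qed (rule scaleC_add_right)

lemmas scaleC_diff_right = linear_diff[OF bounded_linear.linear[OF bounded_linear_scaleC]]
  and scaleC_sum_right = linear_sum[OF bounded_linear.linear[OF bounded_linear_scaleC]]
  and scaleC_zero_right = linear_0[OF bounded_linear.linear[OF bounded_linear_scaleC]]

lemma bounded_linear_compose_scaleC:
  fixes f :: "'b::real_normed_vector \<Rightarrow> 'a::complex_hilbert"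
  shows "bounded_linear f \<Longrightarrow> bounded_linear (\<lambda>x. a *\<^sub>C f x)"
  by (rule bounded_linear_compose[OF bounded_linear_scaleC])

lemma scaleC_minus_left: "(- a) *\<^sub>C x = - (a *\<^sub>C x)"
  for x :: "'a::complex_hilbert"
proof -
  have "(- a) *\<^sub>C x = (complex_of_real (-1)) *\<^sub>C (a *\<^sub>C x)"
    by (simp only: scaleC_scaleC) simp
  then show ?thesis by (simp only: scaleC_of_real) simp
qed

lemma scaleC_zero_left: "0 *\<^sub>C x = 0"
  for x :: "'a::complex_hilbert"
  using scaleC_of_real[of 0 x] by simp

lemma closed_csubspace_subspace: "closed_csubspace M \<Longrightarrow> subspace M"
  by (auto simp: closed_csubspace_def subspace_def simp flip: scaleC_of_real)

lemma closed_csubspace_Int: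
  "closed_csubspace M \<Longrightarrow> closed_csubspace N \<Longrightarrow> closed_csubspace (M \<inter> N)"
  by (auto simp: closed_csubspace_def)

lemma closed_csubspace_UNIV: "closed_csubspace UNIV"
  by (auto simp: closed_csubspace_def)

lemma bounded_op_UNIV_linear: "bounded_op UNIV T \<Longrightarrow> bounded_linear T"
proof -
  assume T: "bounded_op UNIV T"
  then have add: "T (x + y) = T x + T y" and sc: "T (a *\<^sub>C x) = a *\<^sub>C T x" for x y a
    by (auto simp: bounded_op_def clinear_on_def)
  obtain B where B: "\<And>x. norm (T x) \<le> B * norm x"
    using T by (auto simp: bounded_op_def)
  have "T (r *\<^sub>R x) = r *\<^sub>R T x" for r x
    using sc[of "complex_of_real r" x] by (simp add: scaleC_of_real)
  then show ?thesis
    using add B by (intro bounded_linear_intro[where K = B]) (auto simp: mult.commute)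
qed

lemma bounded_op_UNIV_scaleC: "bounded_op UNIV T \<Longrightarrow> T (a *\<^sub>C x) = a *\<^sub>C T x"
  by (auto simp: bounded_op_def clinear_on_def)

lemma bounded_op_UNIV_I:
  assumes "bounded_linear T" "\<And>a x. T (a *\<^sub>C x) = a *\<^sub>C T x"
  shows "bounded_op UNIV T"
proof -
  obtain B where "\<And>x. norm (T x) \<le> norm x * B"
    using bounded_linear.bounded[OF assms(1)] by blast
  then show ?thesis
    using assms(2) by (auto simp: bounded_op_def clinear_on_def mult.commute
        linear_add[OF bounded_linear.linear[OF assms(1)]] intro!: exI[of _ B])
qed

lemma bounded_op_restrict:
  "bounded_op UNIV T \<Longrightarrow> (\<And>x. x \<in> M \<Longrightarrow> T x \<in> M) \<Longrightarrow> bounded_op M T"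
  by (auto simp: bounded_op_def clinear_on_def)

text \<open>
  The usual minimising sequence is Cauchy by the parallelogram law. Existence of adjoints, splitting
  off reducing subspaces, and surjectivity of normal operators that are bounded below all come from
  this lemma.
\<close>

lemma orthogonal_decomposition:
  fixes M :: "'a::{real_inner,complete_space} set"
  assumes "closed M" "subspace M"
  obtains m where "m \<in> M" "\<And>y. y \<in> M \<Longrightarrow> inner (x - m) y = 0"
proof -
  define d where "d = infdist x M"
  have ne: "M \<noteq> {}" and d0: "0 \<le> d"
    using assms(2) subspace_0 by (auto simp: d_def infdist_nonneg)
  have lower: "d \<le> norm (x - y)" if "y \<in> M" for y
    using infdist_le[OF that, of x] by (simp add: d_def dist_norm)
  have "\<exists>y\<in>M. (norm (x - y))\<^sup>2 < d\<^sup>2 + e" if "e > 0" for e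
  proof -
    have "d < sqrt (d\<^sup>2 + e)"
      using that d0 by (intro real_less_rsqrt) simp
    then obtain y where "y \<in> M" "dist x y < sqrt (d\<^sup>2 + e)"
      unfolding d_def infdist_notempty[OF ne] using ne by (subst (asm) cINF_less_iff) auto
    moreover from this have "(norm (x - y))\<^sup>2 < (sqrt (d\<^sup>2 + e))\<^sup>2"
      by (intro power_strict_mono) (auto simp: dist_norm)
    ultimately show ?thesis
      using that by auto
  qed
  then have "\<forall>k. \<exists>y\<in>M. (norm (x - y))\<^sup>2 < d\<^sup>2 + inverse (Suc k)" by simp
  then obtain f where fM: "\<And>k. f k \<in> M"
    and f: "\<And>k. (norm (x - f k))\<^sup>2 < d\<^sup>2 + inverse (Suc k)" by metis
  have par: "(norm (f k - f l))\<^sup>2 \<le> 2 * inverse (Suc k) + 2 * inverse (Suc l)" for k l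
  proof -
    have "(1/2) *\<^sub>R (f k + f l) \<in> M"
      using assms(2) fM by (simp add: subspace_add subspace_scale)
    from lower[OF this] have "d\<^sup>2 \<le> (norm (x - (1/2) *\<^sub>R (f k + f l)))\<^sup>2"
      using d0 by (rule power_mono)
    moreover have "(norm (f k - f l))\<^sup>2 = 2 * (norm (x - f k))\<^sup>2 + 2 * (norm (x - f l))\<^sup>2
        - 4 * (norm (x - (1/2) *\<^sub>R (f k + f l)))\<^sup>2"
      by (simp add: power2_norm_eq_inner inner_add_left inner_add_right inner_diff_left
          inner_diff_right inner_commute algebra_simps)
    ultimately show ?thesis using f[of k] f[of l] by simp
  qed
  have "Cauchy f"
  proof (rule metric_CauchyI)
    fix e :: real assume "e > 0"
    then obtain N where N: "inverse (real (Suc N)) < e\<^sup>2 / 4"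
      using reals_Archimedean[of "e\<^sup>2 / 4"] by auto
    have "dist (f k) (f l) < e" if "k \<ge> N" "l \<ge> N" for k l
    proof -
      have "inverse (real (Suc k)) \<le> inverse (real (Suc N))"
        "inverse (real (Suc l)) \<le> inverse (real (Suc N))" using that by auto
      then have "(norm (f k - f l))\<^sup>2 < e\<^sup>2" using par[of k l] N by linarith
      then show ?thesis
        using \<open>e > 0\<close> by (simp add: dist_norm power_less_imp_less_base)
    qed
    then show "\<exists>N. \<forall>k\<ge>N. \<forall>l\<ge>N. dist (f k) (f l) < e" by blast
  qed
  then obtain m where m: "f \<longlonglongrightarrow> m"
    using Cauchy_convergent convergent_def by blast
  have mM: "m \<in> M" using closed_sequentially[OF assms(1) _ m] fM by auto
  have "(\<lambda>k. d\<^sup>2 + inverse (real (Suc k))) \<longlonglongrightarrow> d\<^sup>2 + 0"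
    by (intro tendsto_intros LIMSEQ_inverse_real_of_nat)
  then have dm: "(norm (x - m))\<^sup>2 \<le> d\<^sup>2"
    using f by (intro LIMSEQ_le[of "\<lambda>k. (norm (x - f k))\<^sup>2"]) (auto intro!: tendsto_intros m less_imp_le)
  have "inner (x - m) y = 0" if y: "y \<in> M" for y
  proof (cases "y = 0")
    case False
    \<comment> \<open>This \<open>t\<close> minimises the distance from \<open>x\<close> to \<open>m + t y\<close>.\<close>
    define t where "t = inner (x - m) y / inner y y"
    have "m + t *\<^sub>R y \<in> M" using assms(2) mM y by (simp add: subspace_add subspace_scale)
    from lower[OF this] have "d\<^sup>2 \<le> (norm (x - (m + t *\<^sub>R y)))\<^sup>2"
      using d0 by (rule power_mono)
    also have "\<dots> = (norm (x - m))\<^sup>2 - 2 * t * inner (x - m) y + t\<^sup>2 * inner y y"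
      unfolding diff_diff_add[symmetric] power2_norm_eq_inner
      by (simp add: inner_diff_left inner_diff_right inner_commute algebra_simps power2_eq_square)
    also have "\<dots> = (norm (x - m))\<^sup>2 - (inner (x - m) y)\<^sup>2 / inner y y"
      using False by (simp add: t_def power2_eq_square)
    finally have "(inner (x - m) y)\<^sup>2 / inner y y \<le> 0" using dm by simp
    moreover have "inner y y > 0" using False by simp
    ultimately have "(inner (x - m) y)\<^sup>2 \<le> 0" by (simp add: divide_le_0_iff)
    then show ?thesis by simp
  qed simp
  with mM that show ?thesis by blast
qed

lemma riesz_representation:
  fixes \<phi> :: "'a::{real_inner,complete_space} \<Rightarrow> real"
  assumes "bounded_linear \<phi>"
  obtains z where "\<And>x. \<phi> x = inner x z"
proof (cases "\<forall>x. \<phi> x = 0")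
  case False
  then obtain x0 where x0: "\<phi> x0 \<noteq> 0" by blast
  interpret bounded_linear \<phi> by fact
  define N where "N = {x. \<phi> x = 0}"
  have "closed N"
    unfolding N_def by (intro closed_Collect_eq continuous_on continuous_intros)
  moreover have "subspace N" by (auto simp: N_def subspace_def add scaleR)
  ultimately obtain m where m: "m \<in> N" "\<And>y. y \<in> N \<Longrightarrow> inner (x0 - m) y = 0"
    using orthogonal_decomposition by blast
  define w where "w = x0 - m"
  have \<phi>w: "\<phi> w = \<phi> x0" using m(1) by (simp add: w_def diff N_def)
  with x0 have "w \<noteq> 0" using zero by auto
  have "\<phi> x = inner x ((\<phi> w / inner w w) *\<^sub>R w)" for x
  proof -
    have "x - (\<phi> x / \<phi> w) *\<^sub>R w \<in> N" using \<phi>w x0 by (simp add: N_def diff scaleR)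
    from m(2)[OF this] have "inner x w = (\<phi> x / \<phi> w) * inner w w"
      by (simp add: w_def[symmetric] inner_simps inner_commute)
    then show ?thesis using \<open>w \<noteq> 0\<close> \<phi>w x0 by (simp add: field_simps)
  qed
  then show ?thesis using that by blast
qed (auto intro: that[of 0])

text \<open>
  By complex linearity, the real part of the identity that characterises the adjoint is already
  the whole identity; so adjoints can be computed with the real inner product.
\<close>

lemma adj_eqI:
  assumes "closed_csubspace M" "clinear_on M T" "z \<in> M"
    and eq: "\<And>x. x \<in> M \<Longrightarrow> inner (T x) y = inner x z"
  shows "adj M T y = z"
  unfolding adj_def
proof (rule the_equality)
  have "cinner (T x) y = cinner x z" if "x \<in> M" for x
  proof (rule complex_eqI)
    show "Re (cinner (T x) y) = Re (cinner x z)" using eq[OF that] by (simp add: Re_cinner)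
    have "(- \<i>) *\<^sub>C x \<in> M" using assms(1) that by (simp add: closed_csubspace_def)
    from eq[OF this] show "Im (cinner (T x) y) = Im (cinner x z)"
      using assms(2) that by (simp add: clinear_on_def Im_cinner inner_scaleC_left)
  qed
  then show "z \<in> M \<and> (\<forall>x\<in>M. cinner (T x) y = cinner x z)" using assms(3) by blast
  fix z' assume z': "z' \<in> M \<and> (\<forall>x\<in>M. cinner (T x) y = cinner x z')"
  have M: "z' - z \<in> M"
    using closed_csubspace_subspace[OF assms(1)] z' assms(3) by (simp add: subspace_diff)
  then have "inner (z' - z) z' = inner (z' - z) z"
    using z' eq[OF M] by (metis Re_cinner)
  then have "inner (z' - z) (z' - z) = 0" by (simp add: inner_diff_right)
  then show "z' = z" by simp
qed

lemma inner_adj_UNIV: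
  assumes "bounded_op UNIV T"
  shows "inner (T x) y = inner x (adj UNIV T y)"
proof -
  have "bounded_linear (\<lambda>x. inner (T x) y)"
    by (rule bounded_linear_compose[OF bounded_linear_inner_left bounded_op_UNIV_linear[OF assms]])
  then obtain z where z: "\<And>x. inner (T x) y = inner x z"
    using riesz_representation by blast
  then have "adj UNIV T y = z"
    using assms by (intro adj_eqI closed_csubspace_UNIV) (auto simp: bounded_op_def)
  then show ?thesis using z by simp
qed

lemma bounded_op_adj_UNIV:
  assumes T: "bounded_op UNIV T"
  shows "bounded_op UNIV (adj UNIV T)"
proof -
  let ?D = "adj UNIV T"
  note D = inner_adj_UNIV[OF T, symmetric]
  have add: "?D (x + y) = ?D x + ?D y" for x y
    by (rule vector_eq_ldot[THEN iffD1]) (simp add: D inner_add_right)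
  have scC: "?D (a *\<^sub>C x) = a *\<^sub>C ?D x" for a x
  proof (rule vector_eq_ldot[THEN iffD1], rule allI)
    fix z
    have "inner z (?D (a *\<^sub>C x)) = inner (T (cnj a *\<^sub>C z)) x"
      by (simp add: D bounded_op_UNIV_scaleC[OF T] inner_scaleC_left)
    then show "inner z (?D (a *\<^sub>C x)) = inner z (a *\<^sub>C ?D x)"
      by (simp add: inner_adj_UNIV[OF T] inner_scaleC_left)
  qed
  obtain B where B: "\<And>x. norm (T x) \<le> B * norm x" using T by (auto simp: bounded_op_def)
  have "norm (?D y) \<le> \<bar>B\<bar> * norm y" for y
  proof (cases "?D y = 0")
    case False
    have "norm (?D y) * norm (?D y) = inner (T (?D y)) y"
      by (simp add: inner_adj_UNIV[OF T] power2_norm_eq_inner flip: power2_eq_square)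
    also have "\<dots> \<le> norm (T (?D y)) * norm y" by (rule norm_cauchy_schwarz)
    also have "\<dots> \<le> (\<bar>B\<bar> * norm (?D y)) * norm y"
      by (intro mult_right_mono order_trans[OF B]) (auto intro: mult_right_mono)
    finally show ?thesis using False by (simp add: mult.assoc mult.left_commute)
  qed simp
  then show ?thesis
    using add scC by (auto simp: bounded_op_def clinear_on_def)
qed

text \<open>
  A normal operator that is bounded below has closed range, and the orthogonal complement of the
  range is the kernel of the adjoint, which is the kernel of the operator.
\<close>

lemma normal_bounded_below_surj:
  fixes N N' :: "'a::{real_inner,complete_space} \<Rightarrow> 'a"
  assumes M: "closed M" "subspace M" and N: "bounded_linear N"
    and inv: "\<And>x. x \<in> M \<Longrightarrow> N x \<in> M" "\<And>x. x \<in> M \<Longrightarrow> N' x \<in> M"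
    and adj: "\<And>x y. x \<in> M \<Longrightarrow> y \<in> M \<Longrightarrow> inner (N x) y = inner x (N' y)"
    and comm: "\<And>x. x \<in> M \<Longrightarrow> N (N' x) = N' (N x)"
    and below: "\<And>x. x \<in> M \<Longrightarrow> norm x \<le> C * norm (N x)"
  shows "bij_betw N M M"
proof -
  interpret N: bounded_linear N by fact
  have inj: "inj_on N M"
  proof (rule inj_onI)
    fix x y assume "x \<in> M" "y \<in> M" "N x = N y"
    then show "x = y" using below[of "x - y"] M(2) by (simp add: subspace_diff N.diff)
  qed
  have sub: "subspace (N ` M)"
    using M(2) by (rule linear_subspace_image[OF N.linear])
  have "closed (N ` M)"
    unfolding closed_sequential_limits
  proof (intro allI impI, elim conjE)
    fix f l assume f: "\<forall>k. f k \<in> N ` M" "f \<longlonglongrightarrow> l"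
    have "\<forall>k. \<exists>x. x \<in> M \<and> f k = N x" using f(1) by auto
    then obtain g where g: "\<And>k. g k \<in> M" "\<And>k. f k = N (g k)" by metis
    have "Cauchy g"
    proof (rule metric_CauchyI)
      fix e :: real assume "e > 0"
      define e' where "e' = e / (\<bar>C\<bar> + 1)"
      have "e' > 0" using \<open>e > 0\<close> by (simp add: e'_def add_nonneg_pos)
      then obtain K where K: "\<And>k l. k \<ge> K \<Longrightarrow> l \<ge> K \<Longrightarrow> dist (f k) (f l) < e'"
        using LIMSEQ_imp_Cauchy[OF f(2)] by (meson Cauchy_def)
      have "dist (g k) (g l) < e" if "k \<ge> K" "l \<ge> K" for k l
      proof -
        have "norm (g k - g l) \<le> C * norm (f k - f l)"
          using below[of "g k - g l"] g M(2) by (simp add: subspace_diff N.diff)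
        also have "\<dots> \<le> (\<bar>C\<bar> + 1) * norm (f k - f l)" by (intro mult_right_mono) auto
        also have "\<dots> < (\<bar>C\<bar> + 1) * e'"
          using K[OF that] by (intro mult_strict_left_mono) (auto simp: dist_norm)
        also have "\<dots> = e" by (simp add: e'_def)
        finally show ?thesis by (simp add: dist_norm)
      qed
      then show "\<exists>K. \<forall>k\<ge>K. \<forall>l\<ge>K. dist (g k) (g l) < e" by blast
    qed
    then obtain x where x: "g \<longlonglongrightarrow> x" using Cauchy_convergent convergent_def by blast
    have "x \<in> M" using closed_sequentially[OF M(1) _ x] g(1) by auto
    moreover have "l = N x"
      using LIMSEQ_unique[OF f(2)] N.tendsto[OF x] g(2) by presburger
    ultimately show "l \<in> N ` M" by blast
  qed
  moreover have "M \<subseteq> N ` M"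
  proof
    fix y assume y: "y \<in> M"
    obtain m where m: "m \<in> N ` M" "\<And>z. z \<in> N ` M \<Longrightarrow> inner (y - m) z = 0"
      using orthogonal_decomposition[OF \<open>closed (N ` M)\<close> sub] by metis
    define w where "w = y - m"
    have w: "w \<in> M" using m(1) y inv M(2) by (auto simp: w_def subspace_diff)
    have "inner (N x) w = 0" if "x \<in> M" for x using m(2) that by (auto simp: w_def inner_commute)
    then have "inner (N (N' w)) w = 0" using inv(2)[OF w] by blast
    then have "N' w = 0" using adj[OF inv(2)[OF w] w] by simp
    moreover have "inner (N w) (N w) = inner w (N (N' w))"
      using adj[OF w inv(1)[OF w]] comm[OF w] by simp
    ultimately have "N w = 0" using N.zero by simp
    then have "w = 0" using below[OF w] by simp
    then show "y \<in> N ` M" using m(1) by (simp add: w_def)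
  qed
  ultimately show ?thesis using inj inv(1) by (auto simp: bij_betw_def)
qed

section \<open>The asymptotic limit of a contraction\<close>

lemma bounded_op_UNIV_diff_id: "bounded_op UNIV A \<Longrightarrow> bounded_op UNIV (\<lambda>x. x - A x)"
  using bounded_linear_sub[OF bounded_linear_ident bounded_op_UNIV_linear]
  by (intro bounded_op_UNIV_I) (auto simp: bounded_op_UNIV_scaleC scaleC_diff_right)

lemma closed_csubspace_kernel: "bounded_op UNIV A \<Longrightarrow> closed_csubspace (kernel A)"
  unfolding closed_csubspace_def kernel_def
proof (intro conjI ballI allI)
  assume A: "bounded_op UNIV A"
  interpret bounded_linear A by (rule bounded_op_UNIV_linear[OF A])
  show "closed {x. A x = 0}"
    by (intro closed_Collect_eq continuous_on continuous_intros)
  show "0 \<in> {x. A x = 0}" by (simp add: zero)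
  show "x + y \<in> {x. A x = 0}" if "x \<in> {x. A x = 0}" "y \<in> {x. A x = 0}" for x y
    using that by (simp add: add)
  show "a *\<^sub>C x \<in> {x. A x = 0}" if "x \<in> {x. A x = 0}" for a x
    using that by (simp add: bounded_op_UNIV_scaleC[OF A] scaleC_zero_right)
qed

lemma norm_diff_square: "(norm (x - y))\<^sup>2 = (norm x)\<^sup>2 - 2 * inner y x + (norm y)\<^sup>2"
  for x y :: "'a::real_inner"
  by (simp add: power2_norm_eq_inner inner_diff_left inner_diff_right inner_commute)

text \<open>\<open>D\<close> is the adjoint of the contraction \<open>P\<close>; keeping both as parameters makes the hypotheses
  symmetric, so that every fact about \<open>P\<close> has its dual for \<open>D\<close>.\<close>

locale contraction_pair =
  fixes P D :: "'a::complex_hilbert \<Rightarrow> 'a"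
  assumes opP: "bounded_op UNIV P" and opD: "bounded_op UNIV D"
    and adjoint: "\<And>x y. inner (P x) y = inner x (D y)"
    and contraction: "\<And>x. norm (P x) \<le> norm x"

definition asymptotic_limit :: "('a::complex_hilbert \<Rightarrow> 'a) \<Rightarrow> ('a \<Rightarrow> 'a) \<Rightarrow> 'a \<Rightarrow> 'a" where
  "asymptotic_limit P D = strong_limit (\<lambda>k x. (D ^^ k) ((P ^^ k) x))"

definition stable_vectors :: "('a::complex_hilbert \<Rightarrow> 'a) \<Rightarrow> 'a set" where
  "stable_vectors P = {x. (\<lambda>k. (P ^^ k) x) \<longlonglongrightarrow> 0}"

definition isometric_vectors :: "('a::complex_hilbert \<Rightarrow> 'a) \<Rightarrow> 'a set" where
  "isometric_vectors P = {x. \<forall>k. norm ((P ^^ k) x) = norm x}"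

context contraction_pair
begin

abbreviation A where "A \<equiv> asymptotic_limit P D"

lemma dual: "contraction_pair D P"
proof
  show "inner (D x) y = inner x (P y)" for x y
    by (metis adjoint inner_commute)
  show "norm (D x) \<le> norm x" for x
  proof (cases "D x = 0")
    case False
    have "norm (D x) * norm (D x) = inner (P (D x)) x"
      by (simp add: adjoint power2_norm_eq_inner flip: power2_eq_square)
    also have "\<dots> \<le> norm (P (D x)) * norm x" by (rule norm_cauchy_schwarz)
    also have "\<dots> \<le> norm (D x) * norm x"
      by (intro mult_right_mono contraction) simp
    finally show ?thesis using False by simp
  qed simp
qed (rule opD opP)+

lemma linear_P: "bounded_linear P" and linear_D: "bounded_linear D"
  by (rule bounded_op_UNIV_linear[OF opP] bounded_op_UNIV_linear[OF opD])+

lemma bounded_op_pow: "bounded_op UNIV (P ^^ k)"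
proof (induction k)
  case 0
  show ?case by (intro bounded_op_UNIV_I) (auto simp: id_def)
next
  case (Suc k)
  show ?case
    using bounded_linear_compose[OF linear_P bounded_op_UNIV_linear[OF Suc]]
    by (intro bounded_op_UNIV_I) (auto simp: o_def bounded_op_UNIV_scaleC[OF Suc]
        bounded_op_UNIV_scaleC[OF opP])
qed

lemma norm_pow_antimono: "m \<le> k \<Longrightarrow> norm ((P ^^ k) x) \<le> norm ((P ^^ m) x)"
proof (induction k rule: dec_induct)
  case (step k)
  then show ?case using contraction[of "(P ^^ k) x"] by simp
qed simp

lemma norm_pow_le: "norm ((P ^^ k) x) \<le> norm x"
  using norm_pow_antimono[of 0 k x] by simp

lemma pow_adjoint: "inner ((P ^^ k) x) y = inner x ((D ^^ k) y)"
proof (induction k arbitrary: y)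
  case (Suc k)
  have "inner (P ((P ^^ k) x)) y = inner x ((D ^^ k) (D y))"
    by (simp only: adjoint Suc)
  then show ?case by (simp add: funpow_swap1[of D])
qed simp

lemma inner_DkPk: "inner ((D ^^ k) ((P ^^ k) x)) y = inner ((P ^^ k) x) ((P ^^ k) y)"
  by (subst (1 2) inner_commute) (rule pow_adjoint[symmetric])

lemma isometric_cancel:
  assumes "norm (P x) = norm x"
  shows "D (P x) = x"
proof -
  have "norm (D (P x) - x) ^ 2 = norm (D (P x)) ^ 2 - 2 * inner (P x) (P x) + norm x ^ 2"
    by (simp add: norm_diff_square flip: adjoint)
  also have "\<dots> \<le> norm (P x) ^ 2 - 2 * inner (P x) (P x) + norm x ^ 2"
    using contraction_pair.contraction[OF dual] by (simp add: power_mono)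
  also have "\<dots> = 0" using assms by (simp flip: power2_norm_eq_inner)
  finally show ?thesis by simp
qed

text \<open>
  For \<open>m \<le> k\<close> the operator \<open>C = D\<^sup>m P\<^sup>m - D\<^sup>k P\<^sup>k\<close> satisfies \<open>0 \<le> C \<le> I\<close>, and then
  \<open>\<parallel>C x\<parallel>\<^sup>2 \<le> \<langle>C x, x\<rangle>\<close>; so convergence of the numbers \<open>\<parallel>P\<^sup>k x\<parallel>\<^sup>2\<close> forces strong convergence.
\<close>

lemma norm_difference_le:
  assumes "m \<le> k"
  shows "(norm ((D ^^ m) ((P ^^ m) x) - (D ^^ k) ((P ^^ k) x)))\<^sup>2
    \<le> (norm ((P ^^ m) x))\<^sup>2 - (norm ((P ^^ k) x))\<^sup>2"
proof -
  define C where "C x = (D ^^ m) ((P ^^ m) x) - (D ^^ k) ((P ^^ k) x)" for x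
  have C: "inner (C x) y = inner ((P ^^ m) x) ((P ^^ m) y) - inner ((P ^^ k) x) ((P ^^ k) y)" for x y
    by (simp add: C_def inner_diff_left inner_DkPk)
  have sym: "inner (C x) y = inner x (C y)" for x y
    using C[of x y] C[of y x] by (simp add: inner_commute)
  have pos: "0 \<le> inner (C y) y" and le: "inner (C y) y \<le> (norm y)\<^sup>2" for y
    using power_mono[OF norm_pow_antimono[OF assms, of y], of 2]
      power_mono[OF norm_pow_le[of m y], of 2]
    by (auto simp: C simp flip: power2_norm_eq_inner intro: order_trans[of _ "(norm ((P ^^ m) y))\<^sup>2"])
  have lin: "C (x - y) = C x - C y" for x y
    by (rule vector_eq_ldot[THEN iffD1]) (simp flip: sym add: inner_diff_right)
  have "0 \<le> inner (C (x - C x)) (x - C x)" by (rule pos)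
  also have "\<dots> = inner (C x) x - 2 * (norm (C x))\<^sup>2 + inner (C (C x)) (C x)"
    by (simp add: lin inner_diff_left inner_diff_right sym power2_norm_eq_inner)
  also have "\<dots> \<le> inner (C x) x - (norm (C x))\<^sup>2" using le[of "C x"] by simp
  finally have "(norm (C x))\<^sup>2 \<le> inner (C x) x" by simp
  then show ?thesis
    by (simp add: C) (simp add: C_def power2_norm_eq_inner)
qed

lemma tendsto_A: "(\<lambda>k. (D ^^ k) ((P ^^ k) x)) \<longlonglongrightarrow> A x"
proof -
  have "decseq (\<lambda>k. (norm ((P ^^ k) x))\<^sup>2)"
    by (intro decseq_SucI power_mono norm_pow_antimono) auto
  then have "convergent (\<lambda>k. (norm ((P ^^ k) x))\<^sup>2)"
    by (rule decseq_convergent[of _ 0]) (auto intro: convergentI)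
  then have Cau: "Cauchy (\<lambda>k. (norm ((P ^^ k) x))\<^sup>2)" by (rule convergent_Cauchy)
  have "Cauchy (\<lambda>k. (D ^^ k) ((P ^^ k) x))"
  proof (rule metric_CauchyI)
    fix e :: real assume e: "e > 0"
    then obtain N where N: "\<And>k l. k \<ge> N \<Longrightarrow> l \<ge> N \<Longrightarrow>
        dist ((norm ((P ^^ k) x))\<^sup>2) ((norm ((P ^^ l) x))\<^sup>2) < e\<^sup>2"
      using Cau by (meson Cauchy_def zero_less_power)
    have *: "dist ((D ^^ k) ((P ^^ k) x)) ((D ^^ l) ((P ^^ l) x)) < e" if "k \<ge> N" "l \<ge> k" for k l
    proof -
      have "(dist ((D ^^ k) ((P ^^ k) x)) ((D ^^ l) ((P ^^ l) x)))\<^sup>2 < e\<^sup>2"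
        using norm_difference_le[OF that(2), of x] N[of k l] that
        by (simp add: dist_norm)
      then show ?thesis using e by (simp add: power_less_imp_less_base)
    qed
    have "dist ((D ^^ k) ((P ^^ k) x)) ((D ^^ l) ((P ^^ l) x)) < e" if "k \<ge> N" "l \<ge> N" for k l
      using *[of k l] *[of l k] that by (cases "k \<le> l") (auto simp: dist_commute)
    then show "\<exists>N. \<forall>k\<ge>N. \<forall>l\<ge>N. dist ((D ^^ k) ((P ^^ k) x)) ((D ^^ l) ((P ^^ l) x)) < e"
      by blast
  qed
  then show ?thesis
    unfolding asymptotic_limit_def strong_limit_def
    by (simp add: Cauchy_convergent convergent_LIMSEQ_iff[symmetric])
qed

lemma tendsto_inner_A: "(\<lambda>k. inner ((P ^^ k) x) ((P ^^ k) y)) \<longlonglongrightarrow> inner (A x) y"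
  using tendsto_inner[OF tendsto_A tendsto_const, of x y] by (simp add: inner_DkPk)

lemma tendsto_norm_pow: "(\<lambda>k. (norm ((P ^^ k) x))\<^sup>2) \<longlonglongrightarrow> inner (A x) x"
  using tendsto_inner_A[of x x] by (simp add: power2_norm_eq_inner)

lemma norm_A_le: "norm (A x) \<le> norm x"
proof (rule LIMSEQ_le_const2[OF tendsto_norm[OF tendsto_A]])
  interpret d: contraction_pair D P by (rule dual)
  show "\<exists>N. \<forall>k\<ge>N. norm ((D ^^ k) ((P ^^ k) x)) \<le> norm x"
    using order_trans[OF d.norm_pow_le norm_pow_le] by blast
qed

lemma bounded_op_A: "bounded_op UNIV A"
proof -
  interpret d: contraction_pair D P by (rule dual)
  note lin = bounded_op_UNIV_linear[OF bounded_op_pow] bounded_op_UNIV_linear[OF d.bounded_op_pow]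
  have "A (x + y) = A x + A y" for x y
    using tendsto_add[OF tendsto_A tendsto_A, of x y] LIMSEQ_unique[OF tendsto_A[of "x + y"]]
    by (simp add: linear_add[OF bounded_linear.linear[OF lin(1)]]
        linear_add[OF bounded_linear.linear[OF lin(2)]])
  moreover have "A (a *\<^sub>C x) = a *\<^sub>C A x" for a x
    using bounded_linear.tendsto[OF bounded_linear_scaleC tendsto_A, of a x]
      LIMSEQ_unique[OF tendsto_A[of "a *\<^sub>C x"]]
    by (simp add: bounded_op_UNIV_scaleC[OF bounded_op_pow] bounded_op_UNIV_scaleC[OF d.bounded_op_pow])
  ultimately show ?thesis
    using norm_A_le by (auto simp: bounded_op_def clinear_on_def intro!: exI[of _ 1])
qed

lemma A_diff: "A (x - y) = A x - A y"
  by (rule linear_diff[OF bounded_linear.linear[OF bounded_op_UNIV_linear[OF bounded_op_A]]])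

lemma A_symmetric: "inner (A x) y = inner x (A y)"
proof -
  have "(\<lambda>k. inner ((P ^^ k) x) ((P ^^ k) y)) \<longlonglongrightarrow> inner (A y) x"
    using tendsto_inner_A[of y x] by (simp add: inner_commute)
  from LIMSEQ_unique[OF tendsto_inner_A this] show ?thesis by (simp add: inner_commute)
qed

lemma D_A_P: "D (A (P x)) = A x"
proof (rule LIMSEQ_unique)
  show "(\<lambda>k. D ((D ^^ k) ((P ^^ k) (P x)))) \<longlonglongrightarrow> D (A (P x))"
    by (rule bounded_linear.tendsto[OF linear_D tendsto_A])
  show "(\<lambda>k. D ((D ^^ k) ((P ^^ k) (P x)))) \<longlonglongrightarrow> A x"
    using LIMSEQ_Suc[OF tendsto_A[of x]] by (simp add: funpow_swap1)
qed

lemma kernel_A: "kernel A = stable_vectors P"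
  unfolding stable_vectors_def
proof (intro set_eqI iffI)
  fix x assume "x \<in> kernel A"
  then have "(\<lambda>k. (norm ((P ^^ k) x))\<^sup>2) \<longlonglongrightarrow> 0"
    using tendsto_norm_pow[of x] by (simp add: kernel_def)
  then have "(\<lambda>k. sqrt ((norm ((P ^^ k) x))\<^sup>2)) \<longlonglongrightarrow> sqrt 0" by (rule tendsto_real_sqrt)
  then show "x \<in> {x. (\<lambda>k. (P ^^ k) x) \<longlonglongrightarrow> 0}" by (simp add: tendsto_norm_zero_iff)
next
  interpret d: contraction_pair D P by (rule dual)
  fix x assume "x \<in> {x. (\<lambda>k. (P ^^ k) x) \<longlonglongrightarrow> 0}"
  then have "(\<lambda>k. norm ((P ^^ k) x)) \<longlonglongrightarrow> 0" by (simp add: tendsto_norm_zero)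
  then have "(\<lambda>k. (D ^^ k) ((P ^^ k) x)) \<longlonglongrightarrow> 0"
    by (rule Lim_null_comparison[rotated]) (simp add: d.norm_pow_le)
  then show "x \<in> kernel A" using LIMSEQ_unique[OF tendsto_A] by (simp add: kernel_def)
qed

lemma kernel_I_minus_A: "kernel (\<lambda>x. x - A x) = isometric_vectors P"
  unfolding isometric_vectors_def
proof (intro set_eqI iffI)
  fix x assume "x \<in> kernel (\<lambda>x. x - A x)"
  then have lim: "(\<lambda>k. (norm ((P ^^ k) x))\<^sup>2) \<longlonglongrightarrow> (norm x)\<^sup>2"
    using tendsto_norm_pow[of x] by (simp add: kernel_def power2_norm_eq_inner)
  have "norm ((P ^^ k) x) = norm x" for k
  proof (rule antisym[OF norm_pow_le])
    have "(norm x)\<^sup>2 \<le> (norm ((P ^^ k) x))\<^sup>2"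
      by (rule LIMSEQ_le_const2[OF lim]) (use norm_pow_antimono[of k] in \<open>auto intro!: power_mono\<close>)
    then show "norm x \<le> norm ((P ^^ k) x)" by (rule power2_le_imp_le) simp
  qed
  then show "x \<in> {x. \<forall>k. norm ((P ^^ k) x) = norm x}" by simp
next
  fix x assume x: "x \<in> {x. \<forall>k. norm ((P ^^ k) x) = norm x}"
  have "(D ^^ k) ((P ^^ k) x) = x" for k
    using norm_difference_le[of 0 k x] x by simp
  then show "x \<in> kernel (\<lambda>x. x - A x)"
    using LIMSEQ_unique[OF tendsto_A[of x], of x] by (simp add: kernel_def)
qed

lemma closed_csubspace_stable_vectors: "closed_csubspace (stable_vectors P)"
  and closed_csubspace_isometric_vectors: "closed_csubspace (isometric_vectors P)"
  using closed_csubspace_kernel[OF bounded_op_A]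
    closed_csubspace_kernel[OF bounded_op_UNIV_diff_id[OF bounded_op_A]]
  by (simp_all only: kernel_A kernel_I_minus_A)

lemma norm_isometric_vectors: "x \<in> isometric_vectors P \<Longrightarrow> norm (P x) = norm x"
  unfolding isometric_vectors_def by (auto dest: spec[of _ 1])

lemma isometric_vectors_cancel: "x \<in> isometric_vectors P \<Longrightarrow> D (P x) = x"
  by (rule isometric_cancel[OF norm_isometric_vectors])

lemma isometric_vectors_image: "x \<in> isometric_vectors P \<Longrightarrow> P x \<in> isometric_vectors P"
proof -
  assume x: "x \<in> isometric_vectors P"
  have "norm ((P ^^ k) (P x)) = norm x" for k
    using x[unfolded isometric_vectors_def, THEN CollectD, rule_format, of "Suc k"]
    by (simp only: funpow_Suc_right o_apply)
  then show ?thesis using norm_isometric_vectors[OF x] by (simp add: isometric_vectors_def)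
qed

lemma pow_cancel:
  assumes "x \<in> isometric_vectors P"
  shows "(D ^^ k) ((P ^^ k) x) = x"
  using norm_difference_le[of 0 k x] assms unfolding isometric_vectors_def by simp

text \<open>
  For idempotent \<open>A\<close> the selfadjoint operator \<open>A\<close> is the orthogonal projection onto the isometric
  part, along the stable part.
\<close>

lemma idempotent_orthogonal:
  assumes "A = A \<circ> A"
  shows "isometric_vectors P = {v. \<forall>u\<in>stable_vectors P. inner u v = 0}"
    and "stable_vectors P = {u. \<forall>v\<in>isometric_vectors P. inner u v = 0}"
  unfolding kernel_A[symmetric] kernel_I_minus_A[symmetric]
proof -
  have AA: "A (A x) = A x" for x using assms by (metis comp_apply)
  have orth: "inner u v = 0" if "u \<in> kernel A" "v \<in> kernel (\<lambda>x. x - A x)" for u v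
    using that A_symmetric[of u v] by (simp add: kernel_def)
  have split: "x - A x \<in> kernel A" "A x \<in> kernel (\<lambda>x. x - A x)" for x
    by (simp_all add: kernel_def A_diff AA)
  have "v \<in> kernel (\<lambda>x. x - A x)" if v: "\<forall>u\<in>kernel A. inner u v = 0" for v
  proof -
    have "inner (v - A v) (v - A v) = inner (v - A v) v - inner (v - A v) (A v)"
      by (rule inner_diff_right)
    also have "\<dots> = 0" using v split orth by simp
    finally show ?thesis by (simp add: kernel_def)
  qed
  then show "kernel (\<lambda>x. x - A x) = {v. \<forall>u\<in>kernel A. inner u v = 0}" using orth by blast
  have "u \<in> kernel A" if u: "\<forall>v\<in>kernel (\<lambda>x. x - A x). inner u v = 0" for u
    using u split[of u] A_symmetric[of u "A u"] AA[of u] by (simp add: kernel_def)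
  then show "kernel A = {u. \<forall>v\<in>kernel (\<lambda>x. x - A x). inner u v = 0}" using orth by blast
qed

text \<open>
  If the two asymptotic limits agree, then \<open>A = D A P = P A D\<close>, and \<open>T = D P\<close> satisfies
  \<open>T A T = A\<close>. The vectors \<open>y\<^sub>k = A T\<^sup>k x\<close> are a bounded backward orbit, \<open>T y\<^bsub>k+1\<^esub> = y\<^sub>k\<close>, and
  positivity of the contraction \<open>T\<close> gives
  \<open>\<parallel>y\<^bsub>k+1\<^esub> - y\<^sub>k\<parallel>\<^sup>2 \<le> \<parallel>y\<^bsub>k+1\<^esub>\<parallel>\<^sup>2 - \<parallel>y\<^sub>k\<parallel>\<^sup>2\<close>, which tends to \<open>0\<close>. Since \<open>T\<^sup>k\<close> maps \<open>y\<^sub>k - T y\<^sub>k\<close> to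
  \<open>y\<^sub>0 - T y\<^sub>0 = A x - T A x\<close>, the latter is \<open>0\<close>.
\<close>

lemma DP_A:
  assumes eq: "asymptotic_limit P D = asymptotic_limit D P"
  shows "D (P (A x)) = A x"
proof -
  interpret d: contraction_pair D P by (rule dual)
  define y where "y k = A (((D \<circ> P) ^^ k) x)" for k
  have Ty: "D (P (y (Suc k))) = y k" for k
    using d.D_A_P D_A_P by (simp add: y_def flip: eq)
  have T_contr: "norm (D (P z)) \<le> norm (P z)" "norm (D (P z)) \<le> norm z" for z
    using d.contraction contraction order_trans by blast+
  have T_pow: "norm (((D \<circ> P) ^^ k) x) \<le> norm x" for k
    by (induction k) (use T_contr(2) in \<open>auto intro: order_trans\<close>)
  have inc: "incseq (\<lambda>k. (norm (y k))\<^sup>2)"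
    using T_contr(2)[of "y (Suc _)"] by (intro incseq_SucI power_mono) (simp_all add: Ty)
  have "(norm (y k))\<^sup>2 \<le> (norm x)\<^sup>2" for k
    unfolding y_def by (intro power_mono order_trans[OF norm_A_le T_pow]) simp
  with inc obtain L where "(\<lambda>k. (norm (y k))\<^sup>2) \<longlonglongrightarrow> L"
    using incseq_convergent by blast
  then have lim: "(\<lambda>k. (norm (y (Suc k)))\<^sup>2 - (norm (y k))\<^sup>2) \<longlonglongrightarrow> 0"
    using tendsto_diff[OF LIMSEQ_Suc, of _ L _ L] by auto
  have step: "(norm (y (Suc k) - D (P (y (Suc k)))))\<^sup>2 \<le> (norm (y (Suc k)))\<^sup>2 - (norm (y k))\<^sup>2" for k
  proof -
    let ?z = "y (Suc k)"
    have "(norm (?z - D (P ?z)))\<^sup>2 = (norm ?z)\<^sup>2 - 2 * (norm (P ?z))\<^sup>2 + (norm (D (P ?z)))\<^sup>2"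
      unfolding norm_diff_square d.adjoint by (simp add: power2_norm_eq_inner)
    moreover have "(norm (D (P ?z)))\<^sup>2 \<le> (norm (P ?z))\<^sup>2"
      by (intro power_mono T_contr) simp
    ultimately show ?thesis by (simp add: Ty)
  qed
  have mono: "norm (y 0 - D (P (y 0))) \<le> norm (y k - D (P (y k)))" for k
  proof (induction k)
    case (Suc k)
    have "y k - D (P (y k)) = D (P (y (Suc k) - D (P (y (Suc k)))))"
      by (simp add: Ty linear_diff[OF bounded_linear.linear[OF linear_P]]
          linear_diff[OF bounded_linear.linear[OF linear_D]])
    then have "norm (y k - D (P (y k))) \<le> norm (y (Suc k) - D (P (y (Suc k))))"
      using T_contr(2) by metis
    then show ?case using Suc by simp
  qed simp
  have "(norm (y 0 - D (P (y 0))))\<^sup>2 \<le> 0"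
    by (rule LIMSEQ_le_const[OF lim])
       (use order_trans[OF power_mono[OF mono] step] in auto)
  then show ?thesis by (simp add: y_def)
qed

text \<open>
  Besides \<open>D P A = A\<close> one has \<open>P D A = A\<close> by duality, so \<open>P A = P D A P = A P\<close>. Then \<open>D\<^sup>k P\<^sup>k\<close> fixes the range of
  \<open>A\<close> for every \<open>k\<close>, and so does the limit \<open>A\<close>.
\<close>

lemma idempotent_if_limits_agree:
  assumes eq: "asymptotic_limit P D = asymptotic_limit D P"
  shows "A = A \<circ> A"
proof -
  interpret d: contraction_pair D P by (rule dual)
  have comm: "P (A x) = A (P x)" for x
    using d.DP_A[OF eq[symmetric], of "P x"] by (simp add: D_A_P flip: eq)
  have "(D ^^ k) ((P ^^ k) (A x)) = A x" for k x
  proof (induction k arbitrary: x)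
    case (Suc k)
    have "(D ^^ Suc k) ((P ^^ Suc k) (A x)) = D ((D ^^ k) ((P ^^ k) (A (P x))))"
      by (simp add: comm funpow_swap1)
    then show ?case by (simp add: Suc D_A_P)
  qed simp
  then have "A (A x) = A x" for x
    using LIMSEQ_unique[OF tendsto_A[of "A x"], of "A x"] by simp
  then show ?thesis by (simp add: fun_eq_iff)
qed

end

section \<open>Elementary symmetric functions on the polydisc\<close>

definition esym :: "nat \<Rightarrow> nat \<Rightarrow> (nat \<Rightarrow> complex) \<Rightarrow> complex" where
  "esym n i z = (\<Sum>J | J \<subseteq> {1..n} \<and> card J = i. \<Prod>j\<in>J. z j)"

lemma sym_map_eq_esym: "i \<in> {1..n} \<Longrightarrow> sym_map n z i = esym n i z"
  by (simp add: sym_map_def esym_def)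

lemma esym_0 [simp]: "esym n 0 z = 1"
proof -
  have "{J. J \<subseteq> {1..n} \<and> card J = 0} = {{}}" by (auto dest: finite_subset)
  then show ?thesis by (simp only: esym_def) simp
qed

lemma esym_top: "esym n n z = (\<Prod>j=1..n. z j)"
proof -
  have "J = {1..n}" if "J \<subseteq> {1..n}" "card J = n" for J
    using card_subset_eq[of "{1..n}" J] that by simp
  then have "{J. J \<subseteq> {1..n} \<and> card J = n} = {{1..n}}" by auto
  then show ?thesis by (simp only: esym_def) simp
qed

lemma sum_Pow_by_card:
  fixes f :: "nat set \<Rightarrow> 'b::comm_monoid_add"
  shows "(\<Sum>X\<in>Pow {1..n}. f X) = (\<Sum>i\<le>n. \<Sum>X | X \<subseteq> {1..n} \<and> card X = i. f X)"
proof -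
  have "card ` Pow {1..n} \<subseteq> {..n}"
    by (auto simp: Pow_def) (use card_mono[of "{1..n}"] in fastforce)
  from sum.group[OF _ _ this, of f, symmetric] show ?thesis by (simp add: Pow_def)
qed

lemma prod_one_minus_eq_esym: "(\<Prod>j=1..n. 1 - u * z j) = (\<Sum>i\<le>n. (- u) ^ i * esym n i z)"
proof -
  have "(\<Prod>j=1..n. 1 - u * z j) = (\<Prod>j=1..n. (- u) * z j + 1)" by simp
  also have "\<dots> = (\<Sum>X\<in>Pow {1..n}. (- u) ^ card X * (\<Prod>j\<in>X. z j))"
    by (subst prod_add)
       (simp_all only: finite_atLeastAtMost prod.distrib prod_constant power_one mult_1_right)
  also have "\<dots> = (\<Sum>i\<le>n. (- u) ^ i * esym n i z)"
    unfolding sum_Pow_by_card esym_def sum_distrib_left by (intro sum.cong) auto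
  finally show ?thesis .
qed

text \<open>Vieta's formula.\<close>

lemma coeff_prod_linear:
  assumes "i \<le> n"
  shows "coeff (\<Prod>j=1..n. [:- z j, 1:]) (n - i) = (-1) ^ i * esym n i z"
proof -
  have X: "(\<Prod>j\<in>X. [:- z j:]) = [:(-1) ^ card X * (\<Prod>j\<in>X. z j):]" if "finite X" for X
    using that by (induction X) (auto simp: one_pCons mult_ac)
  have "(\<Prod>j=1..n. [:- z j, 1:]) = (\<Prod>j=1..n. [:- z j:] + [:0, 1:])" by simp
  also have "\<dots> = (\<Sum>X\<in>Pow {1..n}. monom ((-1) ^ card X * (\<Prod>j\<in>X. z j)) (n - card X))"
  proof (subst prod_add, simp, intro sum.cong refl)
    fix X assume "X \<in> Pow {1..n}"
    then have "finite X" "card ({1..n} - X) = n - card X"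
      by (auto intro: finite_subset simp: card_Diff_subset finite_subset)
    then show "(\<Prod>j\<in>X. [:- z j:]) * (\<Prod>j\<in>{1..n} - X. [:0, 1:])
        = monom ((-1) ^ card X * (\<Prod>j\<in>X. z j)) (n - card X)"
      by (simp add: X monom_altdef)
  qed
  also have "\<dots> = (\<Sum>k\<le>n. monom ((-1) ^ k * esym n k z) (n - k))"
    unfolding sum_Pow_by_card esym_def sum_distrib_left
    by (intro sum.cong refl) (simp add: monom_sum)
  also have "coeff \<dots> (n - i) = (\<Sum>k\<le>n. if k = i then (-1) ^ k * esym n k z else 0)"
    unfolding coeff_sum using assms by (intro sum.cong) auto
  also have "\<dots> = (-1) ^ i * esym n i z" using assms by simp
  finally show ?thesis .
qed

text \<open>
  By Vieta and the fundamental theorem of algebra: \<open>z\<close> lists the roots of the monic polynomial whose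
  coefficients are the coordinates of \<open>w\<close> up to sign.
\<close>

lemma sym_map_surj:
  assumes w: "w \<in> {1..n} \<rightarrow>\<^sub>E UNIV"
  obtains z where "z \<in> {1..n} \<rightarrow>\<^sub>E UNIV" "w = sym_map n z"
proof -
  define v where "v i = (if i = 0 then 1 else w i)" for i
  define p where "p = (\<Sum>k\<le>n. monom ((-1) ^ k * v k) (n - k))"
  have coeff: "coeff p (n - i) = (-1) ^ i * v i" if "i \<le> n" for i
  proof -
    have "coeff p (n - i) = (\<Sum>k\<le>n. if k = i then (-1) ^ k * v k else 0)"
      unfolding p_def coeff_sum using that by (intro sum.cong) auto
    then show ?thesis using that by simp
  qed
  have deg: "degree p = n"
  proof (rule antisym)
    show "degree p \<le> n"
      unfolding p_def by (intro degree_sum_le) (auto intro: order_trans[OF degree_monom_le])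
    show "n \<le> degree p" using coeff[of 0] by (intro le_degree) (simp add: v_def)
  qed
  have lead: "lead_coeff p = 1" using coeff[of 0] by (simp add: deg v_def)
  obtain root where "smult (lead_coeff p) (\<Prod>i<degree p. [:- root i, 1:]) = p"
    by (rule complex_poly_decompose')
  then have p: "p = (\<Prod>i<n. [:- root i, 1:])" unfolding lead by (simp add: deg)
  define z where "z = (\<lambda>j\<in>{1..n}. root (j - 1))"
  have "(\<Prod>i<n. [:- root i, 1:]) = (\<Prod>j=1..n. [:- z j, 1:])"
    by (rule prod.reindex_bij_witness[of _ "\<lambda>j. j - 1" Suc]) (auto simp: z_def)
  then have "esym n i z = v i" if "i \<le> n" for i
    using coeff[OF that] coeff_prod_linear[OF that, of z] by (simp add: p)
  then have "w = sym_map n z"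
    using w by (intro extensionalityI[of _ "{1..n}"])
      (auto simp: PiE_def sym_map_def[of n z] esym_def v_def)
  then show ?thesis using that[of z] by (auto simp: z_def)
qed

lemma norm_esym_le:
  assumes "\<And>j. j \<in> {1..n} \<Longrightarrow> cmod (z j) \<le> 1"
  shows "cmod (esym n i z) \<le> 2 ^ n"
proof -
  have "cmod (\<Prod>j\<in>J. z j) \<le> 1" if "J \<subseteq> {1..n}" for J
    using assms that unfolding prod_norm[symmetric] by (intro prod_le_1) auto
  then have "cmod (esym n i z) \<le> (\<Sum>J | J \<subseteq> {1..n} \<and> card J = i. 1)"
    unfolding esym_def by (intro sum_norm_le) auto
  also have "\<dots> \<le> real (card (Pow {1..n}))"
    by simp (intro card_mono, auto)
  finally show ?thesis by (simp add: card_Pow)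
qed

text \<open>On the torus \<open>z\<^sub>j\<inverse> = cnj z\<^sub>j\<close>, and taking complements of index sets exchanges the \<open>i\<close>-th and the
  \<open>(n - i)\<close>-th elementary symmetric function.\<close>

lemma esym_torus:
  assumes "i \<le> n" and z: "\<And>j. j \<in> {1..n} \<Longrightarrow> cmod (z j) = 1"
  shows "esym n (n - i) z = cnj (esym n i z) * esym n n z"
proof -
  have compl: "(\<Prod>j\<in>{1..n} - J. z j) = cnj (\<Prod>j\<in>J. z j) * (\<Prod>j=1..n. z j)" if J: "J \<subseteq> {1..n}" for J
  proof -
    have "cmod (\<Prod>j\<in>J. z j) = 1"
      using z J unfolding prod_norm[symmetric] by (intro prod.neutral) auto
    then have "cnj (\<Prod>j\<in>J. z j) * (\<Prod>j\<in>J. z j) = 1"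
      by (simp only: mult.commute[of "cnj _"] complex_norm_square[symmetric]) simp
    moreover have "(\<Prod>j=1..n. z j) = (\<Prod>j\<in>J. z j) * (\<Prod>j\<in>{1..n} - J. z j)"
      using prod.subset_diff[OF J] by (simp add: mult.commute)
    ultimately show ?thesis by (simp add: mult.assoc[symmetric])
  qed
  have "esym n (n - i) z = (\<Sum>J | J \<subseteq> {1..n} \<and> card J = i. \<Prod>j\<in>{1..n} - J. z j)"
    unfolding esym_def using assms(1)
    by (intro sum.reindex_bij_witness[of _ "\<lambda>J. {1..n} - J" "\<lambda>J. {1..n} - J"])
       (auto simp: card_Diff_subset finite_subset double_diff)
  also have "\<dots> = (\<Sum>J | J \<subseteq> {1..n} \<and> card J = i. cnj (\<Prod>j\<in>J. z j) * esym n n z)"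
    by (intro sum.cong refl) (simp only: compl esym_top mem_Collect_eq)
  also have "\<dots> = cnj (esym n i z) * esym n n z"
    by (simp add: esym_def[of n i] sum_distrib_right cnj_sum)
  finally show ?thesis .
qed

lemma holomorphic_esym_section: "(\<lambda>\<zeta>. esym n i (z(j := \<zeta>))) holomorphic_on S"
proof -
  have "(\<lambda>\<zeta>. (z(j := \<zeta>)) k) holomorphic_on S" for k
    by (cases "k = j") (auto intro!: holomorphic_intros)
  then show ?thesis unfolding esym_def
    by (intro holomorphic_on_sum holomorphic_on_prod) 
qed

text \<open>The maximum principle in one variable at a time: the bound on the torus \<open>\<bbbT>\<^sup>n\<close> spreads to the
  closed polydisc.\<close>

lemma polydisc_maximum_principle:
  fixes F :: "(nat \<Rightarrow> complex) \<Rightarrow> complex"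
  assumes hol: "\<And>z j. j \<in> {1..n} \<Longrightarrow> (\<And>k. k \<in> {1..n} \<Longrightarrow> cmod (z k) \<le> 1) \<Longrightarrow>
      (\<lambda>\<zeta>. F (z(j := \<zeta>))) holomorphic_on cball 0 1"
    and torus: "\<And>z. (\<And>k. k \<in> {1..n} \<Longrightarrow> cmod (z k) = 1) \<Longrightarrow> cmod (F z) \<le> B"
    and z: "\<And>k. k \<in> {1..n} \<Longrightarrow> cmod (z k) \<le> 1"
  shows "cmod (F z) \<le> B"
proof -
  have "cmod (F z) \<le> B" if "m \<le> n" "\<And>k. k \<in> {1..n} \<Longrightarrow> cmod (z k) \<le> 1"
    "\<And>k. k \<in> {Suc m..n} \<Longrightarrow> cmod (z k) = 1" for m z
    using that
  proof (induction m arbitrary: z)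
    case 0
    then show ?case by (intro torus) auto
  next
    case (Suc m)
    let ?g = "\<lambda>\<zeta>. F (z(Suc m := \<zeta>))"
    have hg: "?g holomorphic_on cball 0 1"
      using Suc.prems by (intro hol) auto
    have "cmod (?g (z (Suc m))) \<le> B"
    proof (rule maximum_modulus_frontier[where f = ?g and S = "cball 0 1"])
      show "?g holomorphic_on interior (cball 0 1)"
        using hg holomorphic_on_subset interior_subset by blast
      show "continuous_on (closure (cball 0 1)) ?g"
        using holomorphic_on_imp_continuous_on[OF hg] by simp
      show "z (Suc m) \<in> cball 0 1" using Suc.prems by simp
      fix \<zeta> :: complex assume "\<zeta> \<in> frontier (cball 0 1)"
      then have "cmod \<zeta> = 1" by simp
      then show "cmod (?g \<zeta>) \<le> B"
        using Suc.prems by (intro Suc.IH) auto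
    qed simp
    then show ?case by simp
  qed
  from this[of n z] show ?thesis using z by auto
qed

text \<open>
  On the torus both sides have equal modulus, because there \<open>s\<^bsub>n-i\<^esub> = cnj s\<^sub>i \<sqdot> p\<close>. The constant
  \<open>2\<^sup>n + 1\<close> serves to keep the denominator away from zero for every \<open>i\<close> at once.
\<close>

lemma esym_pencil_le:
  assumes a: "cmod a = 1" and i: "i \<le> n" and z: "\<And>k. k \<in> {1..n} \<Longrightarrow> cmod (z k) \<le> 1"
  shows "cmod ((2 ^ n + 1) * a * esym n n z - esym n (n - i) z) \<le> cmod ((2 ^ n + 1) - a * esym n i z)"
proof -
  define \<kappa> :: complex where "\<kappa> = 2 ^ n + 1"
  have \<kappa>: "\<kappa> = complex_of_real (2 ^ n + 1)" by (simp add: \<kappa>_def)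
  have nz: "\<kappa> - a * esym n i z \<noteq> 0" if "\<And>k. k \<in> {1..n} \<Longrightarrow> cmod (z k) \<le> 1" for z
  proof
    assume "\<kappa> - a * esym n i z = 0"
    then have "cmod \<kappa> = cmod (a * esym n i z)" by simp
    also have "\<dots> \<le> 2 ^ n" using a norm_esym_le[OF that] by (simp add: norm_mult)
    finally show False unfolding \<kappa> norm_of_real by simp
  qed
  let ?F = "\<lambda>z. (\<kappa> * a * esym n n z - esym n (n - i) z) / (\<kappa> - a * esym n i z)"
  have "cmod (?F z) \<le> 1"
  proof (rule polydisc_maximum_principle[OF _ _ z])
    fix z :: "nat \<Rightarrow> complex" and j assume *: "\<And>k. k \<in> {1..n} \<Longrightarrow> cmod (z k) \<le> 1"
    show "(\<lambda>\<zeta>. ?F (z(j := \<zeta>))) holomorphic_on cball 0 1"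
      using * by (intro holomorphic_intros holomorphic_esym_section nz) auto
  next
    fix z :: "nat \<Rightarrow> complex" assume *: "\<And>k. k \<in> {1..n} \<Longrightarrow> cmod (z k) = 1"
    have top: "cmod (esym n n z) = 1"
      using * unfolding esym_top prod_norm[symmetric] by (intro prod.neutral) auto
    have "esym n (n - i) z = cnj (esym n i z) * esym n n z"
      using * by (intro esym_torus i)
    then have "\<kappa> * a * esym n n z - esym n (n - i) z = (\<kappa> * a - cnj (esym n i z)) * esym n n z"
      by (simp add: algebra_simps)
    then have "cmod (\<kappa> * a * esym n n z - esym n (n - i) z) = cmod (\<kappa> * a - cnj (esym n i z))"
      by (simp add: norm_mult top)
    also have "\<dots> = cmod a * cmod (cnj (\<kappa> * a - cnj (esym n i z)))" using a by (simp only: complex_mod_cnj)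
    also have "\<dots> = cmod (\<kappa> * (a * cnj a) - a * esym n i z)"
      by (simp only: norm_mult[symmetric]) (simp add: \<kappa> algebra_simps)
    also have "a * cnj a = 1" using a by (simp only: complex_norm_square[symmetric]) simp
    finally show "cmod (?F z) \<le> 1" by (simp add: norm_divide divide_le_eq)
  qed
  then show ?thesis using nz[OF z] by (simp add: norm_divide divide_le_eq \<kappa>_def)
qed

section \<open>The sets \<open>\<Gamma>\<^sub>n\<close> and \<open>b\<Gamma>\<^sub>n\<close>\<close>

lemma Gam_esym:
  assumes "w \<in> Gam n"
  shows "\<exists>z. (\<forall>k\<in>{1..n}. cmod (z k) \<le> 1) \<and> (\<forall>i\<in>{1..n}. w i = esym n i z)"
proof -
  obtain z where z: "z \<in> {1..n} \<rightarrow>\<^sub>E cball 0 1" "w = sym_map n z"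
    using assms by (auto simp: Gam_def)
  have "cmod (z k) \<le> 1" if "k \<in> {1..n}" for k
    using PiE_mem[OF z(1) that] by simp
  then show ?thesis using z(2) sym_map_eq_esym by blast
qed

lemma Gam_nonempty: "Gam n \<noteq> {}"
proof -
  have "restrict (\<lambda>_. 0) {1..n} \<in> {1..n} \<rightarrow>\<^sub>E cball (0::complex) 1" by auto
  then show ?thesis unfolding Gam_def by blast
qed

lemma sum_atMost_shift: "(\<Sum>i\<le>n. f i) = f 0 + (\<Sum>i=1..n. f i)" for f :: "nat \<Rightarrow> 'b::comm_monoid_add"
  by (simp add: atMost_atLeast0 sum.atLeast_Suc_atMost)

text \<open>At \<open>w = \<pi>\<^sub>n(z)\<close> the sum is \<open>\<Prod>\<^sub>j (1 - u z\<^sub>j)\<close>, and each factor has modulus at least \<open>1 - |u|\<close>.\<close>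

lemma Gam_lower_bound:
  assumes "w \<in> Gam n" "cmod u < 1"
  shows "(1 - cmod u) ^ n \<le> cmod (1 + (\<Sum>i=1..n. (- u) ^ i * w i))"
proof -
  from assms(1) obtain z where z: "\<And>k. k \<in> {1..n} \<Longrightarrow> cmod (z k) \<le> 1"
    "\<And>i. i \<in> {1..n} \<Longrightarrow> w i = esym n i z" using Gam_esym by blast
  have eq: "1 + (\<Sum>i=1..n. (- u) ^ i * w i) = (\<Prod>j=1..n. 1 - u * z j)"
    unfolding prod_one_minus_eq_esym sum_atMost_shift using z(2) by simp
  have "1 - cmod u \<le> cmod (1 - u * z j)" if "j \<in> {1..n}" for j
  proof -
    have "cmod (u * z j) \<le> cmod u * 1"
      unfolding norm_mult using z(1)[OF that] by (intro mult_left_mono) auto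
    then show ?thesis using norm_triangle_ineq2[of 1 "u * z j"] by simp
  qed
  then have "(\<Prod>j=1..n. 1 - cmod u) \<le> (\<Prod>j=1..n. cmod (1 - u * z j))"
    using assms(2) by (intro prod_mono) auto
  then show ?thesis unfolding eq prod_norm by simp
qed

text \<open>\<open>w = \<pi>\<^sub>n(z)\<close> for the roots \<open>z\<close> of a polynomial; a root \<open>z\<^sub>j\<close> outside the disc gives \<open>u = 1 / z\<^sub>j\<close>.\<close>

lemma not_in_Gam:
  assumes w: "w \<in> {1..n} \<rightarrow>\<^sub>E UNIV" "w \<notin> Gam n"
  obtains u where "cmod u < 1" "1 + (\<Sum>i=1..n. (- u) ^ i * w i) = 0"
proof -
  obtain z where z: "z \<in> {1..n} \<rightarrow>\<^sub>E UNIV" "w = sym_map n z" using sym_map_surj[OF w(1)] .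
  have "\<exists>j\<in>{1..n}. \<not> cmod (z j) \<le> 1"
  proof (rule ccontr)
    assume "\<not> ?thesis"
    then have "z \<in> {1..n} \<rightarrow>\<^sub>E cball 0 1" using z(1) by (auto simp: PiE_iff)
    then show False using w(2) z(2) by (simp add: Gam_def)
  qed
  then obtain j where j: "j \<in> {1..n}" "cmod (z j) > 1" by force
  define u where "u = 1 / z j"
  have "z j \<noteq> 0" using j by auto
  then have "(\<Prod>j=1..n. 1 - u * z j) = 0" using j by (auto simp: u_def)
  then have "1 + (\<Sum>i=1..n. (- u) ^ i * w i) = 0"
    unfolding prod_one_minus_eq_esym sum_atMost_shift z(2) by (simp add: sym_map_eq_esym)
  moreover have "cmod u < 1" using j by (simp add: u_def norm_divide divide_less_eq)
  ultimately show ?thesis using that by blast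
qed

text \<open>Some \<open>z\<^sub>j\<close> is inside the disc, and the last coordinate is the product of all of them.\<close>

lemma not_in_bGam:
  assumes "w \<in> Gam n" "w \<notin> bGam n"
  shows "cmod (w n) < 1" and "1 \<le> n"
proof -
  obtain z where z: "z \<in> {1..n} \<rightarrow>\<^sub>E cball 0 1" "w = sym_map n z"
    using assms(1) by (auto simp: Gam_def)
  have le: "cmod (z k) \<le> 1" if "k \<in> {1..n}" for k
    using PiE_mem[OF z(1) that] by simp
  have "\<exists>j\<in>{1..n}. cmod (z j) \<noteq> 1"
  proof (rule ccontr)
    assume "\<not> ?thesis"
    then have "z \<in> {1..n} \<rightarrow>\<^sub>E sphere 0 1" using z(1) by (auto simp: PiE_iff)
    then show False using assms(2) z(2) by (simp add: bGam_def)
  qed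
  then obtain j where j: "j \<in> {1..n}" "cmod (z j) < 1" using le by force
  then show "1 \<le> n" by simp
  have "cmod (w n) = (\<Prod>j=1..n. cmod (z j))"
    using \<open>1 \<le> n\<close> by (simp add: z(2) sym_map_eq_esym esym_top prod_norm)
  also have "\<dots> = cmod (z j) * (\<Prod>j\<in>{1..n} - {j}. cmod (z j))"
    using j by (simp add: prod.remove)
  also have "\<dots> \<le> cmod (z j) * 1"
    using le by (intro mult_left_mono prod_le_1) auto
  finally show "cmod (w n) < 1" using j by simp
qed

lemma Gam_pencil_le:
  assumes "w \<in> Gam n" "cmod a = 1" "i \<in> {1..<n}"
  shows "cmod ((2 ^ n + 1) * a * w n - w (n - i)) \<le> cmod ((2 ^ n + 1) - a * w i)"
proof -
  from assms(1) obtain z where z: "\<And>k. k \<in> {1..n} \<Longrightarrow> cmod (z k) \<le> 1"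
    "\<And>i. i \<in> {1..n} \<Longrightarrow> w i = esym n i z" using Gam_esym by blast
  show ?thesis
    using esym_pencil_le[OF assms(2), of i n z] assms(3) z(1) z(2)[of i] z(2)[of n] z(2)[of "n - i"]
    by (simp add: Suc_le_eq)
qed

lemma Gam_pencil_nonzero:
  assumes "w \<in> Gam n" "cmod a = 1" "i \<in> {1..n}"
  shows "(2 ^ n + 1) - a * w i \<noteq> 0"
proof
  assume "(2 ^ n + 1) - a * w i = 0"
  then have "cmod (complex_of_real (2 ^ n + 1)) = cmod (a * w i)" by simp
  moreover from assms(1) obtain z where "\<And>k. k \<in> {1..n} \<Longrightarrow> cmod (z k) \<le> 1"
    "\<And>i. i \<in> {1..n} \<Longrightarrow> w i = esym n i z" using Gam_esym by blast
  then have "cmod (a * w i) \<le> 2 ^ n" using norm_esym_le assms(2,3) by (simp add: norm_mult)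
  ultimately show False unfolding norm_of_real by simp
qed

lemma Gam_last_le: "w \<in> Gam n \<Longrightarrow> 1 \<le> n \<Longrightarrow> cmod (w n) \<le> 1"
proof -
  assume "w \<in> Gam n" "1 \<le> n"
  from this(1) obtain z where z: "\<And>k. k \<in> {1..n} \<Longrightarrow> cmod (z k) \<le> 1"
    "\<And>i. i \<in> {1..n} \<Longrightarrow> w i = esym n i z" using Gam_esym by blast
  then show ?thesis
    using \<open>1 \<le> n\<close> by (auto simp: esym_top simp flip: prod_norm intro!: prod_le_1)
qed

section \<open>Polynomials of degree one\<close>

definition affine_poly :: "nat \<Rightarrow> complex \<Rightarrow> (nat \<Rightarrow> complex) \<Rightarrow> mpoly" where
  "affine_poly n c\<^sub>0 c =
     Poly_Mapping.single 0 c\<^sub>0 + (\<Sum>i=1..n. Poly_Mapping.single (Poly_Mapping.single i 1) (c i))"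

lemma poly_in_add: "poly_in n p \<Longrightarrow> poly_in n q \<Longrightarrow> poly_in n (p + q)"
  using Poly_Mapping.keys_add[of p q] by (auto simp: poly_in_def)

lemma poly_in_affine: "poly_in n (affine_poly n c\<^sub>0 c)"
proof -
  have "poly_in n (\<Sum>i\<in>I. Poly_Mapping.single (Poly_Mapping.single i 1) (c i))" if "I \<subseteq> {1..n}" for I
    using finite_subset[OF that finite_atLeastAtMost] that
  proof (induction I)
    case (insert i I)
    have "poly_in n (Poly_Mapping.single (Poly_Mapping.single i 1) (c i))"
      using insert by (auto simp: poly_in_def)
    then show ?case using insert by (auto intro: poly_in_add)
  qed (simp add: poly_in_def)
  moreover have "poly_in n (Poly_Mapping.single 0 c\<^sub>0)" by (simp add: poly_in_def)
  ultimately show ?thesis unfolding affine_poly_def by (intro poly_in_add) auto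
qed

lemma op_poly_superset:
  assumes "finite K" "Poly_Mapping.keys p \<subseteq> K"
  shows "op_poly n p T x = (\<Sum>m\<in>K. Poly_Mapping.lookup p m *\<^sub>C op_monom n T m x)"
  unfolding op_poly_def using assms
  by (intro sum.mono_neutral_left) (auto simp: in_keys_iff scaleC_zero_left)

lemma poly_eval_superset:
  assumes "finite K" "Poly_Mapping.keys p \<subseteq> K"
  shows "poly_eval n p z = (\<Sum>m\<in>K. Poly_Mapping.lookup p m * (\<Prod>i=1..n. z i ^ Poly_Mapping.lookup m i))"
  unfolding poly_eval_def using assms
  by (intro sum.mono_neutral_left) (auto simp: in_keys_iff)

lemma op_poly_add: "op_poly n (p + q) T x = op_poly n p T x + op_poly n q T x"
  using Poly_Mapping.keys_add[of p q]
  by (simp add: op_poly_superset[of "Poly_Mapping.keys p \<union> Poly_Mapping.keys q"] lookup_add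
      scaleC_add_left sum.distrib)

lemma poly_eval_add: "poly_eval n (p + q) z = poly_eval n p z + poly_eval n q z"
  using Poly_Mapping.keys_add[of p q]
  by (simp add: poly_eval_superset[of "Poly_Mapping.keys p \<union> Poly_Mapping.keys q"] lookup_add
      distrib_right sum.distrib)

lemma op_poly_single: "op_poly n (Poly_Mapping.single m c) T x = c *\<^sub>C op_monom n T m x"
  by (subst op_poly_superset[of "{m}"]) auto

lemma poly_eval_single:
  "poly_eval n (Poly_Mapping.single m c) z = c * (\<Prod>i=1..n. z i ^ Poly_Mapping.lookup m i)"
  by (subst poly_eval_superset[of "{m}"]) auto

lemma op_monom_trivial: "(\<And>j. j \<in> {1..n} \<Longrightarrow> Poly_Mapping.lookup m j = 0) \<Longrightarrow> op_monom n T m = id"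
  by (induction n) (auto simp: id_def)

lemma op_monom_variable: "i \<in> {1..n} \<Longrightarrow> op_monom n T (Poly_Mapping.single i 1) = T i"
proof (induction n)
  case (Suc n)
  show ?case
  proof (cases "i = Suc n")
    case True
    moreover have "op_monom n T (Poly_Mapping.single (Suc n) (Suc 0)) = id"
      by (rule op_monom_trivial) (simp add: lookup_single when_def)
    ultimately show ?thesis by simp
  next
    case False
    then show ?thesis using Suc by (auto simp: lookup_single when_def)
  qed
qed simp

lemma op_poly_affine:
  "op_poly n (affine_poly n c\<^sub>0 c) T x = c\<^sub>0 *\<^sub>C x + (\<Sum>i=1..n. c i *\<^sub>C T i x)"
proof -
  have "op_poly n (\<Sum>i\<in>I. Poly_Mapping.single (Poly_Mapping.single i 1) (c i)) T x
      = (\<Sum>i\<in>I. c i *\<^sub>C T i x)" if "I \<subseteq> {1..n}" for I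
    using finite_subset[OF that finite_atLeastAtMost] that
  proof (induction I)
    case (insert i I)
    then show ?case
      using op_monom_variable[of i n T] by (simp add: op_poly_add op_poly_single)
  qed (simp add: op_poly_def)
  then show ?thesis
    by (simp add: affine_poly_def op_poly_add op_poly_single op_monom_trivial)
qed

lemma poly_eval_affine:
  "poly_eval n (affine_poly n c\<^sub>0 c) z = c\<^sub>0 + (\<Sum>i=1..n. c i * z i)"
proof -
  have var: "(\<Prod>k=1..n. z k ^ Poly_Mapping.lookup (Poly_Mapping.single i 1) k) = z i" if "i \<in> {1..n}" for i
  proof -
    have "(\<Prod>k=1..n. z k ^ Poly_Mapping.lookup (Poly_Mapping.single i 1) k)
        = (\<Prod>k=1..n. if k = i then z k else 1)"
      by (intro prod.cong) (auto simp: lookup_single when_def)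
    then show ?thesis using that by simp
  qed
  have "poly_eval n (\<Sum>i\<in>I. Poly_Mapping.single (Poly_Mapping.single i 1) (c i)) z
      = (\<Sum>i\<in>I. c i * z i)" if "I \<subseteq> {1..n}" for I
    using finite_subset[OF that finite_atLeastAtMost] that
  proof (induction I)
    case (insert i I)
    then have "i \<in> {1..n}" by simp
    from var[OF this] show ?case using insert by (simp add: poly_eval_add poly_eval_single)
  qed (simp add: poly_eval_def)
  then show ?thesis
    by (simp add: affine_poly_def poly_eval_add poly_eval_single)
qed

section \<open>Exactness of the Koszul complex\<close>

text \<open>The sign of \<open>e\<^sub>i \<and> e\<^bsub>I - {i}\<^esub> = \<plusminus> e\<^sub>I\<close>.\<close>

definition koszul_sign :: "nat \<Rightarrow> nat set \<Rightarrow> real" where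
  "koszul_sign i I = (-1) ^ card {j\<in>I. j < i}"

lemma koszul_sign_square [simp]: "koszul_sign i I * koszul_sign i I = 1"
  by (simp add: koszul_sign_def flip: power_add mult_2)

lemma koszul_sign_insert:
  assumes "finite I" "j \<notin> I"
  shows "koszul_sign i (insert j I) = (if j < i then - koszul_sign i I else koszul_sign i I)"
proof -
  have "{k\<in>insert j I. k < i} = (if j < i then insert j {k\<in>I. k < i} else {k\<in>I. k < i})" by auto
  then show ?thesis using assms by (simp add: koszul_sign_def)
qed

lemma koszul_sign_insert_self [simp]: "koszul_sign i (insert i I) = koszul_sign i I"
  unfolding koszul_sign_def by (rule arg_cong[of _ _ "\<lambda>A. (-1) ^ card A"]) auto

lemma koszul_sign_remove_self [simp]: "koszul_sign i (I - {i}) = koszul_sign i I"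
  unfolding koszul_sign_def by (rule arg_cong[of _ _ "\<lambda>A. (-1) ^ card A"]) auto

text \<open>
  The first identity is \<open>e\<^sub>i \<and> e\<^sub>j = - e\<^sub>j \<and> e\<^sub>i\<close>; the second says that exterior multiplication by \<open>e\<^sub>i\<close>
  anticommutes with contraction by \<open>e\<^sub>j\<close>.
\<close>

lemma koszul_sign_anticommute:
  assumes "finite I" "i \<in> I" "j \<in> I" "i \<noteq> j"
  shows "koszul_sign i I * koszul_sign j (I - {i}) = - (koszul_sign j I * koszul_sign i (I - {j}))"
  using assms koszul_sign_insert[of "I - {i}" i j] koszul_sign_insert[of "I - {j}" j i]
  by (auto simp: insert_absorb split: if_splits)

lemma koszul_sign_contract:
  assumes "finite I" "i \<in> I" "j \<notin> I"
  shows "koszul_sign i I * koszul_sign j (I - {i}) = - (koszul_sign j I * koszul_sign i (insert j I))"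
  using assms koszul_sign_insert[of "I - {i}" i j] koszul_sign_insert[of I j i]
  by (auto simp: insert_absorb split: if_splits)

locale koszul =
  fixes n :: nat and M :: "'a::complex_hilbert set" and T :: "nat \<Rightarrow> 'a \<Rightarrow> 'a"
    and a :: "nat \<Rightarrow> complex"
  assumes tuple: "commuting_tuple n M T"
begin

lemma sub: "subspace M"
  using tuple closed_csubspace_subspace by (auto simp: commuting_tuple_def)

lemma scaleC_mem: "x \<in> M \<Longrightarrow> b *\<^sub>C x \<in> M"
  using tuple by (auto simp: commuting_tuple_def closed_csubspace_def)

lemma T_mem: "i \<in> {1..n} \<Longrightarrow> x \<in> M \<Longrightarrow> T i x \<in> M"
  and T_add: "i \<in> {1..n} \<Longrightarrow> x \<in> M \<Longrightarrow> y \<in> M \<Longrightarrow> T i (x + y) = T i x + T i y"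
  and T_scaleC: "i \<in> {1..n} \<Longrightarrow> x \<in> M \<Longrightarrow> T i (b *\<^sub>C x) = b *\<^sub>C T i x"
  and T_comm: "i \<in> {1..n} \<Longrightarrow> j \<in> {1..n} \<Longrightarrow> x \<in> M \<Longrightarrow> T i (T j x) = T j (T i x)"
  using tuple by (auto simp: commuting_tuple_def bounded_op_def clinear_on_def)

lemma T_scaleR: "i \<in> {1..n} \<Longrightarrow> x \<in> M \<Longrightarrow> T i (r *\<^sub>R x) = r *\<^sub>R T i x"
  using T_scaleC[of i x "complex_of_real r"] by (simp add: scaleC_of_real)

lemma T_0: "i \<in> {1..n} \<Longrightarrow> T i 0 = 0"
  using T_scaleR[of i 0 0] subspace_0[OF sub] by simp

lemma T_sum:
  assumes "i \<in> {1..n}" "\<And>k. k \<in> J \<Longrightarrow> f k \<in> M"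
  shows "T i (\<Sum>k\<in>J. f k) = (\<Sum>k\<in>J. T i (f k))"
  using assms(2)
proof (induction J rule: infinite_finite_induct)
  case (insert k J)
  then show ?case using assms(1) sub by (simp add: T_add subspace_sum)
qed (use assms(1) T_0 in auto)

lemmas mem = subspace_0[OF sub] subspace_sum[OF sub] subspace_scale[OF sub] scaleC_mem T_mem

lemma forms_mem: "\<xi> \<in> koszul_forms n M \<Longrightarrow> \<xi> I \<in> M"
  using subspace_0[OF sub] by (auto simp: koszul_forms_def split: if_splits)

lemma koszul_d_eq:
  "I \<subseteq> {1..n} \<Longrightarrow> koszul_d n T \<xi> I = (\<Sum>i\<in>I. koszul_sign i I *\<^sub>R T i (\<xi> (I - {i})))"
  by (simp add: koszul_d_def koszul_sign_def)

text \<open>Interior multiplication by \<open>a\<close>, the homotopy operator of the Koszul complex.\<close>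

definition contraction :: "(nat set \<Rightarrow> 'a) \<Rightarrow> nat set \<Rightarrow> 'a" where
  "contraction \<xi> I = (if I \<subseteq> {1..n}
     then \<Sum>j\<in>{1..n} - I. koszul_sign j I *\<^sub>R (a j *\<^sub>C \<xi> (insert j I)) else 0)"

lemma koszul_d_forms: "\<xi> \<in> koszul_forms n M \<Longrightarrow> koszul_d n T \<xi> \<in> koszul_forms n M"
  using forms_mem by (subst koszul_forms_def) (auto simp: koszul_d_def intro!: mem)

lemma contraction_forms: "\<xi> \<in> koszul_forms n M \<Longrightarrow> contraction \<xi> \<in> koszul_forms n M"
  using forms_mem by (subst koszul_forms_def) (auto simp: contraction_def intro!: mem)

text \<open>
  In the double sum over \<open>i \<noteq> j\<close> the term for \<open>(i, j)\<close> cancels that for \<open>(j, i)\<close>, because the operators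
  commute and the signs anticommute.
\<close>

lemma koszul_d_koszul_d:
  assumes \<xi>: "\<xi> \<in> koszul_forms n M"
  shows "koszul_d n T (koszul_d n T \<xi>) = (\<lambda>_. 0)"
proof
  fix I show "koszul_d n T (koszul_d n T \<xi>) I = 0"
  proof (cases "I \<subseteq> {1..n}")
    case True
    then have fin: "finite I" by (rule finite_subset) simp
    define g where "g i j = (if i = j then 0 else
      (koszul_sign i I * koszul_sign j (I - {i})) *\<^sub>R T i (T j (\<xi> (I - {i} - {j}))))" for i j
    have anti: "g j i = - g i j" if "i \<in> I" "j \<in> I" for i j
    proof (cases "i = j")
      case False
      have "T i (T j (\<xi> (I - {i} - {j}))) = T j (T i (\<xi> (I - {j} - {i})))"
        using T_comm[of i j, OF _ _ forms_mem[OF \<xi>]] that True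
        by (metis Diff_insert2 insert_commute subsetD)
      then show ?thesis
        using False that koszul_sign_anticommute[OF fin that False] by (simp add: g_def)
    qed (simp add: g_def)
    have "koszul_d n T (koszul_d n T \<xi>) I = (\<Sum>i\<in>I. \<Sum>j\<in>I. g i j)"
      unfolding koszul_d_eq[OF True]
    proof (intro sum.cong refl)
      fix i assume i: "i \<in> I"
      have sub_i: "I - {i} \<subseteq> {1..n}" and i': "i \<in> {1..n}" using True i by auto
      have "koszul_sign i I *\<^sub>R T i (koszul_d n T \<xi> (I - {i}))
          = (\<Sum>j\<in>I - {i}. (koszul_sign i I * koszul_sign j (I - {i})) *\<^sub>R T i (T j (\<xi> (I - {i} - {j}))))"
        unfolding koszul_d_eq[OF sub_i] using sub_i i' forms_mem[OF \<xi>]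
        by (subst T_sum) (auto simp: scaleR_sum_right T_scaleR mem subset_eq intro!: sum.cong mem)
      also have "\<dots> = (\<Sum>j\<in>I. g i j)"
        using fin i by (subst (2) sum.remove[of _ i]) (auto simp: g_def intro!: sum.cong)
      finally show "koszul_sign i I *\<^sub>R T i (koszul_d n T \<xi> (I - {i})) = (\<Sum>j\<in>I. g i j)" .
    qed
    also have "\<dots> = - (\<Sum>i\<in>I. \<Sum>j\<in>I. g j i)"
      unfolding sum_negf[symmetric] by (intro sum.cong refl anti)
    also have "(\<Sum>i\<in>I. \<Sum>j\<in>I. g j i) = (\<Sum>i\<in>I. \<Sum>j\<in>I. g i j)" by (rule sum.swap)
    finally have "2 *\<^sub>R koszul_d n T (koszul_d n T \<xi>) I = 0"
      using \<open>koszul_d n T (koszul_d n T \<xi>) I = (\<Sum>i\<in>I. \<Sum>j\<in>I. g i j)\<close>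
      by (simp only: scaleR_2 eq_neg_iff_add_eq_0)
    then show ?thesis by simp
  qed (simp add: koszul_d_def)
qed

abbreviation R where "R x \<equiv> (\<Sum>i=1..n. a i *\<^sub>C T i x)"

text \<open>Cartan's formula: contraction with \<open>a\<close> is a homotopy between \<open>0\<close> and \<open>\<Sum>\<^sub>i a\<^sub>i T\<^sub>i\<close>.\<close>

lemma cartan:
  assumes \<xi>: "\<xi> \<in> koszul_forms n M" and I: "I \<subseteq> {1..n}"
  shows "koszul_d n T (contraction \<xi>) I + contraction (koszul_d n T \<xi>) I = R (\<xi> I)"
proof -
  have fin: "finite I" using I by (rule finite_subset) simp
  note x = forms_mem[OF \<xi>]
  define h where "h i j = (koszul_sign i I * koszul_sign j (I - {i})) *\<^sub>R
      (a j *\<^sub>C T i (\<xi> (insert j (I - {i}))))" for i j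
  have 1: "koszul_d n T (contraction \<xi>) I
      = (\<Sum>i\<in>I. a i *\<^sub>C T i (\<xi> I)) + (\<Sum>i\<in>I. \<Sum>j\<in>{1..n} - I. h i j)"
    unfolding koszul_d_eq[OF I] sum.distrib[symmetric]
  proof (intro sum.cong refl)
    fix i assume i: "i \<in> I"
    have i': "i \<in> {1..n}" and sub_i: "I - {i} \<subseteq> {1..n}" using i I by auto
    have ins: "{1..n} - (I - {i}) = insert i ({1..n} - I)" using i' by auto
    have "koszul_sign i I *\<^sub>R T i (contraction \<xi> (I - {i}))
        = (\<Sum>j\<in>{1..n} - (I - {i}). h i j)"
      unfolding contraction_def h_def using sub_i i' x
      by (simp, subst T_sum) (auto simp: scaleR_sum_right T_scaleR T_scaleC mem intro!: sum.cong mem)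
    also have "\<dots> = h i i + (\<Sum>j\<in>{1..n} - I. h i j)"
      unfolding ins using i by (subst sum.insert) auto
    also have "h i i = a i *\<^sub>C T i (\<xi> I)" using i by (simp add: h_def insert_absorb)
    finally show "koszul_sign i I *\<^sub>R T i (contraction \<xi> (I - {i}))
        = a i *\<^sub>C T i (\<xi> I) + (\<Sum>j\<in>{1..n} - I. h i j)" .
  qed
  have 2: "contraction (koszul_d n T \<xi>) I
      = (\<Sum>j\<in>{1..n} - I. a j *\<^sub>C T j (\<xi> I)) + (\<Sum>j\<in>{1..n} - I. \<Sum>i\<in>I. - h i j)"
    unfolding sum.distrib[symmetric] using I
  proof (simp only: contraction_def if_True, intro sum.cong refl)
    fix j assume j: "j \<in> {1..n} - I"
    then have sub_j: "insert j I \<subseteq> {1..n}" using I by auto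
    have "koszul_sign j I *\<^sub>R a j *\<^sub>C koszul_d n T \<xi> (insert j I)
        = a j *\<^sub>C T j (\<xi> I) + (\<Sum>i\<in>I. (koszul_sign j I * koszul_sign i (insert j I)) *\<^sub>R
            (a j *\<^sub>C T i (\<xi> (insert j I - {i}))))"
      unfolding koszul_d_eq[OF sub_j] using j fin
      by (subst sum.insert)
         (auto simp: scaleC_add_right scaleR_add_right scaleC_sum_right scaleR_sum_right
            linear_scale[OF bounded_linear.linear[OF bounded_linear_scaleC]] intro!: sum.cong)
    also have "(\<Sum>i\<in>I. (koszul_sign j I * koszul_sign i (insert j I)) *\<^sub>R
            (a j *\<^sub>C T i (\<xi> (insert j I - {i})))) = (\<Sum>i\<in>I. - h i j)"
    proof (intro sum.cong refl)
      fix i assume i: "i \<in> I"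
      then have "insert j I - {i} = insert j (I - {i})" using j by auto
      then show "(koszul_sign j I * koszul_sign i (insert j I)) *\<^sub>R
            (a j *\<^sub>C T i (\<xi> (insert j I - {i}))) = - h i j"
        using koszul_sign_contract[OF fin i, of j] j by (simp add: h_def)
    qed
    finally show "koszul_sign j I *\<^sub>R a j *\<^sub>C koszul_d n T \<xi> (insert j I)
        = a j *\<^sub>C T j (\<xi> I) + (\<Sum>i\<in>I. - h i j)" .
  qed
  have "(\<Sum>j\<in>{1..n} - I. \<Sum>i\<in>I. - h i j) = - (\<Sum>i\<in>I. \<Sum>j\<in>{1..n} - I. h i j)"
    by (subst sum.swap) (simp add: sum_negf)
  then have "koszul_d n T (contraction \<xi>) I + contraction (koszul_d n T \<xi>) I
      = (\<Sum>i\<in>I. a i *\<^sub>C T i (\<xi> I)) + (\<Sum>j\<in>{1..n} - I. a j *\<^sub>C T j (\<xi> I))"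
    by (simp add: 1 2)
  also have "\<dots> = R (\<xi> I)"
    using sum.subset_diff[OF I, of "\<lambda>i. a i *\<^sub>C T i (\<xi> I)"] by (simp add: add.commute)
  finally show ?thesis .
qed

text \<open>
  The operator \<open>R\<close> of Cartan's formula commutes with the boundary operator, hence so does its inverse;
  for a cycle \<open>\<xi>\<close> the form \<open>\<eta> = R\<inverse> \<xi>\<close> is again a cycle, and \<open>\<xi>\<close> is the boundary of the contraction of \<open>\<eta>\<close>.
\<close>

lemma koszul_exact_if_bij:
  assumes bij: "bij_betw R M M"
  shows "koszul_exact n M T"
  unfolding koszul_exact_def
proof (intro equalityI subsetI)
  fix \<zeta> assume "\<zeta> \<in> koszul_d n T ` koszul_forms n M"
  then show "\<zeta> \<in> {\<xi> \<in> koszul_forms n M. koszul_d n T \<xi> = (\<lambda>_. 0)}"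
    using koszul_d_koszul_d koszul_d_forms by auto
next
  fix \<xi> assume "\<xi> \<in> {\<xi> \<in> koszul_forms n M. koszul_d n T \<xi> = (\<lambda>_. 0)}"
  then have \<xi>: "\<xi> \<in> koszul_forms n M" and d\<xi>: "koszul_d n T \<xi> = (\<lambda>_. 0)" by auto
  define \<eta> where "\<eta> I = (if I \<subseteq> {1..n} then inv_into M R (\<xi> I) else 0)" for I
  have inv: "inv_into M R y \<in> M" "R (inv_into M R y) = y" if "y \<in> M" for y
    using bij_betwE[OF bij_betw_inv_into[OF bij]] bij_betw_inv_into_right[OF bij] that by blast+
  have \<eta>: "\<eta> \<in> koszul_forms n M"
    using inv(1) forms_mem[OF \<xi>] by (auto simp: koszul_forms_def \<eta>_def)
  have R\<eta>: "R (\<eta> I) = \<xi> I" if "I \<subseteq> {1..n}" for I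
    using inv(2)[OF forms_mem[OF \<xi>]] that by (simp add: \<eta>_def)
  have RT: "R (T i x) = T i (R x)" if "i \<in> {1..n}" "x \<in> M" for i x
    using that by (subst T_sum)
      (auto simp: T_scaleC T_comm[OF that(1) _ that(2)] mem intro!: sum.cong mem)
  have R_scale: "R (r *\<^sub>R x) = r *\<^sub>R R x" if "x \<in> M" for r x
    unfolding scaleR_sum_right using that
    by (intro sum.cong) (auto simp: T_scaleR linear_scale[OF bounded_linear.linear[OF bounded_linear_scaleC]])
  have R_add: "R (x + y) = R x + R y" if "x \<in> M" "y \<in> M" for x y
    unfolding sum.distrib[symmetric] using that by (intro sum.cong) (auto simp: T_add scaleC_add_right)
  have R0: "R 0 = 0" using R_scale[of 0 0] mem(1) by simp
  have R_sum: "R (\<Sum>k\<in>J. f k) = (\<Sum>k\<in>J. R (f k))" if "finite J" "\<And>k. k \<in> J \<Longrightarrow> f k \<in> M" for J and f :: "nat \<Rightarrow> 'a"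
    using that
  proof (induction J)
    case (insert k J)
    then have "R (f k + (\<Sum>k\<in>J. f k)) = R (f k) + R (\<Sum>k\<in>J. f k)"
      by (intro R_add subspace_sum[OF sub]) auto
    moreover have "R (\<Sum>k\<in>J. f k) = (\<Sum>k\<in>J. R (f k))" using insert by blast
    ultimately show ?case by (simp only: sum.insert[OF insert.hyps])
  qed (use R0 in simp)
  have d\<eta>: "koszul_d n T \<eta> = (\<lambda>_. 0)"
  proof
    fix I show "koszul_d n T \<eta> I = 0"
    proof (cases "I \<subseteq> {1..n}")
      case True
      then have fin: "finite I" by (rule finite_subset) simp
      have "R (koszul_d n T \<eta> I) = (\<Sum>i\<in>I. R (koszul_sign i I *\<^sub>R T i (\<eta> (I - {i}))))"
        unfolding koszul_d_eq[OF True] using True forms_mem[OF \<eta>] by (intro R_sum fin mem) auto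
      also have "\<dots> = (\<Sum>i\<in>I. koszul_sign i I *\<^sub>R T i (\<xi> (I - {i})))"
      proof (intro sum.cong refl)
        fix i assume "i \<in> I"
        then have i: "i \<in> {1..n}" "I - {i} \<subseteq> {1..n}" using True by auto
        have "R (koszul_sign i I *\<^sub>R T i (\<eta> (I - {i}))) = koszul_sign i I *\<^sub>R R (T i (\<eta> (I - {i})))"
          by (rule R_scale[OF T_mem[OF i(1) forms_mem[OF \<eta>]]])
        also have "R (T i (\<eta> (I - {i}))) = T i (R (\<eta> (I - {i})))"
          by (rule RT[OF i(1) forms_mem[OF \<eta>]])
        finally show "R (koszul_sign i I *\<^sub>R T i (\<eta> (I - {i}))) = koszul_sign i I *\<^sub>R T i (\<xi> (I - {i}))"
          by (simp only: R\<eta>[OF i(2)])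
      qed
      also have "\<dots> = R 0" using fun_cong[OF d\<xi>, of I] by (simp only: koszul_d_eq[OF True] R0)
      finally show ?thesis
        using inj_onD[OF bij_betw_imp_inj_on[OF bij]] forms_mem[OF koszul_d_forms[OF \<eta>]] mem(1) by blast
    qed (simp add: koszul_d_def)
  qed
  have "koszul_d n T (contraction \<eta>) I = \<xi> I" for I
  proof (cases "I \<subseteq> {1..n}")
    case True
    have "contraction (koszul_d n T \<eta>) I = 0" by (simp add: d\<eta> contraction_def scaleC_zero_right)
    then show ?thesis using cartan[OF \<eta> True] R\<eta>[OF True] by simp
  next
    case False
    then show ?thesis using \<xi> by (auto simp: koszul_d_def koszul_forms_def)
  qed
  then show "\<xi> \<in> koszul_d n T ` koszul_forms n M"
    using contraction_forms[OF \<eta>] by (metis ext imageI)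
qed

end

section \<open>Affine functions of the tuple\<close>

lemma scaleC_sum_left: "(\<Sum>i\<in>I. f i) *\<^sub>C x = (\<Sum>i\<in>I. f i *\<^sub>C x)"
  for x :: "'a::complex_hilbert"
  by (induction I rule: infinite_finite_induct) (simp_all add: scaleC_zero_left scaleC_add_left)

definition affine_op ::
    "nat \<Rightarrow> complex \<Rightarrow> (nat \<Rightarrow> complex) \<Rightarrow> (nat \<Rightarrow> 'a::complex_hilbert \<Rightarrow> 'a) \<Rightarrow> 'a \<Rightarrow> 'a" where
  "affine_op n c\<^sub>0 c T x = c\<^sub>0 *\<^sub>C x + (\<Sum>i=1..n. c i *\<^sub>C T i x)"

text \<open>On points \<open>\<pi>\<^sub>n(z)\<close> this affine function is \<open>\<Prod>\<^sub>j (1 - u z\<^sub>j)\<close>.\<close>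

abbreviation root_op :: "nat \<Rightarrow> complex \<Rightarrow> (nat \<Rightarrow> 'a::complex_hilbert \<Rightarrow> 'a) \<Rightarrow> 'a \<Rightarrow> 'a" where
  "root_op n u \<equiv> affine_op n 1 (\<lambda>i. (- u) ^ i)"

text \<open>The bound on \<open>p(T) q(T)\<inverse>\<close>, cleared of the inverse and of the encoding of polynomials.\<close>

lemma spectral_set_affine:
  assumes sp: "spectral_set n K M T" and K: "K \<noteq> {}"
    and nz: "\<And>z. z \<in> K \<Longrightarrow> d\<^sub>0 + (\<Sum>i=1..n. d i * z i) \<noteq> 0"
    and le: "\<And>z. z \<in> K \<Longrightarrow>
      cmod (c\<^sub>0 + (\<Sum>i=1..n. c i * z i)) \<le> B * cmod (d\<^sub>0 + (\<Sum>i=1..n. d i * z i))"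
  shows "bij_betw (affine_op n d\<^sub>0 d T) M M"
    and "x \<in> M \<Longrightarrow> norm (affine_op n c\<^sub>0 c T x) \<le> B * norm (affine_op n d\<^sub>0 d T x)"
proof -
  let ?p = "affine_poly n c\<^sub>0 c" and ?q = "affine_poly n d\<^sub>0 d"
  have op: "op_poly n (affine_poly n e\<^sub>0 e) T = affine_op n e\<^sub>0 e T" for e\<^sub>0 e
    by (rule ext) (simp add: op_poly_affine affine_op_def)
  have nz': "\<forall>z\<in>K. poly_eval n ?q z \<noteq> 0" using nz by (simp add: poly_eval_affine)
  from sp have "poly_in n ?p \<and> poly_in n ?q \<and> (\<forall>z\<in>K. poly_eval n ?q z \<noteq> 0) \<longrightarrow>
      bij_betw (op_poly n ?q T) M M \<and> (\<forall>x\<in>M. norm (op_poly n ?p T (inv_into M (op_poly n ?q T) x))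
        \<le> (SUP z\<in>K. cmod (poly_eval n ?p z / poly_eval n ?q z)) * norm x)"
    unfolding spectral_set_def by blast
  then have *: "bij_betw (affine_op n d\<^sub>0 d T) M M"
    "\<And>y. y \<in> M \<Longrightarrow> norm (affine_op n c\<^sub>0 c T (inv_into M (affine_op n d\<^sub>0 d T) y))
        \<le> (SUP z\<in>K. cmod (poly_eval n ?p z / poly_eval n ?q z)) * norm y"
    unfolding op using nz' poly_in_affine by auto
  show "bij_betw (affine_op n d\<^sub>0 d T) M M" by fact
  assume x: "x \<in> M"
  let ?y = "affine_op n d\<^sub>0 d T x"
  have "?y \<in> M" using x *(1) bij_betwE by blast
  moreover have "inv_into M (affine_op n d\<^sub>0 d T) ?y = x"
    using x *(1) by (simp add: bij_betw_inv_into_left)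
  ultimately have "norm (affine_op n c\<^sub>0 c T x)
      \<le> (SUP z\<in>K. cmod (poly_eval n ?p z / poly_eval n ?q z)) * norm ?y"
    using *(2) by metis
  also have "\<dots> \<le> B * norm ?y"
  proof (intro mult_right_mono cSUP_least K norm_ge_zero)
    fix z assume "z \<in> K"
    from nz[OF this] le[OF this] show "cmod (poly_eval n ?p z / poly_eval n ?q z) \<le> B"
      by (simp only: poly_eval_affine norm_divide divide_le_eq zero_less_norm_iff) simp
  qed
  finally show "norm (affine_op n c\<^sub>0 c T x) \<le> B * norm ?y" .
qed

lemma root_op_bij:
  assumes sp: "spectral_set n (Gam n) M T" and u: "cmod u < 1"
  shows "bij_betw (root_op n u T) M M"
    and "x \<in> M \<Longrightarrow> norm x \<le> inverse ((1 - cmod u) ^ n) * norm (root_op n u T x)"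
proof -
  have pos: "0 < (1 - cmod u) ^ n" using u by simp
  have nz: "1 + (\<Sum>i=1..n. (- u) ^ i * z i) \<noteq> 0" if "z \<in> Gam n" for z
    using Gam_lower_bound[OF that u] pos by auto
  have le: "cmod (1 + (\<Sum>i=1..n. 0 * z i))
      \<le> inverse ((1 - cmod u) ^ n) * cmod (1 + (\<Sum>i=1..n. (- u) ^ i * z i))" if "z \<in> Gam n" for z
    using Gam_lower_bound[OF that u] pos by (simp add: field_simps)
  note * = spectral_set_affine[OF sp Gam_nonempty nz le]
  show "bij_betw (root_op n u T) M M" by (rule *(1))
  show "norm x \<le> inverse ((1 - cmod u) ^ n) * norm (root_op n u T x)" if "x \<in> M"
    using *(2)[OF _ _ that] by (simp add: affine_op_def scaleC_zero_left)
qed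

lemma commuting_tuple_shift:
  assumes "commuting_tuple n M T"
  shows "commuting_tuple n M (\<lambda>i x. T i x - w i *\<^sub>C x)"
proof -
  have sub: "subspace M" and M: "closed_csubspace M"
    using assms closed_csubspace_subspace by (auto simp: commuting_tuple_def)
  have sc: "b *\<^sub>C x \<in> M" if "x \<in> M" for b x using M that by (auto simp: closed_csubspace_def)
  have T: "bounded_op M (T i)" if "i \<in> {1..n}" for i using assms that by (auto simp: commuting_tuple_def)
  have lin: "T i x \<in> M" "T i (x + y) = T i x + T i y" "T i (b *\<^sub>C x) = b *\<^sub>C T i x"
    if "i \<in> {1..n}" "x \<in> M" "y \<in> M" for i x y b
    using T[OF that(1)] that by (auto simp: bounded_op_def clinear_on_def)
  have diff: "T i (x - y) = T i x - T i y" if "i \<in> {1..n}" "x \<in> M" "y \<in> M" for i x y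
    using lin(2)[OF that(1,2) sc[OF that(3), of "-1"]] lin(3)[OF that(1,3,3), of "-1"]
    by (simp add: scaleC_minus_left)
  have "bounded_op M (\<lambda>x. T i x - w i *\<^sub>C x)" if i: "i \<in> {1..n}" for i
  proof -
    obtain B where B: "\<And>x. x \<in> M \<Longrightarrow> norm (T i x) \<le> B * norm x"
      using T[OF i] by (auto simp: bounded_op_def)
    have "norm (T i x - w i *\<^sub>C x) \<le> (B + cmod (w i)) * norm x" if "x \<in> M" for x
      using norm_triangle_ineq4[of "T i x" "w i *\<^sub>C x"] B[OF that]
      by (simp add: norm_scaleC distrib_right)
    then show ?thesis
      unfolding bounded_op_def clinear_on_def using i lin sc sub
      by (auto simp: subspace_diff scaleC_add_right scaleC_diff_right scaleC_scaleC mult.commute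
          intro!: exI[of _ "B + cmod (w i)"])
  qed
  moreover have "T i (T j x - w j *\<^sub>C x) - w i *\<^sub>C (T j x - w j *\<^sub>C x)
      = T j (T i x - w i *\<^sub>C x) - w j *\<^sub>C (T i x - w i *\<^sub>C x)"
    if "i \<in> {1..n}" "j \<in> {1..n}" "x \<in> M" for i j x
  proof -
    have "T i (T j x) = T j (T i x)" using assms that by (auto simp: commuting_tuple_def)
    then show ?thesis
      using that lin sc by (simp add: diff lin(3)[where y = x] scaleC_diff_right scaleC_scaleC mult.commute)
  qed
  ultimately show ?thesis using M by (auto simp: commuting_tuple_def)
qed

lemma not_in_taylor_spectrum:
  assumes "commuting_tuple n M T" "bij_betw (\<lambda>x. \<Sum>i=1..n. a i *\<^sub>C (T i x - w i *\<^sub>C x)) M M"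
  shows "w \<notin> taylor_spectrum n M T"
proof -
  interpret koszul n M "\<lambda>i x. T i x - w i *\<^sub>C x" a
    by standard (rule commuting_tuple_shift[OF assms(1)])
  show ?thesis using koszul_exact_if_bij[OF assms(2)] by (simp add: taylor_spectrum_def)
qed

text \<open>
  A point outside \<open>\<Gamma>\<^sub>n\<close> is a zero of some affine function \<open>s \<mapsto> \<Prod>\<^sub>j (1 - u z\<^sub>j)\<close>, \<open>|u| < 1\<close>, and this
  function of the tuple is a linear combination of the \<open>T\<^sub>i - w\<^sub>i\<close>. If it is invertible, the
  Koszul complex at \<open>w\<close> is contractible.
\<close>

lemma taylor_spectrum_subset_Gam:
  assumes T: "commuting_tuple n M T"
    and bij: "\<And>u. cmod u < 1 \<Longrightarrow> bij_betw (root_op n u T) M M"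
  shows "taylor_spectrum n M T \<subseteq> Gam n"
proof
  fix w assume w: "w \<in> taylor_spectrum n M T"
  show "w \<in> Gam n"
  proof (rule ccontr)
    assume "w \<notin> Gam n"
    moreover have "w \<in> {1..n} \<rightarrow>\<^sub>E UNIV" using w by (simp add: taylor_spectrum_def)
    ultimately obtain u where u: "cmod u < 1" "1 + (\<Sum>i=1..n. (- u) ^ i * w i) = 0"
      using not_in_Gam by blast
    have "(\<Sum>i=1..n. (- u) ^ i *\<^sub>C (T i x - w i *\<^sub>C x)) = root_op n u T x" for x
    proof -
      have "(\<Sum>i=1..n. (- u) ^ i *\<^sub>C (T i x - w i *\<^sub>C x))
          = (\<Sum>i=1..n. (- u) ^ i *\<^sub>C T i x) - (\<Sum>i=1..n. ((- u) ^ i * w i) *\<^sub>C x)"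
        by (simp add: scaleC_diff_right scaleC_scaleC sum_subtractf)
      also have "(\<Sum>i=1..n. ((- u) ^ i * w i) *\<^sub>C x) = (\<Sum>i=1..n. (- u) ^ i * w i) *\<^sub>C x"
        by (rule scaleC_sum_left[symmetric])
      also have "(\<Sum>i=1..n. (- u) ^ i * w i) = - 1" using u(2) by (simp add: add_eq_0_iff)
      finally show ?thesis by (simp add: affine_op_def scaleC_minus_left add.commute)
    qed
    then have "bij_betw (\<lambda>x. \<Sum>i=1..n. (- u) ^ i *\<^sub>C (T i x - w i *\<^sub>C x)) M M"
      using bij[OF u(1)] by presburger
    from not_in_taylor_spectrum[OF T this] w show False by contradiction
  qed
qed

text \<open>
  By the previous criterion the spectrum lies in \<open>\<Gamma>\<^sub>n\<close>, where leaving \<open>b\<Gamma>\<^sub>n\<close> means \<open>|w\<^sub>n| < 1\<close>; then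
  \<open>T\<^sub>n - w\<^sub>n\<close> is itself an invertible combination.
\<close>

lemma taylor_spectrum_subset_bGam:
  assumes T: "commuting_tuple n M T"
    and bij: "\<And>u. cmod u < 1 \<Longrightarrow> bij_betw (root_op n u T) M M"
    and last: "\<And>l. cmod l < 1 \<Longrightarrow> bij_betw (\<lambda>x. T n x - l *\<^sub>C x) M M"
  shows "taylor_spectrum n M T \<subseteq> bGam n"
proof
  fix w assume w: "w \<in> taylor_spectrum n M T"
  then have Gam: "w \<in> Gam n" using taylor_spectrum_subset_Gam[OF T bij] by blast
  show "w \<in> bGam n"
  proof (rule ccontr)
    assume "w \<notin> bGam n"
    note n = not_in_bGam[OF Gam this]
    have "(\<Sum>i=1..n. (if i = n then 1 else 0) *\<^sub>C (T i x - w i *\<^sub>C x)) = T n x - w n *\<^sub>C x" for x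
    proof -
      have "(\<Sum>i=1..n. (if i = n then 1 else 0) *\<^sub>C (T i x - w i *\<^sub>C x))
          = (\<Sum>i=1..n. if i = n then T i x - w i *\<^sub>C x else 0)"
        by (intro sum.cong) (auto simp: scaleC_zero_left)
      then show ?thesis using n(2) by simp
    qed
    then have "bij_betw (\<lambda>x. \<Sum>i=1..n. (if i = n then 1 else 0) *\<^sub>C (T i x - w i *\<^sub>C x)) M M"
      using last[OF n(1)] by presburger
    from not_in_taylor_spectrum[OF T this] w show False by contradiction
  qed
qed

text \<open>Solve \<open>P x - l x = y\<close> by the fixed point of the contraction \<open>x \<mapsto> D (y + l x)\<close>.\<close>

lemma unitary_minus_scalar_bij:
  fixes M :: "'a::complex_hilbert set"
  assumes M: "closed_csubspace M"
    and P: "bounded_op M P" "\<And>x. x \<in> M \<Longrightarrow> norm (P x) = norm x"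
    and D: "\<And>x. x \<in> M \<Longrightarrow> D x \<in> M" "\<And>x. x \<in> M \<Longrightarrow> P (D x) = x"
    and l: "cmod l < 1"
  shows "bij_betw (\<lambda>x. P x - l *\<^sub>C x) M M"
proof -
  have sub: "subspace M" using M by (rule closed_csubspace_subspace)
  have sc: "b *\<^sub>C x \<in> M" if "x \<in> M" for b x using M that by (auto simp: closed_csubspace_def)
  have Pm: "P x \<in> M" if "x \<in> M" for x using P(1) that by (auto simp: bounded_op_def)
  have Pdiff: "P (x - y) = P x - P y" if "x \<in> M" "y \<in> M" for x y
  proof -
    have "P (x + (-1) *\<^sub>C y) = P x + (-1) *\<^sub>C P y"
      using P(1) that sc by (auto simp: bounded_op_def clinear_on_def)
    then show ?thesis by (simp add: scaleC_minus_left)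
  qed
  have Dnorm: "norm (D x - D y) = norm (x - y)" if "x \<in> M" "y \<in> M" for x y
    using P(2)[of "D x - D y"] Pdiff D that sub by (simp add: subspace_diff)
  have "inj_on (\<lambda>x. P x - l *\<^sub>C x) M"
  proof (rule inj_onI)
    fix x y assume xy: "x \<in> M" "y \<in> M" "P x - l *\<^sub>C x = P y - l *\<^sub>C y"
    then have "P (x - y) = l *\<^sub>C (x - y)" by (simp add: Pdiff scaleC_diff_right algebra_simps)
    then have "norm (x - y) = cmod l * norm (x - y)"
      using P(2)[of "x - y"] xy sub by (simp add: subspace_diff norm_scaleC)
    then show "x = y" using l by simp
  qed
  moreover have "\<exists>x\<in>M. y = P x - l *\<^sub>C x" if y: "y \<in> M" for y
  proof -
    have "\<exists>!x\<in>M. D (y + l *\<^sub>C x) = x"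
    proof (rule Banach_fix[where c = "cmod l"])
      show "complete M" using M by (auto simp: closed_csubspace_def complete_eq_closed)
      show "M \<noteq> {}" using y by auto
      show "(\<lambda>x. D (y + l *\<^sub>C x)) ` M \<subseteq> M" using y sc D sub by (auto simp: subspace_add)
      show "dist (D (y + l *\<^sub>C x)) (D (y + l *\<^sub>C z)) \<le> cmod l * dist x z"
        if "x \<in> M" "z \<in> M" for x z
        using that y sc sub
        by (simp add: dist_norm Dnorm subspace_add norm_scaleC flip: scaleC_diff_right)
    qed (use l in auto)
    then obtain x where x: "x \<in> M" "D (y + l *\<^sub>C x) = x" by blast
    then have "P x = y + l *\<^sub>C x" using D(2)[of "y + l *\<^sub>C x"] y sc sub by (simp add: subspace_add)
    then show ?thesis using x by (intro bexI[of _ x]) simp_all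
  qed
  ultimately show ?thesis
    using Pm sc sub by (auto simp: bij_betw_def subspace_diff)
qed

section \<open>The fundamental relation\<close>

lemma quadratic_form_linear_part_zero:
  fixes L K :: real
  assumes "\<And>t. t * L \<le> t\<^sup>2 * K"
  shows "L = 0"
proof (rule ccontr)
  assume "L \<noteq> 0"
  define s where "s = 1 / (2 * (\<bar>K\<bar> + 1))"
  have s: "s > 0" and sK: "s * K \<le> 1/2" by (auto simp: s_def field_simps)
  have "(s * L) * L \<le> (s * L)\<^sup>2 * K" by (rule assms)
  then have "(s * L\<^sup>2) * (1 - s * K) \<le> 0" by (simp add: power2_eq_square algebra_simps)
  moreover have "0 < (s * L\<^sup>2) * (1 - s * K)" using s sK \<open>L \<noteq> 0\<close> by (intro mult_pos_pos) auto
  ultimately show False by simp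
qed

lemma norm_add_scaleR_square:
  "(norm (x + t *\<^sub>R y))\<^sup>2 = (norm x)\<^sup>2 + 2 * t * inner x y + t\<^sup>2 * (norm y)\<^sup>2"
  for x y :: "'a::real_inner"
  unfolding power2_norm_eq_inner
  by (simp add: inner_add_left inner_add_right inner_commute power2_eq_square algebra_simps)

text \<open>
  An operator whose quadratic form is dominated by \<open>\<parallel>x\<parallel>\<^sup>2 - \<parallel>P x\<parallel>\<^sup>2\<close> kills the vectors on which \<open>P\<close> is
  isometric: at such a vector the dominating form vanishes to second order, so the linear part of
  the dominated one is zero in every direction.
\<close>

lemma (in contraction_pair) dominated_form_zero:
  assumes Q: "bounded_op UNIV Q"
    and dom: "\<And>a x. cmod a = 1 \<Longrightarrow> inner (a *\<^sub>C Q x) x \<le> k * ((norm x)\<^sup>2 - (norm (P x))\<^sup>2)"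
    and x: "norm (P x) = norm x"
  shows "Q x = 0"
proof -
  interpret Q: bounded_linear Q by (rule bounded_op_UNIV_linear[OF Q])
  interpret P: bounded_linear P by (rule linear_P)
  have DP: "D (P x) = x" by (rule isometric_cancel[OF x])
  have zero: "inner (a *\<^sub>C Q x) x = 0" if "cmod a = 1" for a
    using dom[OF that, of x] dom[of "- a" x] that x by (simp add: scaleC_minus_left)
  have lin: "inner (a *\<^sub>C Q x) y + inner (a *\<^sub>C Q y) x = 0" if a: "cmod a = 1" for a y
  proof (rule quadratic_form_linear_part_zero)
    fix t :: real
    let ?v = "x + t *\<^sub>R y"
    have form: "(norm ?v)\<^sup>2 - (norm (P ?v))\<^sup>2 = t\<^sup>2 * ((norm y)\<^sup>2 - (norm (P y))\<^sup>2)"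
    proof -
      have cross: "inner (P x) (P y) = inner x y"
        using adjoint[of y "P x"] DP by (simp add: inner_commute)
      have "(norm ?v)\<^sup>2 = (norm x)\<^sup>2 + 2 * t * inner x y + t\<^sup>2 * (norm y)\<^sup>2"
        by (rule norm_add_scaleR_square)
      moreover have "(norm (P ?v))\<^sup>2 = (norm (P x))\<^sup>2 + 2 * t * inner (P x) (P y) + t\<^sup>2 * (norm (P y))\<^sup>2"
        unfolding P.add P.scaleR by (rule norm_add_scaleR_square)
      ultimately show ?thesis using x cross by (simp add: algebra_simps)
    qed
    have "inner (a *\<^sub>C Q ?v) ?v
        = t * (inner (a *\<^sub>C Q x) y + inner (a *\<^sub>C Q y) x) + t\<^sup>2 * inner (a *\<^sub>C Q y) y"
      using zero[OF a]
      by (simp add: Q.add Q.scaleR scaleC_add_right inner_add_left inner_add_right power2_eq_square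
          linear_scale[OF bounded_linear.linear[OF bounded_linear_scaleC]] algebra_simps)
    then show "t * (inner (a *\<^sub>C Q x) y + inner (a *\<^sub>C Q y) x)
        \<le> t\<^sup>2 * (k * ((norm y)\<^sup>2 - (norm (P y))\<^sup>2) - inner (a *\<^sub>C Q y) y)"
      using dom[OF a, of ?v] unfolding form by (simp add: algebra_simps)
  qed
  have "inner (Q x) y = 0" for y
  proof -
    \<comment> \<open>Turning \<open>y\<close> into \<open>\<i> y\<close> and \<open>a = 1\<close> into \<open>- \<i>\<close> changes the sign of one of the two terms of \<open>lin\<close>.\<close>
    have "inner ((- \<i>) *\<^sub>C Q x) (\<i> *\<^sub>C y) = - inner (Q x) y"
      by (simp add: inner_scaleC_left scaleC_scaleC scaleC_minus_left)
    moreover have "(- \<i>) *\<^sub>C Q (\<i> *\<^sub>C y) = Q y"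
      by (simp add: bounded_op_UNIV_scaleC[OF Q] scaleC_scaleC)
    ultimately show ?thesis using lin[of 1 y] lin[of "- \<i>" "\<i> *\<^sub>C y"] by simp
  qed
  then show ?thesis by (metis inner_eq_zero_iff)
qed

text \<open>
  For invertible \<open>Y\<close> this is \<open>\<parallel>(X Y\<inverse>)\<^sup>*\<parallel> = \<parallel>X Y\<inverse>\<parallel> \<le> 1\<close>. Writing \<open>X\<^sup>* y = Y v\<close> gives it without inverses:
  \<open>\<parallel>X\<^sup>* y\<parallel>\<^sup>2 = \<langle>y, X Y v\<rangle> = \<langle>Y\<^sup>* y, X v\<rangle>\<close> and \<open>\<parallel>X v\<parallel> \<le> \<parallel>Y v\<parallel>\<close>.
\<close>

lemma norm_le_adjoint:
  assumes X: "\<And>x y. inner (X x) y = inner x (X' y)" and Y: "\<And>x y. inner (Y x) y = inner x (Y' y)"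
    and comm: "\<And>x. X (Y x) = Y (X x)" and le: "\<And>x. norm (X x) \<le> norm (Y x)" and surj: "surj Y"
  shows "norm (X' y) \<le> norm (Y' y)"
proof (cases "X' y = 0")
  case False
  obtain v where v: "X' y = Y v" using surj by (metis surjD)
  have "norm (X' y) * norm (X' y) = inner (X' y) (Y v)"
    by (simp add: v power2_norm_eq_inner flip: power2_eq_square)
  also have "\<dots> = inner (X v) (Y' y)"
    using X[of "Y v" y] Y[of "X v" y] comm[of v] by (simp add: inner_commute)
  also have "\<dots> \<le> norm (X v) * norm (Y' y)" by (rule norm_cauchy_schwarz)
  also have "\<dots> \<le> norm (X' y) * norm (Y' y)" unfolding v by (intro mult_right_mono le) simp
  finally show ?thesis using False by simp
qed simp

text \<open>
  What the spectral set condition contributes, in a form that is symmetric under passing to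
  adjoints.
\<close>

locale gamma_pair =
  fixes n :: nat and T D :: "nat \<Rightarrow> 'a::complex_hilbert \<Rightarrow> 'a"
  assumes n2: "2 \<le> n"
    and op: "i \<in> {1..n} \<Longrightarrow> bounded_op UNIV (T i)" "i \<in> {1..n} \<Longrightarrow> bounded_op UNIV (D i)"
    and adj_T: "i \<in> {1..n} \<Longrightarrow> inner (T i x) y = inner x (D i y)"
    and comm: "i \<in> {1..n} \<Longrightarrow> j \<in> {1..n} \<Longrightarrow> T i (T j x) = T j (T i x)"
    and contr: "norm (T n x) \<le> norm x"
    and pencil: "i \<in> {1..<n} \<Longrightarrow> cmod a = 1 \<Longrightarrow>
      norm ((2 ^ n + 1) *\<^sub>R (a *\<^sub>C T n x) - T (n - i) x) \<le> norm ((2 ^ n + 1) *\<^sub>R x - a *\<^sub>C T i x)"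
      "i \<in> {1..<n} \<Longrightarrow> cmod a = 1 \<Longrightarrow>
      norm ((2 ^ n + 1) *\<^sub>R (a *\<^sub>C D n x) - D (n - i) x) \<le> norm ((2 ^ n + 1) *\<^sub>R x - a *\<^sub>C D i x)"

sublocale gamma_pair \<subseteq> contraction_pair "T n" "D n"
proof
  have n: "n \<in> {1..n}" using n2 by simp
  show "bounded_op UNIV (T n)" "bounded_op UNIV (D n)" by (rule op[OF n])+
  show "inner (T n x) y = inner x (D n y)" for x y by (rule adj_T[OF n])
qed (rule contr)

context gamma_pair
begin

lemma n_mem: "n \<in> {1..n}" using n2 by simp

lemma comm_D:
  assumes "i \<in> {1..n}" "j \<in> {1..n}"
  shows "D i (D j x) = D j (D i x)"
proof (rule vector_eq_ldot[THEN iffD1], rule allI)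
  show "inner y (D i (D j x)) = inner y (D j (D i x))" for y
    using comm[OF assms, of y] by (simp flip: adj_T[OF assms(1)] adj_T[OF assms(2)])
qed

lemma gamma_pair_dual: "gamma_pair n D T"
proof
  show "inner (D i x) y = inner x (T i y)" if "i \<in> {1..n}" for i x y
    by (subst (1 2) inner_commute) (rule adj_T[OF that, symmetric])
  show "norm (D n x) \<le> norm x" for x
    by (rule contraction_pair.contraction[OF dual])
qed (use n2 op comm_D pencil in auto)

lemma norm_pencil_expand:
  assumes "cmod a = 1"
  shows "(norm (k *\<^sub>R (a *\<^sub>C x) - y))\<^sup>2 = k\<^sup>2 * (norm x)\<^sup>2 - 2 * k * inner (a *\<^sub>C x) y + (norm y)\<^sup>2"
    and "(norm (k *\<^sub>R x - a *\<^sub>C y))\<^sup>2 = k\<^sup>2 * (norm x)\<^sup>2 - 2 * k * inner (a *\<^sub>C y) x + (norm y)\<^sup>2"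
  using assms
  by (simp_all add: norm_diff_square norm_scaleC power_mult_distrib inner_commute)

lemma pencil_form_le:
  assumes i: "i \<in> {1..<n}" and a: "cmod a = 1"
  shows "2 * (2 ^ n + 1) * inner (a *\<^sub>C (T i x - D (n - i) (T n x))) x
    \<le> (2 ^ n + 1)\<^sup>2 * ((norm x)\<^sup>2 - (norm (T n x))\<^sup>2) + (norm (T i x))\<^sup>2 - (norm (T (n - i) x))\<^sup>2"
proof -
  have ni: "n - i \<in> {1..n}" using i by auto
  have "(norm ((2 ^ n + 1) *\<^sub>R (a *\<^sub>C T n x) - T (n - i) x))\<^sup>2
      \<le> (norm ((2 ^ n + 1) *\<^sub>R x - a *\<^sub>C T i x))\<^sup>2"
    using pencil(1)[OF i a] by (intro power_mono) auto
  moreover have "inner (a *\<^sub>C T n x) (T (n - i) x) = inner (a *\<^sub>C D (n - i) (T n x)) x"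
    using adj_T[OF ni, of x "a *\<^sub>C T n x"]
    by (simp add: inner_commute bounded_op_UNIV_scaleC[OF op(2)[OF ni]])
  ultimately show ?thesis
    unfolding norm_pencil_expand[OF a] by (simp add: scaleC_diff_right inner_diff_left algebra_simps)
qed

text \<open>
  Adding the inequalities for \<open>i\<close> and \<open>n - i\<close> removes \<open>\<parallel>T\<^sub>i x\<parallel>\<close> and \<open>\<parallel>T\<^bsub>n-i\<^esub> x\<parallel>\<close>, and averaging over
  \<open>\<plusminus>1\<close> removes the second form.
\<close>

lemma fundamental_form_le:
  assumes i: "i \<in> {1..<n}" and a: "cmod a = 1"
  shows "inner (a *\<^sub>C (T i x - D (n - i) (T n x))) x
    \<le> (2 ^ n + 1) * ((norm x)\<^sup>2 - (norm (T n x))\<^sup>2)"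
proof -
  define k :: real where "k = 2 ^ n + 1"
  have k: "k > 0" by (simp add: k_def add_pos_pos)
  have i': "n - i \<in> {1..<n}" "n - (n - i) = i" using i by auto
  let ?d = "(norm x)\<^sup>2 - (norm (T n x))\<^sup>2"
  let ?X = "inner (a *\<^sub>C (T i x - D (n - i) (T n x))) x"
    and ?Y = "inner (T (n - i) x - D i (T n x)) x"
  have "2 * k * ?X \<le> k\<^sup>2 * ?d + (norm (T i x))\<^sup>2 - (norm (T (n - i) x))\<^sup>2"
    unfolding k_def by (rule pencil_form_le[OF i a])
  moreover have "2 * k * ?Y \<le> k\<^sup>2 * ?d + (norm (T (n - i) x))\<^sup>2 - (norm (T i x))\<^sup>2"
    using pencil_form_le[OF i'(1), of 1 x] unfolding i'(2) k_def by simp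
  moreover have "- (2 * k * ?Y) \<le> k\<^sup>2 * ?d + (norm (T (n - i) x))\<^sup>2 - (norm (T i x))\<^sup>2"
    using pencil_form_le[OF i'(1), of "- 1" x] unfolding i'(2) k_def scaleC_minus_left inner_minus_left
    by simp
  ultimately have "4 * (k * ?X) \<le> 4 * (k\<^sup>2 * ?d)" by linarith
  then have "k * ?X \<le> k * (k * ?d)" by (simp add: power2_eq_square mult.assoc)
  then show ?thesis using k by (simp add: k_def)
qed

text \<open>
  For isometric \<open>P\<close> this is the relation that characterises \<open>\<Gamma>\<^sub>n\<close>-isometries. Having it vector by vector
  makes it applicable before the isometric part is known to be invariant.
\<close>

lemma fundamental_relation:
  assumes i: "i \<in> {1..<n}" and x: "norm (T n x) = norm x"
  shows "T i x = D (n - i) (T n x)"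
proof -
  have mem: "i \<in> {1..n}" "n - i \<in> {1..n}" using i by auto
  have "bounded_op UNIV (\<lambda>x. T i x - D (n - i) (T n x))"
    using bounded_linear_sub[OF bounded_op_UNIV_linear[OF op(1)[OF mem(1)]]
        bounded_linear_compose[OF bounded_op_UNIV_linear[OF op(2)[OF mem(2)]] linear_P]]
    by (intro bounded_op_UNIV_I)
       (auto simp: bounded_op_UNIV_scaleC[OF op(1)[OF mem(1)]] bounded_op_UNIV_scaleC[OF op(2)[OF mem(2)]]
         bounded_op_UNIV_scaleC[OF opP] scaleC_diff_right)
  from dominated_form_zero[OF this fundamental_form_le[OF i] x] show ?thesis by simp
qed

end

text \<open>
  The pencil inequality is the spectral set condition for \<open>(\<kappa> a p - s\<^bsub>n-i\<^esub>) / (\<kappa> - a s\<^sub>i)\<close> with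
  \<open>\<kappa> = 2\<^sup>n + 1\<close>. Its counterpart for the adjoints follows by \<open>norm_le_adjoint\<close>, with \<open>a\<close> conjugated.
\<close>

lemma gamma_contraction_imp_gamma_pair:
  assumes contr: "gamma_contraction n UNIV T" and n: "2 \<le> n"
  shows "gamma_pair n T (\<lambda>i. adj UNIV (T i))"
proof -
  have op: "bounded_op UNIV (T i)" if "i \<in> {1..n}" for i
    using contr that by (auto simp: gamma_contraction_def commuting_tuple_def)
  have comm: "T i (T j x) = T j (T i x)" if "i \<in> {1..n}" "j \<in> {1..n}" for i j x
    using contr that by (auto simp: gamma_contraction_def commuting_tuple_def)
  have sp: "spectral_set n (Gam n) UNIV T" using contr by (simp add: gamma_contraction_def)
  have single: "(\<Sum>j=1..n. (if j = i then b else 0) *\<^sub>C T j x) = b *\<^sub>C T i x" if "i \<in> {1..n}" for b i x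
  proof -
    have "(\<Sum>j=1..n. (if j = i then b else 0) *\<^sub>C T j x) = (\<Sum>j=1..n. if j = i then b *\<^sub>C T j x else 0)"
      by (intro sum.cong) (auto simp: scaleC_zero_left)
    then show ?thesis using that by simp
  qed
  have single': "(\<Sum>j=1..n. (if j = i then b else 0) * z j) = b * z i" if "i \<in> {1..n}" for b :: complex and i z
  proof -
    have "(\<Sum>j=1..n. (if j = i then b else 0) * z j) = (\<Sum>j=1..n. if j = i then b * z j else 0)"
      by (intro sum.cong) auto
    then show ?thesis using that by simp
  qed
  have nn: "n \<in> {1..n}" using n by simp
  have contr: "norm (T n x) \<le> norm x" for x
  proof -
    let ?c = "\<lambda>j. if j = n then 1 else 0"
    have nz: "1 + (\<Sum>j=1..n. 0 * z j) \<noteq> 0" for z :: "nat \<Rightarrow> complex" by simp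
    have le: "cmod (0 + (\<Sum>j=1..n. ?c j * z j)) \<le> 1 * cmod (1 + (\<Sum>j=1..n. 0 * z j))"
      if "z \<in> Gam n" for z
      using Gam_last_le[OF that] n by (simp only: single'[OF nn]) simp
    have "affine_op n 0 ?c T x = T n x" "affine_op n 1 (\<lambda>_. 0) T x = x"
      by (simp_all only: affine_op_def single[OF nn]) (simp_all add: scaleC_zero_left)
    then show ?thesis
      using spectral_set_affine(2)[OF sp Gam_nonempty nz le, of x] by simp
  qed
  define k :: complex where "k = 2 ^ n + 1"
  have k: "k *\<^sub>C x = (2 ^ n + 1) *\<^sub>R x" for x :: 'a
    using scaleC_of_real[of "2 ^ n + 1" x] by (simp add: k_def)
  have pencil: "bij_betw (\<lambda>x. (2 ^ n + 1) *\<^sub>R x - a *\<^sub>C T i x) UNIV UNIV \<and>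
      norm ((2 ^ n + 1) *\<^sub>R (a *\<^sub>C T n x) - T (n - i) x) \<le> norm ((2 ^ n + 1) *\<^sub>R x - a *\<^sub>C T i x)"
    if i: "i \<in> {1..<n}" and a: "cmod a = 1" for i a x
  proof -
    have mem: "i \<in> {1..n}" "n - i \<in> {1..n}" using i by auto
    let ?d = "\<lambda>j. if j = i then - a else 0"
    let ?c = "\<lambda>j. (if j = n then k * a else 0) + (if j = n - i then - 1 else 0)"
    have d: "affine_op n k ?d T x = (2 ^ n + 1) *\<^sub>R x - a *\<^sub>C T i x" for x
      by (simp only: affine_op_def single[OF mem(1)] scaleC_minus_left k) simp
    have c: "affine_op n 0 ?c T x = (2 ^ n + 1) *\<^sub>R (a *\<^sub>C T n x) - T (n - i) x" for x
      by (simp only: affine_op_def scaleC_add_left sum.distrib single[OF nn] single[OF mem(2)]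
          scaleC_minus_left scaleC_zero_left scaleC_scaleC[symmetric] k) simp
    have de: "k + (\<Sum>j=1..n. ?d j * z j) = k - a * z i" for z
      by (simp only: single'[OF mem(1)]) simp
    have ce: "0 + (\<Sum>j=1..n. ?c j * z j) = k * a * z n - z (n - i)" for z
      by (simp only: distrib_right sum.distrib single'[OF nn] single'[OF mem(2)]) simp
    have nz: "k + (\<Sum>j=1..n. ?d j * z j) \<noteq> 0" if "z \<in> Gam n" for z
      unfolding de using Gam_pencil_nonzero[OF that a mem(1)] unfolding k_def .
    have le: "cmod (0 + (\<Sum>j=1..n. ?c j * z j)) \<le> 1 * cmod (k + (\<Sum>j=1..n. ?d j * z j))"
      if "z \<in> Gam n" for z
      unfolding de ce mult_1 using Gam_pencil_le[OF that a i] unfolding k_def .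
    show ?thesis
      using spectral_set_affine[OF sp Gam_nonempty nz le] unfolding c
      by (simp add: d flip: d)
  qed
  show ?thesis
  proof
    fix i x a assume i: "i \<in> {1..<n}" and a: "cmod a = 1"
    show "norm ((2 ^ n + 1) *\<^sub>R (a *\<^sub>C T n x) - T (n - i) x) \<le> norm ((2 ^ n + 1) *\<^sub>R x - a *\<^sub>C T i x)"
      using pencil[OF i a] by blast
    have mem: "i \<in> {1..n}" "n - i \<in> {1..n}" using i by auto
    have a': "cmod (cnj a) = 1" using a by simp
    define r :: real where "r = 2 ^ n + 1"
    note scaleR = linear_scale[OF bounded_linear.linear]
    note lin = linear_diff[OF bounded_linear.linear[OF bounded_op_UNIV_linear[OF op]]]
      scaleR[OF bounded_op_UNIV_linear[OF op]] bounded_op_UNIV_scaleC[OF op]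
    note adj = inner_adj_UNIV[OF op] bounded_op_UNIV_scaleC[OF bounded_op_adj_UNIV[OF op]]
    have "norm (r *\<^sub>R (a *\<^sub>C adj UNIV (T n) x) - adj UNIV (T (n - i)) x)
        \<le> norm (r *\<^sub>R x - a *\<^sub>C adj UNIV (T i) x)"
    proof (rule norm_le_adjoint[where X = "\<lambda>x. r *\<^sub>R (cnj a *\<^sub>C T n x) - T (n - i) x"
          and Y = "\<lambda>x. r *\<^sub>R x - cnj a *\<^sub>C T i x"
          and X' = "\<lambda>x. r *\<^sub>R (a *\<^sub>C adj UNIV (T n) x) - adj UNIV (T (n - i)) x"
          and Y' = "\<lambda>x. r *\<^sub>R x - a *\<^sub>C adj UNIV (T i) x"])
      show "surj (\<lambda>x. r *\<^sub>R x - cnj a *\<^sub>C T i x)"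
        using pencil[OF i a'] bij_betw_imp_surj_on unfolding r_def by blast
      show "norm (r *\<^sub>R (cnj a *\<^sub>C T n x) - T (n - i) x) \<le> norm (r *\<^sub>R x - cnj a *\<^sub>C T i x)" for x
        using pencil[OF i a'] unfolding r_def by blast
      show "inner (r *\<^sub>R (cnj a *\<^sub>C T n x) - T (n - i) x) y
          = inner x (r *\<^sub>R (a *\<^sub>C adj UNIV (T n) y) - adj UNIV (T (n - i)) y)" for x y
        by (simp add: inner_diff_left inner_diff_right inner_scaleC_left adj[OF nn] adj[OF mem(2)])
      show "inner (r *\<^sub>R x - cnj a *\<^sub>C T i x) y = inner x (r *\<^sub>R y - a *\<^sub>C adj UNIV (T i) y)" for x y
        by (simp add: inner_diff_left inner_diff_right inner_scaleC_left adj[OF mem(1)])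
      show "r *\<^sub>R (cnj a *\<^sub>C T n (r *\<^sub>R x - cnj a *\<^sub>C T i x)) - T (n - i) (r *\<^sub>R x - cnj a *\<^sub>C T i x)
          = r *\<^sub>R (r *\<^sub>R (cnj a *\<^sub>C T n x) - T (n - i) x)
            - cnj a *\<^sub>C T i (r *\<^sub>R (cnj a *\<^sub>C T n x) - T (n - i) x)" for x
        by (simp add: lin[OF mem(1)] lin[OF mem(2)] lin[OF nn] comm[OF nn mem(1)] comm[OF mem(2,1)]
            scaleC_diff_right scaleR[OF bounded_linear_scaleC] scaleR_diff_right)
    qed
    then show "norm ((2 ^ n + 1) *\<^sub>R (a *\<^sub>C adj UNIV (T n) x) - adj UNIV (T (n - i)) x)
        \<le> norm ((2 ^ n + 1) *\<^sub>R x - a *\<^sub>C adj UNIV (T i) x)"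
      unfolding r_def .
  qed (use n op comm contr in \<open>auto simp: bounded_op_adj_UNIV inner_adj_UNIV\<close>)
qed

section \<open>Reducing subspaces\<close>

definition reducing ::
    "nat \<Rightarrow> (nat \<Rightarrow> 'a::complex_hilbert \<Rightarrow> 'a) \<Rightarrow> (nat \<Rightarrow> 'a \<Rightarrow> 'a) \<Rightarrow> 'a set \<Rightarrow> bool" where
  "reducing n T D M \<longleftrightarrow> closed_csubspace M \<and> (\<forall>i\<in>{1..n}. \<forall>x\<in>M. T i x \<in> M \<and> D i x \<in> M)"

lemma reducing_commute: "reducing n T D M \<longleftrightarrow> reducing n D T M"
  by (auto simp: reducing_def)

lemma reducing_Int: "reducing n T D M \<Longrightarrow> reducing n T D N \<Longrightarrow> reducing n T D (M \<inter> N)"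
  by (simp add: reducing_def closed_csubspace_Int)

lemma (in contraction_pair) pow_commute:
  assumes "\<And>x. P (R x) = R (P x)"
  shows "(P ^^ k) (R x) = R ((P ^^ k) x)"
  by (induction k) (simp_all add: assms)

context gamma_pair
begin

lemma stable_T:
  assumes i: "i \<in> {1..n}" and x: "x \<in> stable_vectors (T n)"
  shows "T i x \<in> stable_vectors (T n)"
proof -
  have "(\<lambda>k. T i ((T n ^^ k) x)) \<longlonglongrightarrow> T i 0"
    using x by (intro bounded_linear.tendsto[OF bounded_op_UNIV_linear[OF op(1)[OF i]]])
      (simp add: stable_vectors_def)
  then show ?thesis
    using linear_0[OF bounded_linear.linear[OF bounded_op_UNIV_linear[OF op(1)[OF i]]]]
    by (simp add: stable_vectors_def pow_commute comm[OF n_mem i])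
qed

text \<open>
  The \<open>D\<^sub>i\<close> preserve the isometric part as the orthogonal complement of the stable part. On it
  \<open>T\<^sub>i = D\<^bsub>n-i\<^esub> P\<close>, so it is invariant under the \<open>T\<^sub>i\<close> too.
\<close>

lemma reducing_isometric:
  assumes idem: "A = A \<circ> A"
  shows "reducing n T D (isometric_vectors (T n))"
  unfolding reducing_def
proof (intro conjI ballI)
  note orth = idempotent_orthogonal(1)[OF idem]
  have D: "D i x \<in> isometric_vectors (T n)" if "i \<in> {1..n}" "x \<in> isometric_vectors (T n)" for i x
    using that stable_T unfolding orth by (simp flip: adj_T)
  then show "D i x \<in> isometric_vectors (T n)" if "i \<in> {1..n}" "x \<in> isometric_vectors (T n)" for i x
    using that .
  fix i x assume i: "i \<in> {1..n}" and x: "x \<in> isometric_vectors (T n)"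
  show "T i x \<in> isometric_vectors (T n)"
  proof (cases "i = n")
    case False
    then have "T i x = D (n - i) (T n x)"
      using i by (intro fundamental_relation norm_isometric_vectors x) auto
    then show ?thesis using D[of "n - i"] isometric_vectors_image[OF x] i False by auto
  qed (simp add: isometric_vectors_image[OF x])
qed (rule closed_csubspace_isometric_vectors)

lemma reducing_stable:
  assumes idem: "A = A \<circ> A"
  shows "reducing n T D (stable_vectors (T n))"
  unfolding reducing_def
proof (intro conjI ballI)
  fix i x assume i: "i \<in> {1..n}" and x: "x \<in> stable_vectors (T n)"
  show "T i x \<in> stable_vectors (T n)" by (rule stable_T[OF i x])
  have T: "T i v \<in> isometric_vectors (T n)" if "v \<in> isometric_vectors (T n)" for v
    using reducing_isometric[OF idem] i that by (auto simp: reducing_def)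
  have "inner (D i x) v = 0" if "v \<in> isometric_vectors (T n)" for v
    using x T[OF that] unfolding idempotent_orthogonal(2)[OF idem]
    by (simp add: inner_commute[of "D i x"] inner_commute[of x] flip: adj_T[OF i])
  then show "D i x \<in> stable_vectors (T n)" unfolding idempotent_orthogonal(2)[OF idem] by blast
qed (rule closed_csubspace_stable_vectors)

text \<open>
  Both sets are invariant under the \<open>D\<^sub>i\<close>, the second because the \<open>D\<^sub>i\<close> commute with \<open>D\<^sub>n\<close>; and \<open>D\<^sub>n P = I\<close> on
  the first makes the intersection invariant under \<open>P\<close>. The relation \<open>T\<^sub>i = D\<^bsub>n-i\<^esub> P\<close> does the rest.
\<close>

lemma reducing_shift_part:
  assumes idem: "A = A \<circ> A"
  shows "reducing n T D (isometric_vectors (T n) \<inter> stable_vectors (D n))"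
  unfolding reducing_def
proof (intro conjI ballI)
  interpret d: gamma_pair n D T by (rule gamma_pair_dual)
  let ?M = "isometric_vectors (T n) \<inter> stable_vectors (D n)"
  note iso = reducing_isometric[OF idem, unfolded reducing_def]
  show "closed_csubspace ?M"
    by (intro closed_csubspace_Int closed_csubspace_isometric_vectors d.closed_csubspace_stable_vectors)
  have D: "D i x \<in> ?M" if "i \<in> {1..n}" "x \<in> ?M" for i x
    using that iso d.stable_T by auto
  then show "D i x \<in> ?M" if "i \<in> {1..n}" "x \<in> ?M" for i x using that .
  have Tn: "T n x \<in> ?M" if x: "x \<in> ?M" for x
  proof -
    have "(\<lambda>k. (D n ^^ Suc k) (T n x)) \<longlonglongrightarrow> 0"
      using x by (simp add: funpow_Suc_right isometric_vectors_cancel stable_vectors_def del: funpow.simps)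
    then have "(\<lambda>k. (D n ^^ k) (T n x)) \<longlonglongrightarrow> 0" by (rule LIMSEQ_imp_Suc)
    then show ?thesis using x isometric_vectors_image by (auto simp: stable_vectors_def)
  qed
  fix i x assume i: "i \<in> {1..n}" and x: "x \<in> ?M"
  show "T i x \<in> ?M"
  proof (cases "i = n")
    case False
    then have "T i x = D (n - i) (T n x)"
      using i x by (intro fundamental_relation norm_isometric_vectors) auto
    then show ?thesis using D[OF _ Tn[OF x], of "n - i"] i False by auto
  qed (use Tn[OF x] in simp)
qed

abbreviation unitary_part where
  "unitary_part \<equiv> isometric_vectors (T n) \<inter> isometric_vectors (D n)"

text \<open>
  \<open>D\<^sub>n\<close> inverts \<open>P\<close> here, so it commutes with whatever commutes with \<open>P\<close> and preserves the isometric part.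
\<close>

lemma D_pow_commutes_T:
  assumes idem: "A = A \<circ> A" and i: "i \<in> {1..n}" and x: "x \<in> unitary_part"
  shows "(D n ^^ k) (T i x) = T i ((D n ^^ k) x)"
proof -
  interpret d: gamma_pair n D T by (rule gamma_pair_dual)
  note iso = reducing_isometric[OF idem, unfolded reducing_def]
  have mem: "(D n ^^ k) x \<in> isometric_vectors (T n)"
    by (induction k) (use x iso n_mem in auto)
  have "(D n ^^ k) (T i x) = (D n ^^ k) (T i ((T n ^^ k) ((D n ^^ k) x)))"
    using d.pow_cancel[of x k] x by simp
  also have "\<dots> = (D n ^^ k) ((T n ^^ k) (T i ((D n ^^ k) x)))"
    by (simp add: pow_commute comm[OF n_mem i])
  also have "\<dots> = T i ((D n ^^ k) x)"
    using iso i mem by (intro pow_cancel) auto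
  finally show ?thesis .
qed

text \<open>
  By the preceding commutation the \<open>T\<^sub>i\<close> preserve the property that all \<open>D\<^sub>n\<^sup>k\<close> are isometric; the \<open>D\<^sub>i\<close> are
  then handled by the dual relation \<open>D\<^sub>i = T\<^bsub>n-i\<^esub> D\<^sub>n\<close>.
\<close>

lemma reducing_unitary_part:
  assumes idem: "A = A \<circ> A"
  shows "reducing n T D unitary_part"
  unfolding reducing_def
proof (intro conjI ballI)
  interpret d: gamma_pair n D T by (rule gamma_pair_dual)
  note iso = reducing_isometric[OF idem, unfolded reducing_def]
  show "closed_csubspace unitary_part"
    by (intro closed_csubspace_Int closed_csubspace_isometric_vectors d.closed_csubspace_isometric_vectors)
  have T: "T i x \<in> unitary_part" if i: "i \<in> {1..n}" and x: "x \<in> unitary_part" for i x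
  proof -
    have "norm ((D n ^^ k) (T i x)) = norm (T i x)" for k
    proof -
      have "(D n ^^ k) x \<in> isometric_vectors (T n)"
        by (induction k) (use x iso n_mem in auto)
      then have "T i ((D n ^^ k) x) \<in> isometric_vectors (T n)" using iso i by blast
      then have "norm (T i ((D n ^^ k) x)) = norm ((T n ^^ k) (T i ((D n ^^ k) x)))"
        by (simp add: isometric_vectors_def)
      also have "\<dots> = norm (T i x)"
        using d.pow_cancel[of x k] x by (simp add: pow_commute comm[OF n_mem i])
      finally show ?thesis by (simp add: D_pow_commutes_T[OF idem i x])
    qed
    then have "T i x \<in> isometric_vectors (D n)" by (simp add: isometric_vectors_def)
    then show ?thesis using iso i x by auto
  qed
  then show "T i x \<in> unitary_part" if "i \<in> {1..n}" "x \<in> unitary_part" for i x using that .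
  fix i x assume i: "i \<in> {1..n}" and x: "x \<in> unitary_part"
  have Dn: "D n x \<in> unitary_part"
    using x iso n_mem d.isometric_vectors_image by auto
  show "D i x \<in> unitary_part"
  proof (cases "i = n")
    case False
    then have "D i x = T (n - i) (D n x)"
      using i x by (intro d.fundamental_relation d.norm_isometric_vectors) auto
    then show ?thesis using T[OF _ Dn, of "n - i"] i False by auto
  qed (use Dn in simp)
qed

end

section \<open>Restriction to reducing subspaces\<close>

text \<open>
  This is applied to functions of the tuple and the decomposition \<open>M \<oplus> M\<^sup>\<bottom>\<close>. For a subspace that is merely
  invariant, surjectivity could be lost.
\<close>

lemma bij_betw_restrict:
  fixes f :: "'a::real_vector \<Rightarrow> 'a"
  assumes bij: "bij f" and add: "\<And>x y. f (x + y) = f x + f y"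
    and sub: "subspace M" "subspace N" and Int: "M \<inter> N \<subseteq> {0}"
    and dec: "\<And>x. \<exists>u\<in>M. \<exists>v\<in>N. x = u + v"
    and inv: "f ` M \<subseteq> M" "f ` N \<subseteq> N"
  shows "bij_betw f M M"
proof -
  have "y \<in> f ` M" if y: "y \<in> M" for y
  proof -
    obtain x where x: "f x = y" using bij by (metis bij_pointE)
    obtain u v where uv: "u \<in> M" "v \<in> N" "x = u + v" using dec by blast
    have "f v = y - f u" using x uv(3) add[of u v] by (metis add_diff_cancel_left')
    then have "f v \<in> M" using y uv(1) inv(1) sub(1) by (auto intro: subspace_diff)
    moreover have "f v \<in> N" using uv(2) inv(2) by blast
    ultimately have "f v = 0" using Int by blast
    then have "f u = y" using \<open>f v = y - f u\<close> by simp
    then show ?thesis using uv(1) by blast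
  qed
  moreover have "inj_on f M" using bij by (auto simp: bij_def intro: inj_on_subset)
  ultimately show ?thesis using inv(1) by (auto simp: bij_betw_def)
qed

lemma inv_into_restrict:
  assumes "bij_betw f M M" "inj f" "y \<in> M"
  shows "inv_into M f y = inv_into UNIV f y"
proof -
  have "f (inv_into M f y) = y" using assms(1,3) by (rule bij_betw_inv_into_right)
  then show ?thesis using assms(2) by (metis inv_f_f)
qed

lemma op_monom_add:
  assumes "\<And>i x y. i \<in> {1..n} \<Longrightarrow> T i (x + y) = T i x + T i y"
  shows "op_monom n T m (x + y) = op_monom n T m x + op_monom n T m y"
  using assms
proof (induction n arbitrary: x y)
  case (Suc n)
  have "(T (Suc n) ^^ k) (x + y) = (T (Suc n) ^^ k) x + (T (Suc n) ^^ k) y" for k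
    by (induction k) (simp_all add: Suc.prems)
  then show ?case using Suc by simp
qed simp

lemma op_poly_additive:
  assumes "\<And>i x y. i \<in> {1..n} \<Longrightarrow> T i (x + y) = T i x + T i y"
  shows "op_poly n p T (x + y) = op_poly n p T x + op_poly n p T y"
  unfolding op_poly_def using op_monom_add[of n T, OF assms]
  by (simp add: scaleC_add_right sum.distrib)

lemma op_monom_mem:
  assumes "\<And>i x. i \<in> {1..n} \<Longrightarrow> x \<in> M \<Longrightarrow> T i x \<in> M" "x \<in> M"
  shows "op_monom n T m x \<in> M"
  using assms
proof (induction n arbitrary: x)
  case (Suc n)
  have "(T (Suc n) ^^ k) x \<in> M" for k
    by (induction k) (use Suc.prems in auto)
  then show ?case using Suc by simp
qed simp

lemma op_poly_mem:
  assumes "\<And>i x. i \<in> {1..n} \<Longrightarrow> x \<in> M \<Longrightarrow> T i x \<in> M" "closed_csubspace M" "x \<in> M"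
  shows "op_poly n p T x \<in> M"
  unfolding op_poly_def
proof (rule subspace_sum[OF closed_csubspace_subspace[OF assms(2)]])
  fix m
  have "op_monom n T m x \<in> M" using assms(1,3) by (rule op_monom_mem)
  then show "Poly_Mapping.lookup p m *\<^sub>C op_monom n T m x \<in> M"
    using assms(2) by (simp add: closed_csubspace_def)
qed

lemma closed_csubspace_orthogonal: "closed_csubspace {x. \<forall>m\<in>M. inner m x = 0}"
  if "closed_csubspace M" for M :: "'a::complex_hilbert set"
  unfolding closed_csubspace_def
proof (intro conjI ballI allI)
  have "{x. \<forall>m\<in>M. inner m x = 0} = (\<Inter>m\<in>M. {x. inner m x = 0})" by auto
  then show "closed {x. \<forall>m\<in>M. inner m x = 0}"
    by (simp add: closed_INT closed_Collect_eq continuous_intros)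
  fix a x assume x: "x \<in> {x. \<forall>m\<in>M. inner m x = 0}"
  have "inner m (a *\<^sub>C x) = 0" if m: "m \<in> M" for m
  proof -
    have "cnj a *\<^sub>C m \<in> M" using \<open>closed_csubspace M\<close> m by (simp add: closed_csubspace_def)
    then have "inner (cnj a *\<^sub>C m) x = 0" using x by blast
    then show ?thesis by (simp add: inner_scaleC_left)
  qed
  then show "a *\<^sub>C x \<in> {x. \<forall>m\<in>M. inner m x = 0}" by blast
qed (auto simp: inner_add_right)

lemma bij_betw_op_poly_restrict:
  assumes M: "reducing n T D M"
    and T: "\<And>i. i \<in> {1..n} \<Longrightarrow> bounded_op UNIV (T i)"
    and adj: "\<And>i x y. i \<in> {1..n} \<Longrightarrow> inner (T i x) y = inner x (D i y)"
    and bij: "bij (op_poly n q T)"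
  shows "bij_betw (op_poly n q T) M M"
proof (rule bij_betw_restrict[OF bij])
  let ?N = "{x. \<forall>m\<in>M. inner m x = 0}"
  have cM: "closed_csubspace M" using M by (simp add: reducing_def)
  note cN = closed_csubspace_orthogonal[OF cM]
  show "subspace M" "subspace ?N" using cM cN by (simp_all add: closed_csubspace_subspace)
  show "M \<inter> ?N \<subseteq> {0}" by auto
  show "op_poly n q T (x + y) = op_poly n q T x + op_poly n q T y" for x y
    using T by (intro op_poly_additive) (auto simp: bounded_op_def clinear_on_def)
  show "\<exists>u\<in>M. \<exists>v\<in>?N. x = u + v" for x
  proof -
    obtain u where "u \<in> M" "\<And>y. y \<in> M \<Longrightarrow> inner (x - u) y = 0"
      using orthogonal_decomposition[of M] cM closed_csubspace_subspace[OF cM]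
      by (metis closed_csubspace_def)
    then show ?thesis by (intro bexI[of _ u] bexI[of _ "x - u"]) (auto simp: inner_commute)
  qed
  show "op_poly n q T ` M \<subseteq> M"
    using M by (auto intro!: op_poly_mem cM simp: reducing_def)
  have "T i x \<in> ?N" if i: "i \<in> {1..n}" and x: "x \<in> ?N" for i x
  proof -
    have "inner m (T i x) = 0" if "m \<in> M" for m
    proof -
      have "D i m \<in> M" using M i that by (simp add: reducing_def)
      then have "inner (D i m) x = 0" using x by blast
      then show ?thesis using adj[OF i, of x m] by (simp add: inner_commute)
    qed
    then show ?thesis by blast
  qed
  then show "op_poly n q T ` ?N \<subseteq> ?N" using op_poly_mem[OF _ cN] by blast
qed

lemma commuting_tuple_restrict:
  assumes "commuting_tuple n UNIV T" "reducing n T D M"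
  shows "commuting_tuple n M T"
  using assms by (auto simp: commuting_tuple_def reducing_def intro: bounded_op_restrict)

text \<open>
  On \<open>M\<close> the inverse of \<open>q(T)\<close> is the restriction of the inverse on the whole space, so the norm
  bounds are inherited; the Taylor spectrum is controlled by the operators \<open>root_op\<close>.
\<close>

lemma spectral_set_restrict:
  assumes contr: "gamma_contraction n UNIV T" and M: "reducing n T D M"
    and adj: "\<And>i x y. i \<in> {1..n} \<Longrightarrow> inner (T i x) y = inner x (D i y)"
  shows "spectral_set n (Gam n) M T"
proof -
  have sp: "spectral_set n (Gam n) UNIV T" and tup: "commuting_tuple n UNIV T"
    using contr by (auto simp: gamma_contraction_def)
  then have T: "bounded_op UNIV (T i)" if "i \<in> {1..n}" for i
    using that by (simp add: commuting_tuple_def)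
  note restrict = bij_betw_op_poly_restrict[OF M T adj]
  have root: "op_poly n (affine_poly n 1 (\<lambda>i. (- u) ^ i)) T = root_op n u T" for u
    by (rule ext) (simp add: op_poly_affine affine_op_def)
  have "bij_betw (root_op n u T) M M" if "cmod u < 1" for u
    using restrict[of "affine_poly n 1 (\<lambda>i. (- u) ^ i)"] root_op_bij(1)[OF sp that] by (simp add: root)
  then have "taylor_spectrum n M T \<subseteq> Gam n"
    by (intro taylor_spectrum_subset_Gam commuting_tuple_restrict[OF tup M])
  moreover have "bij_betw (op_poly n q T) M M \<and>
        (\<forall>x\<in>M. norm (op_poly n p T (inv_into M (op_poly n q T) x))
                 \<le> (SUP z\<in>Gam n. cmod (poly_eval n p z / poly_eval n q z)) * norm x)"
    if pq: "poly_in n p" "poly_in n q" "\<forall>z\<in>Gam n. poly_eval n q z \<noteq> 0" for p q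
  proof -
    have *: "bij (op_poly n q T)" "norm (op_poly n p T (inv_into UNIV (op_poly n q T) x))
                 \<le> (SUP z\<in>Gam n. cmod (poly_eval n p z / poly_eval n q z)) * norm x" for x
      using sp pq unfolding spectral_set_def by blast+
    note b = restrict[OF _ _ *(1)]
    show ?thesis
      using b *(2) inv_into_restrict[OF b bij_is_inj[OF *(1)]] by auto
  qed
  ultimately show ?thesis using sp unfolding spectral_set_def by blast
qed

lemma gamma_contraction_restrict:
  assumes contr: "gamma_contraction n UNIV T" and M: "reducing n T D M"
    and adj: "\<And>i x y. i \<in> {1..n} \<Longrightarrow> inner (T i x) y = inner x (D i y)"
  shows "gamma_contraction n M T"
  using commuting_tuple_restrict[OF _ M] spectral_set_restrict[OF contr M adj] contr
  by (simp add: gamma_contraction_def)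

lemma adj_on_reducing:
  assumes "reducing n T D M" "i \<in> {1..n}" "bounded_op UNIV (T i)"
    and "\<And>x y. inner (T i x) y = inner x (D i y)" "x \<in> M"
  shows "adj M (T i) x = D i x"
  using assms by (intro adj_eqI) (auto simp: reducing_def bounded_op_def clinear_on_def)

text \<open>
  Normality: \<open>D\<^sub>i = T\<^bsub>n-i\<^esub> D\<^sub>n\<close> is a product of operators commuting with \<open>T\<^sub>i\<close>. The spectrum lies in \<open>b\<Gamma>\<^sub>n\<close>
  because \<open>T\<^sub>n\<close> is unitary.
\<close>

lemma (in gamma_pair) gamma_unitary_on_unitary_part:
  assumes gc: "gamma_contraction n UNIV T" and idem: "A = A \<circ> A"
  shows "gamma_unitary n unitary_part T"
proof -
  interpret d: gamma_pair n D T by (rule gamma_pair_dual)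
  note red = reducing_unitary_part[OF idem]
  note inv = red[unfolded reducing_def]
  have tup: "commuting_tuple n unitary_part T"
    using gc commuting_tuple_restrict[OF _ red] by (simp add: gamma_contraction_def)
  have "T i (D i x) = D i (T i x)" if i: "i \<in> {1..n}" and x: "x \<in> unitary_part" for i x
  proof (cases "i = n")
    case True
    then show ?thesis using x isometric_vectors_cancel[of x] d.isometric_vectors_cancel[of x] by simp
  next
    case False
    then have i': "i \<in> {1..<n}" "n - i \<in> {1..n}" using i by auto
    have Tx: "T i x \<in> unitary_part" using inv i x by blast
    have "D i x = T (n - i) (D n x)" "D i (T i x) = T (n - i) (D n (T i x))"
      using x Tx by (auto intro!: d.fundamental_relation[OF i'(1)] d.norm_isometric_vectors)
    moreover have "D n (T i x) = T i (D n x)" using D_pow_commutes_T[OF idem i x, of 1] by simp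
    ultimately show ?thesis by (simp add: comm[OF i i'(2)])
  qed
  moreover have "adj unitary_part (T i) x = D i x" if "i \<in> {1..n}" "x \<in> unitary_part" for i x
    by (rule adj_on_reducing[OF red that(1) op(1)[OF that(1)] adj_T[OF that(1)] that(2)])
  ultimately have normal: "normal_op unitary_part (T i)" if i: "i \<in> {1..n}" for i
    unfolding normal_op_def using i tup inv by (auto simp: commuting_tuple_def)
  have "taylor_spectrum n unitary_part T \<subseteq> bGam n"
  proof (rule taylor_spectrum_subset_bGam[OF tup])
    show "bij_betw (root_op n u T) unitary_part unitary_part" if "cmod u < 1" for u
      by (rule root_op_bij(1)[OF spectral_set_restrict[OF gc red adj_T] that])
    show "bij_betw (\<lambda>x. T n x - l *\<^sub>C x) unitary_part unitary_part" if "cmod l < 1" for l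
      using that tup inv n_mem
      by (intro unitary_minus_scalar_bij[where D = "D n"])
         (auto simp: commuting_tuple_def norm_isometric_vectors d.isometric_vectors_cancel)
  qed
  then show ?thesis using tup normal by (simp add: gamma_unitary_def)
qed

section \<open>Two-sided square-summable sequences\<close>

text \<open>Sequences over \<open>\<int>\<close> are stored along the bijection \<open>int_encode\<close> of \<open>\<int>\<close> with \<open>\<nat>\<close>.\<close>

definition coord :: "'a::complex_hilbert ell2 \<Rightarrow> int \<Rightarrow> 'a" where
  "coord f m = ell2_nth f (int_encode m)"

lemma coord_simps [simp]:
  "coord 0 m = 0" "coord (f + g) m = coord f m + coord g m"
  "coord (f - g) m = coord f m - coord g m" "coord (a *\<^sub>C f) m = a *\<^sub>C coord f m"
  by (simp_all add: coord_def)

lemma coord_sum: "coord (\<Sum>i\<in>I. f i) m = (\<Sum>i\<in>I. coord (f i) m)"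
  by (induction I rule: infinite_finite_induct) simp_all

lemma coord_eqI: "(\<And>m. coord f m = coord g m) \<Longrightarrow> f = g"
proof (rule ell2_eqI)
  fix k assume "\<And>m. coord f m = coord g m"
  from this[of "int_decode k"] show "ell2_nth f k = ell2_nth g k" by (simp add: coord_def)
qed

lemma bounded_linear_ell2_nth: "bounded_linear (\<lambda>f. ell2_nth f k)"
  by (rule bounded_linear_intro[where K = 1]) (simp_all add: norm_ell2_nth_le)

definition ell2_over :: "'a::complex_hilbert set \<Rightarrow> 'a ell2 set" where
  "ell2_over E = {f. \<forall>k. ell2_nth f k \<in> E}"

lemma ell2_over_coord: "f \<in> ell2_over E \<longleftrightarrow> (\<forall>m. coord f m \<in> E)"
proof
  assume f: "\<forall>m. coord f m \<in> E"
  have "ell2_nth f k \<in> E" for k using f[rule_format, of "int_decode k"] by (simp add: coord_def)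
  then show "f \<in> ell2_over E" by (simp add: ell2_over_def)
qed (simp add: ell2_over_def coord_def)

lemma closed_csubspace_ell2_over: "closed_csubspace E \<Longrightarrow> closed_csubspace (ell2_over E)"
proof -
  assume E: "closed_csubspace E"
  have "closed ((\<lambda>f. ell2_nth f k) -` E)" for k :: nat
    using E bounded_linear.isUCont[OF bounded_linear_ell2_nth]
    by (intro closed_vimage linear_continuous_on[OF bounded_linear_ell2_nth])
       (auto simp: closed_csubspace_def)
  moreover have "ell2_over E = (\<Inter>k. (\<lambda>f. ell2_nth f k) -` E)" by (auto simp: ell2_over_def)
  ultimately have "closed (ell2_over E)" by (simp add: closed_INT)
  then show ?thesis using E by (auto simp: closed_csubspace_def ell2_over_def)
qed

definition ell2_map :: "('a::complex_hilbert \<Rightarrow> 'a) \<Rightarrow> 'a ell2 \<Rightarrow> 'a ell2" where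
  "ell2_map A f = Abs_ell2 (\<lambda>k. A (ell2_nth f k))"

lemma
  assumes A: "bounded_op UNIV A"
  shows ell2_nth_map: "ell2_nth (ell2_map A f) k = A (ell2_nth f k)"
    and bounded_op_ell2_map: "bounded_op UNIV (ell2_map A)"
proof -
  obtain B where B: "\<And>x. norm (A x) \<le> norm x * B" "0 < B"
    using bounded_linear.pos_bounded[OF bounded_op_UNIV_linear[OF A]] by blast
  have sq: "(norm (A x))\<^sup>2 \<le> B\<^sup>2 * (norm x)\<^sup>2" for x
    using power_mono[OF B(1) norm_ge_zero, of x 2] by (simp add: power_mult_distrib mult.commute)
  have "summable (\<lambda>k. (norm (A (ell2_nth f k)))\<^sup>2)" for f
    by (rule summable_comparison_test'[OF summable_mult[OF summable_ell2[of f], of "B\<^sup>2"]])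
       (simp add: sq)
  then have nth: "ell2_nth (ell2_map A f) k = A (ell2_nth f k)" for f k
    unfolding ell2_map_def by (simp add: ell2_nth_Abs)
  then show "ell2_nth (ell2_map A f) k = A (ell2_nth f k)" .
  have le: "norm (ell2_map A f) \<le> B * norm f" for f
  proof (rule power2_le_imp_le)
    have "(norm (ell2_map A f))\<^sup>2 \<le> suminf (\<lambda>k. B\<^sup>2 * (norm (ell2_nth f k))\<^sup>2)"
      unfolding norm_ell2_sq nth
      using summable_ell2[of "ell2_map A f"]
      by (intro suminf_le sq summable_mult summable_ell2) (simp add: nth)
    also have "\<dots> = (B * norm f)\<^sup>2"
      by (simp add: suminf_mult summable_ell2 norm_ell2_sq power_mult_distrib)
    finally show "(norm (ell2_map A f))\<^sup>2 \<le> (B * norm f)\<^sup>2" .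
  qed (use B in simp)
  show "bounded_op UNIV (ell2_map A)"
    using A le by (auto simp: bounded_op_def clinear_on_def nth intro!: ell2_eqI exI[of _ B])
qed

lemma coord_map: "bounded_op UNIV A \<Longrightarrow> coord (ell2_map A f) m = A (coord f m)"
  by (simp add: coord_def ell2_nth_map)

lemma inner_ell2_map:
  assumes "bounded_op UNIV A" "bounded_op UNIV B"
    and "\<And>x y. x \<in> E \<Longrightarrow> y \<in> E \<Longrightarrow> inner (A x) y = inner x (B y)"
    and "f \<in> ell2_over E" "g \<in> ell2_over E"
  shows "inner (ell2_map A f) g = inner f (ell2_map B g)"
  using assms by (simp add: inner_ell2_def ell2_nth_map ell2_over_def)

definition shift_ell2 :: "int \<Rightarrow> 'a::complex_hilbert ell2 \<Rightarrow> 'a ell2" where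
  "shift_ell2 j f = Abs_ell2 (\<lambda>k. ell2_nth f (int_encode (int_decode k - j)))"

lemma shift_index: "bij (\<lambda>k. int_encode (int_decode k - j))"
  by (rule o_bij[of "\<lambda>k. int_encode (int_decode k + j)"]) (auto simp: fun_eq_iff)

lemma summable_shift:
  "summable (\<lambda>k. (norm (ell2_nth f (int_encode (int_decode k - j))))\<^sup>2)" (is ?S)
  and suminf_shift:
  "suminf (\<lambda>k. (norm (ell2_nth f (int_encode (int_decode k - j))))\<^sup>2) = (norm f)\<^sup>2" (is ?E)
proof -
  let ?g = "\<lambda>k. int_encode (int_decode k - j)" and ?f = "\<lambda>k. (norm (ell2_nth f k))\<^sup>2"
  have g: "inj ?g" "surj ?g" using shift_index[of j] by (auto simp: bij_def)
  show ?S using summable_reindex[OF summable_ell2 g(1), of f] by (simp add: o_def)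
  show ?E using suminf_reindex[OF summable_ell2 g(1), of f] g(2) by (simp add: o_def norm_ell2_sq)
qed

lemma coord_shift [simp]: "coord (shift_ell2 j f) m = coord f (m - j)"
  unfolding shift_ell2_def coord_def by (simp add: ell2_nth_Abs summable_shift)

lemma norm_shift [simp]: "norm (shift_ell2 j f) = norm f"
proof (rule power2_eq_imp_eq)
  show "(norm (shift_ell2 j f))\<^sup>2 = (norm f)\<^sup>2"
    using suminf_shift[of f j] unfolding norm_ell2_sq[of "shift_ell2 j f"]
    unfolding shift_ell2_def by (simp add: ell2_nth_Abs summable_shift)
qed simp_all

lemma shift_add: "shift_ell2 j (f + g) = shift_ell2 j f + shift_ell2 j g"
  and shift_scaleC: "shift_ell2 j (a *\<^sub>C f) = a *\<^sub>C shift_ell2 j f"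
  and shift_shift: "shift_ell2 i (shift_ell2 j f) = shift_ell2 (i + j) f"
  and shift_0: "shift_ell2 0 f = f"
  by (rule coord_eqI, simp add: algebra_simps)+

lemma bounded_op_shift: "bounded_op UNIV (shift_ell2 j)"
  by (auto simp: bounded_op_def clinear_on_def shift_add shift_scaleC intro!: exI[of _ 1])

lemma inner_shift: "inner (shift_ell2 j f) g = inner f (shift_ell2 (- j) g)"
proof -
  have "inner (shift_ell2 j f) (shift_ell2 j h) = inner f h" for h
    by (simp add: dot_norm flip: shift_add)
  from this[of "shift_ell2 (- j) g"] show ?thesis by (simp add: shift_shift shift_0)
qed

definition one_sided :: "(nat \<Rightarrow> 'a::complex_hilbert) \<Rightarrow> 'a ell2" where
  "one_sided h = Abs_ell2 (\<lambda>k. if 0 \<le> int_decode k then h (nat (int_decode k)) else 0)"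

lemma
  assumes "(\<lambda>m. (norm (h m))\<^sup>2) sums s"
  shows coord_one_sided: "coord (one_sided h) m = (if 0 \<le> m then h (nat m) else 0)"
    and norm_one_sided: "(norm (one_sided h))\<^sup>2 = s"
proof -
  let ?F = "\<lambda>k. if 0 \<le> int_decode k then h (nat (int_decode k)) else 0"
  have mono: "strict_mono (\<lambda>m::nat. int_encode (int m))"
    by (rule strict_monoI) (simp add: int_encode_def sum_encode_def)
  have "(\<lambda>m. (norm (?F (int_encode (int m))))\<^sup>2) sums s" using assms by simp
  moreover have "(norm (?F k))\<^sup>2 = 0" if "k \<notin> range (\<lambda>m::nat. int_encode (int m))" for k
  proof (cases "0 \<le> int_decode k")
    case True
    then have "k = int_encode (int (nat (int_decode k)))" by simp
    then show ?thesis using that by blast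
  qed simp
  ultimately have sums: "(\<lambda>k. (norm (?F k))\<^sup>2) sums s"
    using sums_mono_reindex[OF mono, of "\<lambda>k. (norm (?F k))\<^sup>2" s] by blast
  then have nth: "ell2_nth (one_sided h) = ?F"
    unfolding one_sided_def by (intro ell2_nth_Abs) (rule sums_summable)
  then show "coord (one_sided h) m = (if 0 \<le> m then h (nat m) else 0)"
    by (simp add: coord_def)
  show "(norm (one_sided h))\<^sup>2 = s"
    unfolding norm_ell2_sq nth using sums by (rule sums_unique[symmetric])
qed

definition truncate :: "nat \<Rightarrow> 'a::complex_hilbert ell2 \<Rightarrow> 'a ell2" where
  "truncate N f = Abs_ell2 (\<lambda>k. if k < N then ell2_nth f k else 0)"

lemma truncate_nth: "ell2_nth (truncate N f) k = (if k < N then ell2_nth f k else 0)"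
proof -
  have "summable (\<lambda>k. (norm (if k < N then ell2_nth f k else 0))\<^sup>2)"
    by (rule summable_finite[of "{..<N}"]) auto
  then show ?thesis unfolding truncate_def by (simp add: ell2_nth_Abs)
qed

lemma truncate_tendsto: "(\<lambda>N. truncate N f) \<longlonglongrightarrow> f"
proof -
  let ?a = "\<lambda>k. (norm (ell2_nth f k))\<^sup>2"
  have "(norm (f - truncate N f))\<^sup>2 = (norm f)\<^sup>2 - (\<Sum>k<N. ?a k)" for N
  proof -
    have "(norm (f - truncate N f))\<^sup>2 = suminf (\<lambda>k. ?a k - (if k < N then ?a k else 0))"
      unfolding norm_ell2_sq by (intro suminf_cong) (simp add: truncate_nth)
    also have "\<dots> = suminf (\<lambda>k. ?a k) - suminf (\<lambda>k. if k < N then ?a k else 0)"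
      by (intro suminf_diff[symmetric] summable_ell2 summable_finite[of "{..<N}"]) auto
    also have "suminf (\<lambda>k. if k < N then ?a k else 0) = (\<Sum>k<N. ?a k)"
      by (subst suminf_finite[of "{..<N}"]) auto
    finally show ?thesis by (simp add: norm_ell2_sq)
  qed
  moreover have "(\<lambda>N. (norm f)\<^sup>2 - (\<Sum>k<N. ?a k)) \<longlonglongrightarrow> (norm f)\<^sup>2 - (norm f)\<^sup>2"
    unfolding norm_ell2_sq by (intro tendsto_diff tendsto_const summable_LIMSEQ summable_ell2)
  ultimately have "(\<lambda>N. sqrt ((norm (f - truncate N f))\<^sup>2)) \<longlonglongrightarrow> sqrt 0"
    by (intro tendsto_real_sqrt) simp
  then have "(\<lambda>N. norm (truncate N f - f)) \<longlonglongrightarrow> 0"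
    by (simp add: norm_minus_commute)
  then show ?thesis by (rule LIM_zero_cancel[OF tendsto_norm_zero_cancel])
qed

section \<open>The Wold decomposition of the shift part\<close>

locale gamma_shift = gamma_pair n T D for n and T D :: "nat \<Rightarrow> 'a::complex_hilbert \<Rightarrow> 'a" +
  fixes M :: "'a set"
  assumes red: "reducing n T D M"
    and iso: "M \<subseteq> isometric_vectors (T n)" and stab: "M \<subseteq> stable_vectors (D n)"
begin

text \<open>With \<open>T\<^sub>0 = I\<close> the fundamental relation \<open>T\<^sub>i = D\<^bsub>n-i\<^esub> P\<close> covers \<open>i = 0\<close> and \<open>i = n\<close> as well.\<close>

definition T0 where "T0 i = (if i = 0 then id else T i)"
definition D0 where "D0 i = (if i = 0 then id else D i)"

lemma cM: "closed_csubspace M" and sM: "subspace M"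
  using red closed_csubspace_subspace by (auto simp: reducing_def)

lemma bounded_op_id: "bounded_op UNIV (id :: 'a \<Rightarrow> 'a)"
  by (intro bounded_op_UNIV_I) (simp_all add: id_def)

lemma op0: "i \<le> n \<Longrightarrow> bounded_op UNIV (T0 i)" "i \<le> n \<Longrightarrow> bounded_op UNIV (D0 i)"
  using op bounded_op_id by (auto simp: T0_def D0_def)

lemma mem0: "i \<le> n \<Longrightarrow> x \<in> M \<Longrightarrow> T0 i x \<in> M" "i \<le> n \<Longrightarrow> x \<in> M \<Longrightarrow> D0 i x \<in> M"
  using red by (auto simp: T0_def D0_def reducing_def)

lemma adj0: "i \<le> n \<Longrightarrow> inner (T0 i x) y = inner x (D0 i y)"
  using adj_T by (auto simp: T0_def D0_def)

lemma comm0: "i \<le> n \<Longrightarrow> j \<le> n \<Longrightarrow> T0 i (T0 j x) = T0 j (T0 i x)"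
  "i \<le> n \<Longrightarrow> j \<le> n \<Longrightarrow> D0 i (D0 j x) = D0 j (D0 i x)"
  using comm comm_D by (auto simp: T0_def D0_def)

lemma Tn: "x \<in> M \<Longrightarrow> T n x \<in> M" and Dn: "x \<in> M \<Longrightarrow> D n x \<in> M"
  using red n_mem by (auto simp: reducing_def)

lemma DnTn: "x \<in> M \<Longrightarrow> D n (T n x) = x"
  using iso isometric_vectors_cancel by blast

lemma relation0:
  assumes "i \<le> n" "x \<in> M"
  shows "T0 i x = D0 (n - i) (T n x)"
proof -
  consider "i = 0" | "i = n" | "i \<in> {1..<n}" using assms(1) by force
  then show ?thesis
  proof cases
    case 3
    then have "T i x = D (n - i) (T n x)"
      using assms(2) iso by (intro fundamental_relation norm_isometric_vectors) auto
    then show ?thesis using 3 by (simp add: T0_def D0_def)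
  qed (use n2 DnTn assms in \<open>auto simp: T0_def D0_def\<close>)
qed

text \<open>\<open>Q\<close> is the projection of \<open>M\<close> onto the wandering subspace \<open>E = M \<ominus> P M\<close>.\<close>

definition Q where "Q x = x - T n (D n x)"
definition E where "E = M \<inter> kernel (D n)"

lemma opQ: "bounded_op UNIV Q"
proof -
  have "bounded_linear Q"
    unfolding Q_def by (intro bounded_linear_sub bounded_linear_ident bounded_linear_compose[OF linear_P linear_D])
  then show ?thesis
    by (rule bounded_op_UNIV_I)
       (simp add: Q_def bounded_op_UNIV_scaleC[OF opP] bounded_op_UNIV_scaleC[OF opD] scaleC_diff_right)
qed

lemma linears: "bounded_linear Q" "i \<le> n \<Longrightarrow> bounded_linear (T0 i)" "i \<le> n \<Longrightarrow> bounded_linear (D0 i)"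
  using opQ op0 by (auto intro: bounded_op_UNIV_linear)

lemmas diffs = linear_diff[OF bounded_linear.linear[OF linears(1)]]
  linear_diff[OF bounded_linear.linear[OF linears(2)]] linear_diff[OF bounded_linear.linear[OF linears(3)]]

lemma E_M: "e \<in> E \<Longrightarrow> e \<in> M" and E_D: "e \<in> E \<Longrightarrow> D n e = 0"
  by (auto simp: E_def kernel_def)

lemma closed_csubspace_E: "closed_csubspace E"
  unfolding E_def by (intro closed_csubspace_Int cM closed_csubspace_kernel opD)

lemma Q_E: "e \<in> E \<Longrightarrow> Q e = e"
  using linear_0[OF bounded_linear.linear[OF linear_P]] by (simp add: Q_def E_D)

lemma Q_mem: "y \<in> M \<Longrightarrow> Q y \<in> E"
  using subspace_diff[OF sM] Tn Dn DnTn linear_diff[OF bounded_linear.linear[OF linear_D]]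
  by (simp add: E_def kernel_def Q_def)

lemma Q_T: "z \<in> M \<Longrightarrow> Q (T n z) = 0"
  by (simp add: Q_def DnTn)

lemma inner_Q: "e \<in> E \<Longrightarrow> inner (Q x) e = inner x e"
  by (simp add: Q_def inner_diff_left adjoint E_D)

lemma norm_Q: "y \<in> M \<Longrightarrow> (norm (Q y))\<^sup>2 = (norm y)\<^sup>2 - (norm (D n y))\<^sup>2"
proof -
  assume y: "y \<in> M"
  have "norm (T n (D n y)) = norm (D n y)" using Dn[OF y] iso norm_isometric_vectors by blast
  moreover have "inner (T n (D n y)) y = (norm (D n y))\<^sup>2" by (simp add: adjoint power2_norm_eq_inner)
  ultimately show ?thesis unfolding Q_def norm_diff_square by simp
qed

text \<open>\<open>P M\<close> is invariant under \<open>T\<^sub>i\<close>, so the component of \<open>T\<^sub>i y\<close> in \<open>E\<close> depends only on that of \<open>y\<close>.\<close>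

lemma Q_T0_Q: "i \<le> n \<Longrightarrow> y \<in> M \<Longrightarrow> Q (T0 i (Q y)) = Q (T0 i y)"
proof -
  assume i: "i \<le> n" and y: "y \<in> M"
  have "T0 i (T n (D n y)) = T n (T0 i (D n y))"
    using comm0(1)[OF i, of n "D n y"] n2 by (simp add: T0_def)
  then have "Q (T0 i (T n (D n y))) = 0" using Q_T[OF mem0(1)[OF i Dn[OF y]]] by simp
  then show ?thesis by (simp add: Q_def[of y] diffs i)
qed

text \<open>
  The coefficient identity behind \<open>V_intertwines\<close>: split \<open>y = Q y + P D\<^sub>n y\<close> and use
  \<open>D\<^bsub>n-i\<^esub> P = T\<^sub>i\<close> on the second summand.
\<close>

lemma Q_D0_Q:
  assumes i: "i \<le> n" and y: "y \<in> M"
  shows "Q (T0 i (Q (D n y))) + Q (D0 (n - i) (Q y)) = Q (D0 (n - i) y)"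
proof -
  have "D0 (n - i) (T n (D n y)) = T0 i (D n y)" by (rule relation0[OF i Dn[OF y], symmetric])
  then have "Q (D0 (n - i) (Q y)) = Q (D0 (n - i) y) - Q (T0 i (D n y))"
    by (simp add: Q_def[of y] diffs)
  then show ?thesis using Q_T0_Q[OF i Dn[OF y]] by simp
qed

section \<open>The unitary extension\<close>

text \<open>
  By the Wold decomposition \<open>M\<close> is the space of square-summable sequences in \<open>E\<close>, \<open>P\<close> is the shift, and
  \<open>T\<^sub>i\<close> is the analytic Toeplitz operator with the symbol \<open>A\<^sub>i + \<zeta> B\<^sub>i\<close>. The extension \<open>U\<^sub>i\<close> is the
  Laurent operator with the same symbol on two-sided sequences.
\<close>

definition A_coeff where "A_coeff i x = Q (T0 i x)"
definition B_coeff where "B_coeff i x = Q (D0 (n - i) x)"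

definition U where "U i f = ell2_map (A_coeff i) f + ell2_map (B_coeff i) (shift_ell2 1 f)"

definition V where "V x = one_sided (\<lambda>m. Q ((D n ^^ m) x))"

abbreviation K where "K \<equiv> ell2_over E"

lemma op_coeff:
  assumes "i \<le> n"
  shows "bounded_op UNIV (A_coeff i)" "bounded_op UNIV (B_coeff i)"
proof -
  note T = op0(1)[OF assms] and D = op0(2)[of "n - i", simplified]
  show "bounded_op UNIV (A_coeff i)"
  proof (rule bounded_op_UNIV_I)
    show "bounded_linear (A_coeff i)" unfolding A_coeff_def[abs_def]
      by (rule bounded_linear_compose[OF linears(1) linears(2)[OF assms]])
  qed (simp add: A_coeff_def bounded_op_UNIV_scaleC[OF T] bounded_op_UNIV_scaleC[OF opQ])
  show "bounded_op UNIV (B_coeff i)"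
  proof (rule bounded_op_UNIV_I)
    show "bounded_linear (B_coeff i)" unfolding B_coeff_def[abs_def]
      by (rule bounded_linear_compose[OF linears(1) linears(3)]) simp
  qed (simp add: B_coeff_def bounded_op_UNIV_scaleC[OF D] bounded_op_UNIV_scaleC[OF opQ])
qed

lemma coeff_mem: "i \<le> n \<Longrightarrow> e \<in> E \<Longrightarrow> A_coeff i e \<in> E" "i \<le> n \<Longrightarrow> e \<in> E \<Longrightarrow> B_coeff i e \<in> E"
  by (simp_all add: A_coeff_def B_coeff_def Q_mem mem0 E_M)

text \<open>
  In terms of symbols: \<open>(A\<^sub>i + \<zeta> B\<^sub>i)\<^sup>* = cnj \<zeta> (A\<^bsub>n-i\<^esub> + \<zeta> B\<^bsub>n-i\<^esub>)\<close> for \<open>|\<zeta>| = 1\<close>. This is the fundamental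
  relation for the extension, and the source of its normality.
\<close>

lemma inner_coeff:
  assumes "i \<le> n" "e \<in> E" "g \<in> E"
  shows "inner (A_coeff i e) g = inner e (B_coeff (n - i) g)"
    and "inner (B_coeff i e) g = inner e (A_coeff (n - i) g)"
proof -
  have *: "inner (A_coeff i e) g = inner e (B_coeff (n - i) g)" if "i \<le> n" "e \<in> E" "g \<in> E" for i e g
    using that inner_Q[of g "T0 i e"] inner_Q[of e "D0 i g"] adj0[of i e g]
    by (simp add: A_coeff_def B_coeff_def inner_commute)
  show "inner (A_coeff i e) g = inner e (B_coeff (n - i) g)" by (rule *[OF assms])
  show "inner (B_coeff i e) g = inner e (A_coeff (n - i) g)"
    using *[of "n - i" g e] assms by (simp add: inner_commute)
qed

lemma coeff_lin:
  assumes "i \<le> n"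
  shows "A_coeff i 0 = 0" "B_coeff i 0 = 0"
    "A_coeff i (x + y) = A_coeff i x + A_coeff i y" "B_coeff i (x + y) = B_coeff i x + B_coeff i y"
proof -
  note lin = op_coeff[OF assms, THEN bounded_op_UNIV_linear, THEN bounded_linear.linear]
  show "A_coeff i 0 = 0" "B_coeff i 0 = 0" by (rule lin[THEN linear_0])+
  show "A_coeff i (x + y) = A_coeff i x + A_coeff i y" "B_coeff i (x + y) = B_coeff i x + B_coeff i y"
    by (rule lin[THEN linear_add])+
qed

lemma coord_U: "i \<le> n \<Longrightarrow> coord (U i f) m = A_coeff i (coord f m) + B_coeff i (coord f (m - 1))"
  by (simp add: U_def coord_map op_coeff)

lemma U_mem: "i \<le> n \<Longrightarrow> f \<in> K \<Longrightarrow> U i f \<in> K"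
  by (simp add: ell2_over_coord coord_U coeff_mem
      subspace_add[OF closed_csubspace_subspace[OF closed_csubspace_E]])

lemma shift_mem: "f \<in> K \<Longrightarrow> shift_ell2 j f \<in> K"
  by (simp add: ell2_over_coord)

lemma U_shift: "i \<le> n \<Longrightarrow> U i (shift_ell2 j f) = shift_ell2 j (U i f)"
  by (rule coord_eqI) (simp add: coord_U algebra_simps)

lemma op_U: "i \<le> n \<Longrightarrow> bounded_op UNIV (U i)"
proof -
  assume i: "i \<le> n"
  note ops = bounded_op_ell2_map[OF op_coeff(1)[OF i]] bounded_op_ell2_map[OF op_coeff(2)[OF i]]
  have "bounded_linear (U i)"
    unfolding U_def
    by (rule bounded_linear_add[OF bounded_op_UNIV_linear[OF ops(1)]
          bounded_linear_compose[OF bounded_op_UNIV_linear[OF ops(2)] bounded_op_UNIV_linear[OF bounded_op_shift]]])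
  then show ?thesis
    by (rule bounded_op_UNIV_I)
       (simp add: U_def bounded_op_UNIV_scaleC[OF ops(1)] bounded_op_UNIV_scaleC[OF ops(2)]
         shift_scaleC scaleC_add_right)
qed

lemma U_n: "f \<in> K \<Longrightarrow> U n f = shift_ell2 1 f"
  using Q_T[OF E_M] Q_E n2 
  by (intro coord_eqI) (simp add: coord_U ell2_over_coord A_coeff_def B_coeff_def T0_def D0_def)

lemma D_pow_mem: "x \<in> M \<Longrightarrow> (D n ^^ m) x \<in> M"
  by (induction m) (auto intro: Dn)

lemma T_pow_mem: "x \<in> M \<Longrightarrow> (T n ^^ m) x \<in> M"
  by (induction m) (auto intro: Tn)

text \<open>The sum telescopes, and purity makes the remainder \<open>\<parallel>D\<^sub>n\<^sup>m x\<parallel>\<^sup>2\<close> vanish in the limit.\<close>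

lemma sums_V:
  assumes x: "x \<in> M"
  shows "(\<lambda>m. (norm (Q ((D n ^^ m) x)))\<^sup>2) sums (norm x)\<^sup>2"
proof -
  have "(\<lambda>m. (norm ((D n ^^ m) x))\<^sup>2) \<longlonglongrightarrow> 0\<^sup>2"
    using x stab by (intro tendsto_power tendsto_norm_zero) (auto simp: stable_vectors_def)
  from telescope_sums'[OF this] show ?thesis
    by (simp add: norm_Q D_pow_mem x)
qed

lemma coord_V: "x \<in> M \<Longrightarrow> coord (V x) m = (if 0 \<le> m then Q ((D n ^^ nat m) x) else 0)"
  unfolding V_def by (rule coord_one_sided[OF sums_V])

lemma norm_V: "x \<in> M \<Longrightarrow> norm (V x) = norm x"
  unfolding V_def by (rule power2_eq_imp_eq[OF norm_one_sided[OF sums_V]]) simp_all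

lemma V_mem: "x \<in> M \<Longrightarrow> V x \<in> K"
  by (simp add: ell2_over_coord coord_V Q_mem D_pow_mem
      subspace_0[OF closed_csubspace_subspace[OF closed_csubspace_E]])

lemma V_linear: "clinear_on M V"
proof -
  interpret d: contraction_pair "D n" "T n" by (rule dual)
  have op: "bounded_op UNIV (D n ^^ k)" for k by (rule d.bounded_op_pow)
  note lin = linear_add[OF bounded_linear.linear[OF bounded_op_UNIV_linear]] bounded_op_UNIV_scaleC
  have "V (x + y) = V x + V y" if "x \<in> M" "y \<in> M" for x y
    by (rule coord_eqI) (simp add: that subspace_add[OF sM] coord_V lin[OF op] lin[OF opQ])
  moreover have "V (a *\<^sub>C x) = a *\<^sub>C V x" if "x \<in> M" for a x
  proof -
    have "a *\<^sub>C x \<in> M" using cM that by (simp add: closed_csubspace_def)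
    then show ?thesis
      by (intro coord_eqI) (simp add: that coord_V lin[OF op] lin[OF opQ] scaleC_zero_right)
  qed
  ultimately show ?thesis by (simp add: clinear_on_def)
qed

lemma V_intertwines:
  assumes i: "i \<le> n" and x: "x \<in> M"
  shows "V (T0 i x) = U i (V x)"
proof (rule coord_eqI)
  fix m
  note Tx = mem0(1)[OF i x]
  consider "m < 0" | "m = 0" | k where "m = int (Suc k)"
    by (metis int_cases linorder_not_less nat_0_le negD nonneg_int_cases not0_implies_Suc of_nat_0)
  then show "coord (V (T0 i x)) m = coord (U i (V x)) m"
  proof cases
    case 1
    then show ?thesis by (simp add: coord_V coord_U i x Tx coeff_lin)
  next
    case 2
    then show ?thesis by (simp add: coord_V coord_U i x Tx coeff_lin A_coeff_def Q_T0_Q)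
  next
    case (3 k)
    let ?y = "(D n ^^ k) x"
    have pow: "(D n ^^ l) (D0 (n - i) z) = D0 (n - i) ((D n ^^ l) z)" for l z
      using comm0(2)[of n "n - i"] n2 by (induction l) (auto simp: D0_def)
    have "(D n ^^ Suc k) (T0 i x) = D0 (n - i) ((D n ^^ Suc k) (T n x))"
      unfolding relation0[OF i x] by (rule pow)
    also have "(D n ^^ Suc k) (T n x) = ?y"
      by (simp only: funpow_Suc_right o_apply DnTn[OF x])
    finally have "coord (V (T0 i x)) m = Q (D0 (n - i) ?y)"
      using 3 Tx by (simp add: coord_V nat_add_distrib)
    also have "\<dots> = Q (T0 i (Q (D n ?y))) + Q (D0 (n - i) (Q ?y))"
      by (rule Q_D0_Q[OF i D_pow_mem[OF x], symmetric])
    also have "\<dots> = coord (U i (V x)) m"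
      using 3 i x by (simp add: coord_U coord_V A_coeff_def B_coeff_def nat_add_distrib)
    finally show ?thesis .
  qed
qed

lemma coord_V_E:
  assumes e: "e \<in> E"
  shows "coord (V e) m = (if m = 0 then e else 0)"
proof (cases "m > 0")
  case True
  have pow: "(D n ^^ Suc k) e = 0" for k
    using E_D[OF e] linear_0[OF bounded_linear.linear[OF linear_D]]
    by (induction k) auto
  from True obtain k where "nat m = Suc k" using not0_implies_Suc by fastforce
  then show ?thesis using True pow[of k] linear_0[OF bounded_linear.linear[OF linears(1)]]
    by (simp add: coord_V E_M[OF e] del: funpow.simps)
qed (auto simp: coord_V E_M Q_E e)

text \<open>Comparing the coordinates of \<open>T\<^sub>i T\<^sub>j e = T\<^sub>j T\<^sub>i e\<close> for \<open>e \<in> E\<close> gives the commutation of the symbols.\<close>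

lemma coeff_comm:
  assumes i: "i \<le> n" and j: "j \<le> n" and e: "e \<in> E"
  shows "A_coeff i (A_coeff j e) = A_coeff j (A_coeff i e)"
    and "A_coeff i (B_coeff j e) + B_coeff i (A_coeff j e) = A_coeff j (B_coeff i e) + B_coeff j (A_coeff i e)"
    and "B_coeff i (B_coeff j e) = B_coeff j (B_coeff i e)"
proof -
  have eM: "e \<in> M" by (rule E_M[OF e])
  have "U i (U j (V e)) = U j (U i (V e))"
    using V_intertwines[OF i mem0(1)[OF j eM]] V_intertwines[OF j mem0(1)[OF i eM]]
      V_intertwines[OF i eM] V_intertwines[OF j eM] comm0(1)[OF i j, of e] by simp
  then have eq: "coord (U i (U j (V e))) m = coord (U j (U i (V e))) m" for m by simp
  show "A_coeff i (A_coeff j e) = A_coeff j (A_coeff i e)"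
    using eq[of 0] i j by (simp add: coord_U coord_V_E[OF e] coeff_lin)
  show "A_coeff i (B_coeff j e) + B_coeff i (A_coeff j e) = A_coeff j (B_coeff i e) + B_coeff j (A_coeff i e)"
    using eq[of 1] i j by (simp add: coord_U coord_V_E[OF e] coeff_lin)
  show "B_coeff i (B_coeff j e) = B_coeff j (B_coeff i e)"
    using eq[of 2] i j by (simp add: coord_U coord_V_E[OF e] coeff_lin)
qed

lemma U_comm:
  assumes i: "i \<le> n" and j: "j \<le> n" and f: "f \<in> K"
  shows "U i (U j f) = U j (U i f)"
proof (rule coord_eqI)
  fix m
  have mem: "coord f l \<in> E" for l using f by (simp add: ell2_over_coord)
  have expand: "coord (U i (U j f)) m = A_coeff i (A_coeff j (coord f m))
      + (A_coeff i (B_coeff j (coord f (m - 1))) + B_coeff i (A_coeff j (coord f (m - 1))))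
      + B_coeff i (B_coeff j (coord f (m - 2)))" if "i \<le> n" "j \<le> n" for i j
    using that by (simp add: coord_U coeff_lin)
  show "coord (U i (U j f)) m = coord (U j (U i f)) m"
    unfolding expand[OF i j] expand[OF j i] using coeff_comm[OF i j mem] by simp
qed

text \<open>The adjoint \<open>W\<inverse> U\<^bsub>n-i\<^esub>\<close> of \<open>U\<^sub>i\<close>, with \<open>W\<close> the bilateral shift.\<close>

abbreviation U' where "U' i f \<equiv> shift_ell2 (- 1) (U (n - i) f)"

lemma inner_U:
  assumes i: "i \<le> n" and f: "f \<in> K" and g: "g \<in> K"
  shows "inner (U i f) g = inner f (U' i g)"
proof -
  have i': "n - i \<le> n" by simp
  have "inner (ell2_map (A_coeff i) f) g = inner f (ell2_map (B_coeff (n - i)) g)"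
    by (rule inner_ell2_map[OF op_coeff(1)[OF i] op_coeff(2)[OF i'] inner_coeff(1)[OF i] f g])
  moreover have "inner (ell2_map (B_coeff i) (shift_ell2 1 f)) g
      = inner f (shift_ell2 (- 1) (ell2_map (A_coeff (n - i)) g))"
    using inner_ell2_map[OF op_coeff(2)[OF i] op_coeff(1)[OF i'] inner_coeff(2)[OF i] shift_mem[OF f] g]
    by (simp add: inner_shift)
  moreover have "U' i g = ell2_map (B_coeff (n - i)) g + shift_ell2 (- 1) (ell2_map (A_coeff (n - i)) g)"
    by (rule coord_eqI) (simp add: coord_U coord_map op_coeff)
  ultimately show ?thesis by (simp add: U_def inner_add_left inner_add_right)
qed

lemma tuple_U: "commuting_tuple n K U"
  unfolding commuting_tuple_def
  using closed_csubspace_ell2_over[OF closed_csubspace_E] U_comm op_U U_mem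
  by (auto intro: bounded_op_restrict)

lemma U_U'_comm: "i \<le> n \<Longrightarrow> j \<le> n \<Longrightarrow> f \<in> K \<Longrightarrow> U i (U' j f) = U' j (U i f)"
  by (simp add: U_shift U_comm)

lemma normal_U:
  assumes i: "i \<in> {1..n}"
  shows "normal_op K (U i)"
proof -
  have i': "i \<le> n" using i by simp
  have "adj K (U i) f = U' i f" if "f \<in> K" for f
    using op_U[OF i'] that
    by (intro adj_eqI closed_csubspace_ell2_over closed_csubspace_E shift_mem U_mem inner_U i')
       (auto simp: bounded_op_def clinear_on_def)
  then show ?thesis
    using tuple_U i i' by (simp add: normal_op_def commuting_tuple_def U_mem U_U'_comm)
qed

text \<open>
  Translates \<open>W\<^bsup>-j\<^esup> V M\<close> of the embedded space are dense in \<open>K\<close>; estimates for the tuple on \<open>M\<close>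
  pass to the extension, because the \<open>U\<^sub>i\<close> commute with the bilateral shift \<open>W\<close>.
\<close>

definition translates where "translates = {f. \<exists>j::nat. \<exists>x\<in>M. shift_ell2 (int j) f = V x}"

lemma shift_V: "x \<in> M \<Longrightarrow> shift_ell2 (int l) (V x) = V ((T n ^^ l) x)"
proof (induction l)
  case (Suc l)
  note mem = T_pow_mem[OF Suc.prems]
  have "shift_ell2 (int (Suc l)) (V x) = shift_ell2 1 (V ((T n ^^ l) x))"
    using Suc by (simp add: shift_shift flip: Suc.IH)
  also have "\<dots> = V (T n ((T n ^^ l) x))"
    using V_intertwines[of n, OF _ mem] U_n[OF V_mem[OF mem]] n2 by (simp add: T0_def)
  finally show ?case by simp
qed (simp add: shift_0)

lemma translates_add:
  assumes "f \<in> translates" "g \<in> translates"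
  shows "f + g \<in> translates"
proof -
  obtain j x l y where jx: "x \<in> M" "shift_ell2 (int j) f = V x" and ly: "y \<in> M" "shift_ell2 (int l) g = V y"
    using assms by (auto simp: translates_def)
  note mem = T_pow_mem[OF jx(1)] T_pow_mem[OF ly(1)]
  have "shift_ell2 (int (j + l)) (f + g)
      = shift_ell2 (int l) (shift_ell2 (int j) f) + shift_ell2 (int j) (shift_ell2 (int l) g)"
    by (simp add: shift_shift shift_add add.commute)
  also have "\<dots> = V ((T n ^^ l) x) + V ((T n ^^ j) y)"
    by (simp only: jx(2) ly(2) shift_V jx(1) ly(1))
  also have "\<dots> = V ((T n ^^ l) x + (T n ^^ j) y)"
    using V_linear mem by (simp add: clinear_on_def)
  finally show ?thesis using mem subspace_add[OF sM] unfolding translates_def by blast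
qed

text \<open>
  A sequence supported at one index is a translate of \<open>V e\<close>, and finitely many of them can be moved to
  nonnegative indices simultaneously.
\<close>

lemma truncate_translates:
  assumes f: "f \<in> K"
  shows "truncate N f \<in> translates"
proof (induction N)
  case 0
  have "truncate 0 f = 0" by (rule ell2_eqI) (simp add: truncate_nth)
  moreover have "V 0 = 0"
    using norm_V[of 0] subspace_0[OF sM] by simp
  moreover have "shift_ell2 (int 0) (0 :: 'a ell2) = 0" by (simp add: shift_0)
  ultimately show ?case unfolding translates_def using subspace_0[OF sM] by (metis (mono_tags) mem_Collect_eq)
next
  case (Suc N)
  define m where "m = int_decode N"
  define e where "e = ell2_nth f N"
  have e: "e \<in> E" using f by (simp add: e_def ell2_over_def)
  define s where "s = shift_ell2 m (V e)"
  have "truncate (Suc N) f = truncate N f + s"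
  proof (rule ell2_eqI)
    fix k
    have "ell2_nth s k = coord s (int_decode k)" by (simp add: coord_def)
    also have "\<dots> = (if k = N then e else 0)"
      by (simp add: s_def m_def coord_V_E[OF e] inj_eq[OF bij_is_inj[OF bij_int_decode]])
    finally show "ell2_nth (truncate (Suc N) f) k = ell2_nth (truncate N f + s) k"
      by (simp add: truncate_nth e_def less_Suc_eq)
  qed
  moreover have "s \<in> translates"
  proof -
    have "shift_ell2 (int (nat (- m))) s = shift_ell2 (int (nat m)) (V e)"
      unfolding s_def shift_shift by (rule arg_cong[of _ _ "\<lambda>j. shift_ell2 j (V e)"]) simp
    also have "\<dots> = V ((T n ^^ nat m) e)" by (rule shift_V[OF E_M[OF e]])
    finally have "shift_ell2 (int (nat (- m))) s = V ((T n ^^ nat m) e)" .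
    then show ?thesis using T_pow_mem[OF E_M[OF e]] unfolding translates_def by blast
  qed
  ultimately show ?case using Suc translates_add by simp
qed

lemma bounded_linear_root_U: "bounded_linear (root_op n u U)"
proof -
  have U: "bounded_linear (\<lambda>f. (- u) ^ i *\<^sub>C U i f)" if "i \<in> {1..n}" for i
    by (rule bounded_linear_compose_scaleC[OF bounded_op_UNIV_linear[OF op_U]]) (use that in simp)
  show ?thesis
    unfolding affine_op_def[abs_def]
    by (rule bounded_linear_add[OF bounded_linear_scaleC bounded_linear_sum[OF U]])
qed

lemma root_U_V:
  assumes x: "x \<in> M"
  shows "root_op n u U (V x) = V (root_op n u T x)"
proof -
  interpret d: contraction_pair "D n" "T n" by (rule dual)
  let ?v = "\<lambda>m x. if 0 \<le> m then Q ((D n ^^ nat m) x) else 0"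
  have lin: "bounded_op UNIV (?v m)" for m
  proof (cases "0 \<le> m")
    case True
    then show ?thesis
      using bounded_linear_compose[OF linears(1) bounded_op_UNIV_linear[OF d.bounded_op_pow]]
      by (intro bounded_op_UNIV_I) (auto simp: bounded_op_UNIV_scaleC[OF opQ]
          bounded_op_UNIV_scaleC[OF d.bounded_op_pow])
  qed (auto intro!: bounded_op_UNIV_I bounded_linear_zero simp: scaleC_zero_right)
  note linear_v = bounded_linear.linear[OF bounded_op_UNIV_linear[OF lin]]
  have Tx: "T i x \<in> M" if "i \<in> {1..n}" for i using red x that by (simp add: reducing_def)
  have "root_op n u T x \<in> M"
    unfolding affine_op_def using cM Tx x
    by (intro subspace_add[OF sM] subspace_sum[OF sM]) (auto simp: closed_csubspace_def)
  then have "coord (V (root_op n u T x)) m = ?v m (root_op n u T x)" for m by (rule coord_V)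
  also have "?v m (root_op n u T x) = ?v m x + (\<Sum>i=1..n. (- u) ^ i *\<^sub>C ?v m (T i x))" for m
    unfolding affine_op_def linear_add[OF linear_v] linear_sum[OF linear_v]
      bounded_op_UNIV_scaleC[OF lin] by simp
  also have "\<dots> m = coord (root_op n u U (V x)) m" for m
  proof -
    have "coord (U i (V x)) m = ?v m (T i x)" if "i \<in> {1..n}" for i
      using V_intertwines[of i x] x that coord_V[OF Tx[OF that]] by (simp add: T0_def)
    then show ?thesis
      unfolding affine_op_def by (simp add: coord_sum coord_V x)
  qed
  finally show ?thesis by (intro coord_eqI) simp
qed

lemma root_U_shift: "root_op n u U (shift_ell2 j f) = shift_ell2 j (root_op n u U f)"
proof (rule coord_eqI)
  show "coord (root_op n u U (shift_ell2 j f)) m = coord (shift_ell2 j (root_op n u U f)) m" for m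
    by (simp add: affine_op_def coord_sum U_shift)
qed

lemma root_U_below:
  assumes below: "\<And>x. x \<in> M \<Longrightarrow> norm x \<le> C * norm (root_op n u T x)" and f: "f \<in> K"
  shows "norm f \<le> C * norm (root_op n u U f)"
proof -
  have RM: "root_op n u T x \<in> M" if "x \<in> M" for x
    unfolding affine_op_def using cM that red
    by (intro subspace_add[OF sM] subspace_sum[OF sM]) (auto simp: closed_csubspace_def reducing_def)
  have *: "norm g \<le> C * norm (root_op n u U g)" if g: "g \<in> translates" for g
  proof -
    obtain j x where x: "x \<in> M" and j: "shift_ell2 (int j) g = V x" using g by (auto simp: translates_def)
    have "norm g = norm x" using norm_V[OF x] by (simp flip: j)
    moreover have "norm (root_op n u U g) = norm (root_op n u U (shift_ell2 (int j) g))"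
      by (simp add: root_U_shift)
    moreover have "\<dots> = norm (root_op n u T x)"
      by (simp add: j root_U_V[OF x] norm_V RM[OF x])
    ultimately show ?thesis using below[OF x] by simp
  qed
  have lim: "(\<lambda>N. truncate N f) \<longlonglongrightarrow> f" by (rule truncate_tendsto)
  show ?thesis
  proof (rule LIMSEQ_le)
    show "(\<lambda>N. norm (truncate N f)) \<longlonglongrightarrow> norm f" by (rule tendsto_norm[OF lim])
    show "(\<lambda>N. C * norm (root_op n u U (truncate N f))) \<longlonglongrightarrow> C * norm (root_op n u U f)"
      by (intro tendsto_mult tendsto_const tendsto_norm bounded_linear.tendsto[OF bounded_linear_root_U lim])
    show "\<exists>N. \<forall>k\<ge>N. norm (truncate k f) \<le> C * norm (root_op n u U (truncate k f))"
      using *[OF truncate_translates[OF f]] by blast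
  qed
qed

text \<open>
  The lower bound on \<open>M\<close> extends to \<open>K\<close> by density of the translates, and the operator is normal.
\<close>

lemma root_U_bij:
  assumes below: "\<And>x. x \<in> M \<Longrightarrow> norm x \<le> C * norm (root_op n u T x)"
  shows "bij_betw (root_op n u U) K K"
proof -
  have cK: "closed_csubspace K" by (rule closed_csubspace_ell2_over[OF closed_csubspace_E])
  have sK: "subspace K" by (rule closed_csubspace_subspace[OF cK])
  have scK: "a *\<^sub>C f \<in> K" if "f \<in> K" for a f using cK that by (simp add: closed_csubspace_def)
  define N' where "N' f = f + (\<Sum>i=1..n. cnj ((- u) ^ i) *\<^sub>C U' i f)" for f
  note lin = linear_add[OF bounded_linear.linear[OF bounded_op_UNIV_linear]]
    linear_sum[OF bounded_linear.linear[OF bounded_op_UNIV_linear]] bounded_op_UNIV_scaleC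
  show ?thesis
  proof (rule normal_bounded_below_surj[where N' = N' and C = C])
    show "closed K" using cK by (simp add: closed_csubspace_def)
    show "root_op n u U f \<in> K" if "f \<in> K" for f
      unfolding affine_op_def using that
      by (intro subspace_add[OF sK] subspace_sum[OF sK] scK U_mem) auto
    show "N' f \<in> K" if "f \<in> K" for f
      unfolding N'_def using that
      by (intro subspace_add[OF sK] subspace_sum[OF sK] scK shift_mem U_mem) auto
    show "inner (root_op n u U f) g = inner f (N' g)" if fg: "f \<in> K" "g \<in> K" for f g
    proof -
      have "inner (c *\<^sub>C U i f) g = inner f (cnj c *\<^sub>C U' i g)" if "i \<in> {1..n}" for c i
        using inner_U[of i f "cnj c *\<^sub>C g"] fg scK that
        by (simp add: inner_scaleC_left lin(3)[OF op_U] shift_scaleC)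
      then show ?thesis
        unfolding affine_op_def N'_def inner_add_left inner_add_right inner_sum_left inner_sum_right
        by simp
    qed
    show "root_op n u U (N' f) = N' (root_op n u U f)" if f: "f \<in> K" for f
    proof -
      note lin_root = bounded_linear.linear[OF bounded_linear_root_U[of u]]
      have scale: "root_op n u U (a *\<^sub>C g) = a *\<^sub>C root_op n u U g" for a g
        unfolding affine_op_def by (simp add: scaleC_add_right scaleC_sum_right lin(3)[OF op_U] scaleC_scaleC mult.commute)
      have "root_op n u U (U' j f) = U' j (root_op n u U f)" if j: "j \<in> {1..n}" for j
        unfolding affine_op_def using f j
        by (simp add: U_U'_comm lin[OF op_U] lin[OF bounded_op_shift] U_shift U_comm)
      then show ?thesis
        unfolding N'_def linear_add[OF lin_root] linear_sum[OF lin_root] scale by simp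
    qed
  qed (use sK bounded_linear_root_U root_U_below[OF below] in auto)
qed

lemma gamma_isometry_on_shift:
  assumes below: "\<And>u. cmod u < 1 \<Longrightarrow> \<exists>C. \<forall>x\<in>M. norm x \<le> C * norm (root_op n u T x)"
  shows "gamma_isometry n M T"
proof -
  have cK: "closed_csubspace K" by (rule closed_csubspace_ell2_over[OF closed_csubspace_E])
  have "taylor_spectrum n K U \<subseteq> bGam n"
  proof (rule taylor_spectrum_subset_bGam[OF tuple_U])
    show "bij_betw (root_op n u U) K K" if "cmod u < 1" for u
      using below[OF that] root_U_bij by blast
    show "bij_betw (\<lambda>f. U n f - l *\<^sub>C f) K K" if "cmod l < 1" for l
    proof (rule unitary_minus_scalar_bij[where D = "shift_ell2 (- 1)"])
      show "bounded_op K (U n)" using tuple_U n_mem by (auto simp: commuting_tuple_def)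
    qed (use cK that in \<open>auto simp: U_n shift_mem shift_shift shift_0\<close>)
  qed
  then have "gamma_unitary n K U" using tuple_U normal_U by (simp add: gamma_unitary_def)
  moreover have "V (T i x) = U i (V x)" if "i \<in> {1..n}" "x \<in> M" for i x
    using V_intertwines[of i x] that by (simp add: T0_def)
  ultimately show ?thesis
    unfolding gamma_isometry_def using cM red V_linear V_mem norm_V unfolding reducing_def by blast
qed

end

section \<open>The decomposition\<close>

lemma strongly_stable_iff: "strongly_stable M P \<longleftrightarrow> M \<subseteq> stable_vectors P"
  by (auto simp: strongly_stable_def stable_vectors_def tendsto_norm_zero_iff)

lemma strongly_stable_cong:
  assumes "\<And>x. x \<in> M \<Longrightarrow> P x = R x" "\<And>x. x \<in> M \<Longrightarrow> R x \<in> M"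
  shows "strongly_stable M P \<longleftrightarrow> strongly_stable M R"
proof -
  have "(P ^^ k) x = (R ^^ k) x \<and> (R ^^ k) x \<in> M" if "x \<in> M" for k x
    by (induction k) (use assms that in auto)
  then show ?thesis by (simp add: strongly_stable_def)
qed

context gamma_pair
begin

lemma strongly_stable_adj:
  assumes red: "reducing n T D M"
  shows "strongly_stable M (adj M (T n)) \<longleftrightarrow> M \<subseteq> stable_vectors (D n)"
proof -
  have "adj M (T n) x = D n x" if "x \<in> M" for x
    by (rule adj_on_reducing[OF red n_mem op(1)[OF n_mem] adj_T[OF n_mem] that])
  then have "strongly_stable M (adj M (T n)) \<longleftrightarrow> strongly_stable M (D n)"
    using red n_mem by (intro strongly_stable_cong) (auto simp: reducing_def)
  then show ?thesis by (simp add: strongly_stable_iff)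
qed

lemma pure_gamma_isometry_on_shift_part:
  assumes gc: "gamma_contraction n UNIV T" and idem: "A = A \<circ> A"
  shows "pure_gamma_isometry n (isometric_vectors (T n) \<inter> stable_vectors (D n)) T"
proof -
  let ?M = "isometric_vectors (T n) \<inter> stable_vectors (D n)"
  have red: "reducing n T D ?M" by (rule reducing_shift_part[OF idem])
  interpret gamma_shift n T D ?M by unfold_locales (use red in auto)
  have sp: "spectral_set n (Gam n) UNIV T" using gc by (simp add: gamma_contraction_def)
  have "gamma_isometry n ?M T"
    using root_op_bij(2)[OF sp] by (intro gamma_isometry_on_shift) blast
  moreover have "gamma_contraction n ?M T"
    by (rule gamma_contraction_restrict[OF gc red adj_T])
  ultimately show ?thesis
    using strongly_stable_adj[OF red] by (simp add: pure_gamma_isometry_def pure_gamma_contraction_def)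
qed

lemma backward_shift_restrict:
  assumes red: "reducing n T D M" and M: "M \<subseteq> stable_vectors (T n)" "M \<subseteq> isometric_vectors (D n)"
  shows "backward_shift M (T n)"
proof -
  interpret d: gamma_pair n D T by (rule gamma_pair_dual)
  have red': "reducing n D T M" using red by (simp add: reducing_commute)
  have "bounded_op M (D n)"
    using red n_mem by (intro bounded_op_restrict[OF opD]) (auto simp: reducing_def)
  moreover have "\<forall>x\<in>M. norm (D n x) = norm x" using M(2) d.norm_isometric_vectors by blast
  moreover have "strongly_stable M (adj M (D n))" using M(1) d.strongly_stable_adj[OF red'] by blast
  ultimately have "unilateral_shift M (D n)" by (simp add: unilateral_shift_def)
  moreover have "T n x = adj M (D n) x" if "x \<in> M" for x
    by (rule adj_on_reducing[OF red' n_mem opD d.adj_T[OF n_mem] that, symmetric])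
  ultimately show ?thesis unfolding backward_shift_def by blast
qed

lemma reduces_if_reducing:
  assumes "reducing n T D M" "i \<in> {1..n}" "\<And>x. D i x = adj UNIV (T i) x"
  shows "reduces M (T i)"
  using assms(1,2) by (simp add: reducing_def reduces_def flip: assms(3))

end

theorem theorem4p7:
  fixes n :: nat
    and S :: "nat \<Rightarrow> 'a::complex_hilbert \<Rightarrow> 'a"
    and P A A_star :: "'a \<Rightarrow> 'a"
    and T :: "nat \<Rightarrow> 'a \<Rightarrow> 'a"
  assumes n: "n \<ge> 2"
    and T: "T = S(n := P)"
    and contr: "gamma_contraction n UNIV T"
    and A: "A = strong_limit (\<lambda>k x. (adj UNIV P ^^ k) ((P ^^ k) x))"
    and A_star: "A_star = strong_limit (\<lambda>k x. (P ^^ k) ((adj UNIV P ^^ k) x))"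
  shows
    "(A = A \<circ> A \<longrightarrow>
       (\<forall>i\<in>{1..n-1}.
          reduces (kernel A) (S i) \<and>
          reduces (kernel (\<lambda>x. x - A x) \<inter> kernel A_star) (S i) \<and>
          reduces (kernel (\<lambda>x. x - A x) \<inter> kernel (\<lambda>x. x - A_star x)) (S i)) \<and>
       strongly_stable_gamma_contraction n (kernel A) T \<and>
       pure_gamma_isometry n (kernel (\<lambda>x. x - A x) \<inter> kernel A_star) T \<and>
       gamma_unitary n (kernel (\<lambda>x. x - A x) \<inter> kernel (\<lambda>x. x - A_star x)) T) \<and>
     (A = A \<circ> A \<and> A_star = A_star \<circ> A_star \<longrightarrow>
       C00_gamma_contraction n (kernel A \<inter> kernel A_star) T \<and>
       gamma_contraction n (kernel A \<inter> kernel (\<lambda>x. x - A_star x)) T \<and>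
       backward_shift (kernel A \<inter> kernel (\<lambda>x. x - A_star x)) P) \<and>
     (A = A_star \<longrightarrow>
       C00_gamma_contraction n (kernel A) T \<and>
       gamma_unitary n (kernel (\<lambda>x. x - A x)) T)"
proof -
  note gc = contr
  define D where "D i = adj UNIV (T i)" for i
  have Ti: "T i = S i" if "i \<in> {1..n-1}" for i
    using T that n by auto
  have Tn: "T n = P" using T by simp
  interpret gamma_pair n T D
    unfolding D_def[abs_def] by (rule gamma_contraction_imp_gamma_pair[OF gc n])
  interpret d: gamma_pair n D T by (rule gamma_pair_dual)
  have A_eq: "A = asymptotic_limit (T n) (D n)" and A_star_eq: "A_star = asymptotic_limit (D n) (T n)"
    unfolding A A_star asymptotic_limit_def D_def Tn by simp_all
  have ker: "kernel A = stable_vectors (T n)" "kernel (\<lambda>x. x - A x) = isometric_vectors (T n)"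
    "kernel A_star = stable_vectors (D n)" "kernel (\<lambda>x. x - A_star x) = isometric_vectors (D n)"
    unfolding A_eq A_star_eq
    by (rule kernel_A kernel_I_minus_A d.kernel_A d.kernel_I_minus_A)+
  note restrict = gamma_contraction_restrict[OF gc _ adj_T]
  have C00: "C00_gamma_contraction n M T"
    if "reducing n T D M" "M \<subseteq> stable_vectors (T n)" "M \<subseteq> stable_vectors (D n)" for M
    using that restrict strongly_stable_adj[OF that(1)]
    by (simp add: C00_gamma_contraction_def strongly_stable_iff)
  have 1: "(\<forall>i\<in>{1..n-1}.
          reduces (kernel A) (S i) \<and>
          reduces (kernel (\<lambda>x. x - A x) \<inter> kernel A_star) (S i) \<and>
          reduces (kernel (\<lambda>x. x - A x) \<inter> kernel (\<lambda>x. x - A_star x)) (S i)) \<and>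
       strongly_stable_gamma_contraction n (kernel A) T \<and>
       pure_gamma_isometry n (kernel (\<lambda>x. x - A x) \<inter> kernel A_star) T \<and>
       gamma_unitary n (kernel (\<lambda>x. x - A x) \<inter> kernel (\<lambda>x. x - A_star x)) T"
    if "A = A \<circ> A"
  proof -
    note idem = that[unfolded A_eq]
    have "reduces M (S i)" if "i \<in> {1..n-1}" "reducing n T D M" for i M
    proof -
      have "i \<in> {1..n}" using that(1) by auto
      from reduces_if_reducing[OF that(2) this] show ?thesis by (simp add: D_def Ti[OF that(1)])
    qed
    then show ?thesis
      using restrict[OF reducing_stable[OF idem]] pure_gamma_isometry_on_shift_part[OF gc idem]
        gamma_unitary_on_unitary_part[OF gc idem] reducing_stable[OF idem]
        reducing_shift_part[OF idem] reducing_unitary_part[OF idem]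
      unfolding ker by (simp add: strongly_stable_gamma_contraction_def strongly_stable_iff)
  qed
  moreover have "C00_gamma_contraction n (kernel A \<inter> kernel A_star) T \<and>
       gamma_contraction n (kernel A \<inter> kernel (\<lambda>x. x - A_star x)) T \<and>
       backward_shift (kernel A \<inter> kernel (\<lambda>x. x - A_star x)) P"
    if "A = A \<circ> A \<and> A_star = A_star \<circ> A_star"
  proof -
    note idem = that[unfolded A_eq A_star_eq, THEN conjunct1] that[unfolded A_eq A_star_eq, THEN conjunct2]
    note red = reducing_stable[OF idem(1)] d.reducing_stable[OF idem(2)] d.reducing_isometric[OF idem(2)]
    note red' = red(1) red(2,3)[THEN reducing_commute[THEN iffD1]]
    have "reducing n T D (stable_vectors (T n) \<inter> stable_vectors (D n))"
      "reducing n T D (stable_vectors (T n) \<inter> isometric_vectors (D n))"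
      by (rule reducing_Int[OF red'(1) red'(2)] reducing_Int[OF red'(1) red'(3)])+
    then show ?thesis
      unfolding ker using C00 restrict backward_shift_restrict by (simp add: Tn)
  qed
  moreover have "C00_gamma_contraction n (kernel A) T \<and> gamma_unitary n (kernel (\<lambda>x. x - A x)) T"
    if eq: "A = A_star"
  proof -
    have idem: "A = A \<circ> A"
      using idempotent_if_limits_agree eq unfolding A_eq A_star_eq .
    have "stable_vectors (T n) = stable_vectors (D n)" "isometric_vectors (T n) = isometric_vectors (D n)"
      using ker eq by simp_all
    then show ?thesis
      using C00[OF reducing_stable[OF idem[unfolded A_eq]]] 1[OF idem] unfolding ker by simp
  qed
  ultimately show ?thesis by blast
qed

end
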